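(* Let $(M,\mathcal D,g,\omega)$ be a sub-Riemannian measure manifold of dimension $n$, and denote by the same symbol $g$ a Riemannian metric on $M$ that extends the sub-Riemannian metric. Assume that $p\in M$ is a regular point and consider two privileged orthonormal frames $\mathbf X=(X_1,\dots,X_n)$ and $\mathbf Y=(Y_1,\dots,Y_n)$ in an open neighborhood $W$ of $p$. Let $F_{p,\mathbf X},F_{p,\mathbf Y}\colon V\to W$ be the exponential coordinates of the first kind around $p$ associated with $\mathbf X$ and $\mathbf Y$, respectively, where $V\subset\mathbb R^n$ is an open neighborhood of $0\in\mathbb R^n$. Let $\widehat{\mathbf X}^p=(\widehat X_1^p,\dots,\widehat X_n^p)$ and $\widehat{\mathbf Y}^p=(\widehat Y_1^p,\dots,\widehat Y_n^p)$ denote the nilpotent approximations of $\mathbf X$ and $\mathbf Y$ at $p$. Then the following facts hold: (i) the family of maps $\delta_{1/\varepsilon}\circ F_{p,\mathbf Y}^{-1}\circ F_{p,\mathbf X}\circ\delta_\varepsilon\colon V\to\mathbb R^n$ uniformly converges to the restriction of a linear Euclidean isometry $\widehat L\colon\mathbb R^n\to\mathbb R^n$ as $\varepsilon\to0$; (ii) we have $\widehat L=\mathrm d(F_{p,\mathbf Y}^{-1}\circ F_{p,\mathbf X})(0)$ and the matrix associated with $\widehat L$ is block diagonal; (iii) if $\widehat d_{p,\mathbf X}$ and $\widehat d_{p,\mathbf Y}$ denote the sub-Riemannian distances associated with $\widehat{\mathbf X}^p$ and $\widehat{\mathbf Y}^p$, respectively, then $\widehat d_{p,\mathbf Y}(\widehat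 L(x),\widehat L(y))=\widehat d_{p,\mathbf X}(x,y)$ for every $x,y\in\mathbb R^n$.
   Context: Sub-Riemannian manifolds. Let $M$ be a smooth connected manifold of dimension $n$, let $\mathbf U$ be a Euclidean vector bundle over $M$ (a vector bundle with a smooth scalar product on the fibers) and let $f\colon\mathbf U\to TM$ be a smooth morphism of vector bundles over $M$ (linear on fibers, $f(\mathbf U_p)\subset T_pM$). The horizontal vector fields are $\mathcal D=\{f\circ\sigma:\sigma\in\Gamma(\mathbf U)\}$, and $\mathcal D_p=\{X(p):X\in\mathcal D\}$. Chow's condition $\mathrm{Lie}_p(\mathcal D)=T_pM$ is assumed for all $p\in M$. For $v\in\mathcal D_p$ set $G_p(v)=\min\{|u|_p^2:u\in\mathbf U_p,\ f(u)=v\}$; this is a quadratic form, and the scalar product $g_p$ on $\mathcal D_p$ with $g_p(v,v)=G_p(v)$ defines the sub-Riemannian metric $g$. The triple $(M,\mathcal D,g)$ is a sub-Riemannian manifold. A sub-Riemannian measure manifold $(M,\mathcal D,g,\omega)$ is an oriented sub-Riemannian manifold with a positive (nonvanishing, smooth) volume form $\omega$. Regular points. Set $\mathcal D^1=\mathcal D$, $\mathcal D^{k+1}=\mathcal D^k+[\mathcal D^k,\mathcal D]$, $\mathcal D^k_p=\{X(p):X\in\mathcal D^k\}$. $(M,\mathcal D,g)$ is equiregular of step $s$ if $\mathcal D^s_p=T_pM$ and $\dim\mathcal D^k_p=n_k$ for all $k=1,\dots,s$ and $p\in M$, with $n_k$ independent of $p$; set $n_0=0$ and $m=n_1$. A point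 is regular if it has an open neighborhood that is an equiregular sub-Riemannian manifold with the restricted structure; the numbers $m,n_k,s$ then refer to this neighborhood. Privileged frames. A frame of smooth vector fields $(X_1,\dots,X_n)$ on an open set $W$ (on which the structure is equiregular) is privileged if for every $q\in W$: (a) $(X_1(q),\dots,X_m(q))$ is a basis of $\mathcal D_q$; (b) for $1\le j\le s$ the fields $X_{n_{j-1}+1},\dots,X_{n_j}$ are iterated Lie brackets of $X_1,\dots,X_m$ of length $j$, i.e. of the form $[\dots[[X_{i_1},X_{i_2}],X_{i_3}],\dots,X_{i_j}]$ with $i_1,\dots,i_j\in\{1,\dots,m\}$; (c) for $j=1,\dots,s$, $(X_1(q),\dots,X_{n_j}(q))$ is a basis of $\mathcal D^j_q$. It is a privileged orthonormal frame if in addition it is orthonormal with respect to the Riemannian metric $g$ extending the sub-Riemannian metric. Exponential coordinates. $\exp(X)(p)$ is the time-one flow of $X$ from $p$. The exponential coordinates of the first kind centered at $p$ are given by $F_{p,\mathbf X}(x)=\exp(x_1X_1+\dots+x_nX_n)(p)$, a smooth diffeomorphism from an open neighborhood of $0\in\mathbb R^n$ onto its image. The weight of $x_i$ is $w_i=j$ if $n_{j-1}<i\le n_j$, and $\delta_r(x)=(r^{w_1}x_1,\dots,r^{w_n}x_n)$ for $r>0$. A function $\phi$ is $\delta$-homogeneous of degree $\alpha$ if $\phi(\delta_rx)=r^\alpha\phi(x)$. Nilpotent approximation. Write $\widetilde X_i^p=(F_{p,\mathbf X}^{-1})_*X_i=\sum_{j}a_{ij}^p\partial_j$ near $0$. Let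 $b_{ij}^p$ be the $\delta$-homogeneous part of degree $w_j-w_i$ in the Taylor expansion of $a_{ij}^p$ at $0$ (so $b_{ij}^p=0$ if $w_j<w_i$, and $b_{ij}^p$ is the Kronecker delta of $i,j$ if $w_i=w_j$), and $\widehat X_i^p=\sum_jb_{ij}^p\partial_j$. The frame $\widehat{\mathbf X}^p=(\widehat X_1^p,\dots,\widehat X_n^p)$ on $\mathbb R^n$ is the nilpotent approximation of $\mathbf X$ at $p$; equivalently $\widehat X_i^p=\lim_{r\to0}r^{w_i}(\delta_{1/r})_*\widetilde X_i^p$ in $C^\infty_{\rm loc}$. The distance $\widehat d_{p,\mathbf X}$ is the sub-Riemannian distance on $\mathbb R^n$ for which $(\widehat X_1^p,\dots,\widehat X_m^p)$ is a horizontal orthonormal frame, i.e. the infimum of $\int_0^1|h(t)|\,dt$ over absolutely continuous curves $\gamma\colon[0,1]\to\mathbb R^n$ joining the two points with $\dot\gamma=\sum_{i=1}^mh_i\widehat X_i^p(\gamma)$ a.e.; similarly for $\mathbf Y$.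
   Formalization: In (i) the uniform convergence is proved on every bounded subset of V (on V itself if V is bounded), where the maps are defined once ε is small; for unbounded V uniform convergence on all of V can fail, e.g. for a standard and a slightly rotated frame of the flat plane. *)

theory Defs
  imports "HOL-Analysis.Analysis"
begin

section \<open>Smooth maps between normed spaces\<close>

text \<open>These notions are only used on open sets.\<close>

primrec Ck_on :: "nat \<Rightarrow> 'v::real_normed_vector set \<Rightarrow> ('v \<Rightarrow> 'w::real_normed_vector) \<Rightarrow> bool" where
  "Ck_on 0 S h \<longleftrightarrow> continuous_on S h"
| "Ck_on (Suc k) S h \<longleftrightarrow>
     (\<forall>x\<in>S. h differentiable (at x)) \<and> (\<forall>v. Ck_on k S (\<lambda>x. frechet_derivative h (at x) v))"

definition smooth_on :: "'v::real_normed_vector set \<Rightarrow> ('v \<Rightarrow> 'w::real_normed_vector) \<Rightarrow> bool" where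
  "smooth_on S h \<longleftrightarrow> (\<forall>k. Ck_on k S h)"

section \<open>Smooth manifolds\<close>

text \<open>The manifold is the whole type \<open>'a\<close>, modelled on \<open>real ^ 'n\<close>. The index type \<open>'n\<close> is
  linearly ordered, so that frames and coordinates come in an order;
  \<open>pos i\<close> is the place of \<open>i\<close> in \<open>{1..n}\<close>.\<close>

type_synonym ('a, 'n) chart = "'a set \<times> ('a \<Rightarrow> real ^ 'n)"

definition pos :: "'n::{finite,linorder} \<Rightarrow> nat" where
  "pos i = card {..i}"

abbreviation chart_inv :: "('a, 'n::finite) chart \<Rightarrow> real ^ 'n \<Rightarrow> 'a" where
  "chart_inv c \<equiv> inv_into (fst c) (snd c)"

definition is_chart :: "('a::topological_space, 'n::finite) chart \<Rightarrow> bool" where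
  "is_chart c \<longleftrightarrow> open (fst c) \<and> open (snd c ` fst c) \<and>
     homeomorphism (fst c) (snd c ` fst c) (snd c) (chart_inv c)"

definition smooth_atlas :: "('a::topological_space, 'n::finite) chart set \<Rightarrow> bool" where
  "smooth_atlas A \<longleftrightarrow> (\<forall>c\<in>A. is_chart c) \<and> (\<Union>c\<in>A. fst c) = UNIV \<and>
     (\<forall>c\<in>A. \<forall>c'\<in>A. smooth_on (snd c ` (fst c \<inter> fst c')) (snd c' \<circ> chart_inv c))"

definition smooth_fun :: "('a, 'n::finite) chart set \<Rightarrow> 'a set \<Rightarrow> ('a \<Rightarrow> 'w::real_normed_vector) \<Rightarrow> bool" where
  "smooth_fun A W h \<longleftrightarrow> (\<forall>c\<in>A. smooth_on (snd c ` (W \<inter> fst c)) (h \<circ> chart_inv c))"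

text \<open>The tangent space at \<open>p\<close> is \<open>real ^ 'n\<close>: a tangent vector is given by its components in a
  chart \<open>chart_at A p\<close> chosen once and for all at \<open>p\<close>. As \<open>p\<close> varies these choices are in no way
  continuous, so regularity is always expressed through the components in a fixed chart.\<close>

definition chart_at :: "('a, 'n::finite) chart set \<Rightarrow> 'a \<Rightarrow> ('a, 'n) chart" where
  "chart_at A p = (SOME c. c \<in> A \<and> p \<in> fst c)"

definition coord_change ::
  "('a, 'n::finite) chart \<Rightarrow> ('a, 'n) chart \<Rightarrow> 'a \<Rightarrow> real ^ 'n \<Rightarrow> real ^ 'n" where
  "coord_change c c' p v = frechet_derivative (snd c' \<circ> chart_inv c) (at (snd c p)) v"

definition components ::
  "('a, 'n::finite) chart set \<Rightarrow> ('a, 'n) chart \<Rightarrow> 'a \<Rightarrow> real ^ 'n \<Rightarrow> real ^ 'n" where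
  "components A c p v = coord_change (chart_at A p) c p v"

definition of_components ::
  "('a, 'n::finite) chart set \<Rightarrow> ('a, 'n) chart \<Rightarrow> 'a \<Rightarrow> real ^ 'n \<Rightarrow> real ^ 'n" where
  "of_components A c p a = coord_change c (chart_at A p) p a"

definition differential ::
  "('a, 'n::finite) chart set \<Rightarrow> ('a \<Rightarrow> 'w::real_normed_vector) \<Rightarrow> 'a \<Rightarrow> real ^ 'n \<Rightarrow> 'w" where
  "differential A h p v =
     frechet_derivative (h \<circ> chart_inv (chart_at A p)) (at (snd (chart_at A p) p)) v"

text \<open>Vector fields on an open set \<open>W\<close> are total functions whose values outside \<open>W\<close> are irrelevant.\<close>

type_synonym ('a, 'n) vfield = "'a \<Rightarrow> real ^ 'n"

definition field_in_chart ::
  "('a, 'n::finite) chart set \<Rightarrow> ('a, 'n) chart \<Rightarrow> ('a, 'n) vfield \<Rightarrow> real ^ 'n \<Rightarrow> real ^ 'n" where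
  "field_in_chart A c X x = components A c (chart_inv c x) (X (chart_inv c x))"

definition smooth_field :: "('a, 'n::finite) chart set \<Rightarrow> 'a set \<Rightarrow> ('a, 'n) vfield \<Rightarrow> bool" where
  "smooth_field A W X \<longleftrightarrow> (\<forall>c\<in>A. smooth_on (snd c ` (W \<inter> fst c)) (field_in_chart A c X))"

definition bracket ::
  "('a, 'n::finite) chart set \<Rightarrow> ('a, 'n) vfield \<Rightarrow> ('a, 'n) vfield \<Rightarrow> ('a, 'n) vfield" where
  "bracket A X Y q = (let c = chart_at A q in
     frechet_derivative (field_in_chart A c Y) (at (snd c q)) (X q) -
     frechet_derivative (field_in_chart A c X) (at (snd c q)) (Y q))"

definition scalar_product :: "('v::real_vector \<Rightarrow> 'v \<Rightarrow> real) \<Rightarrow> bool" where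
  "scalar_product B \<longleftrightarrow> bilinear B \<and> (\<forall>u v. B u v = B v u) \<and> (\<forall>u. u \<noteq> 0 \<longrightarrow> B u u > 0)"

definition riemannian_metric ::
  "('a, 'n::finite) chart set \<Rightarrow> ('a \<Rightarrow> real ^ 'n \<Rightarrow> real ^ 'n \<Rightarrow> real) \<Rightarrow> bool" where
  "riemannian_metric A g \<longleftrightarrow> (\<forall>p. scalar_product (g p)) \<and>
     (\<forall>c\<in>A. \<forall>a b. smooth_fun A (fst c) (\<lambda>p. g p (of_components A c p a) (of_components A c p b)))"

definition oriented_atlas :: "('a::topological_space, 'n::finite) chart set \<Rightarrow> bool" where
  "oriented_atlas A \<longleftrightarrow> smooth_atlas A \<and>
     (\<forall>c\<in>A. \<forall>c'\<in>A. \<forall>p\<in>fst c \<inter> fst c'. det (matrix (coord_change c c' p)) > 0)"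

definition positive_volume_form ::
  "('a, 'n::finite) chart set \<Rightarrow> ('a \<Rightarrow> ('n \<Rightarrow> real ^ 'n) \<Rightarrow> real) \<Rightarrow> bool" where
  "positive_volume_form A \<omega> \<longleftrightarrow>
     (\<forall>p v i. linear (\<lambda>u. \<omega> p (v(i := u)))) \<and>
     (\<forall>p v i j. i \<noteq> j \<and> v i = v j \<longrightarrow> \<omega> p v = 0) \<and>
     (\<forall>c\<in>A. smooth_fun A (fst c) (\<lambda>p. \<omega> p (\<lambda>i. of_components A c p (axis i 1))) \<and>
             (\<forall>p\<in>fst c. \<omega> p (\<lambda>i. of_components A c p (axis i 1)) > 0))"

section \<open>Sub-Riemannian manifolds\<close>

text \<open>The Euclidean bundle \<open>U\<close> has as fibre over each point a copy of the vector space \<open>'e\<close> (the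
  linear identifications being arbitrary, as for tangent spaces). A local trivialization is a pair
  \<open>(P, \<Phi>)\<close> with \<open>P\<close> open and \<open>\<Phi> p\<close> a linear isomorphism from the fibre over \<open>p \<in> P\<close> onto the model
  fibre \<open>'e\<close>; the smooth structure of \<open>U\<close> is the one determined by the trivializations.\<close>

record ('a, 'n, 'e) sr_structure =
  atlas :: "('a, 'n) chart set"
  trivs :: "('a set \<times> ('a \<Rightarrow> 'e \<Rightarrow> 'e)) set"
  fib_inner :: "'a \<Rightarrow> 'e \<Rightarrow> 'e \<Rightarrow> real"
  anchor :: "'a \<Rightarrow> 'e \<Rightarrow> real ^ 'n"

definition euclidean_bundle ::
  "('a::topological_space, 'n::finite, 'e::euclidean_space) sr_structure \<Rightarrow> bool" where
  "euclidean_bundle S \<longleftrightarrow>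
     (\<forall>(P, \<Phi>)\<in>trivs S. open P \<and> (\<forall>p\<in>P. linear (\<Phi> p) \<and> bij (\<Phi> p))) \<and>
     (\<Union>(P, \<Phi>)\<in>trivs S. P) = UNIV \<and>
     (\<forall>(P, \<Phi>)\<in>trivs S. \<forall>(Q, \<Psi>)\<in>trivs S. \<forall>u. smooth_fun (atlas S) (P \<inter> Q) (\<lambda>p. \<Psi> p (inv (\<Phi> p) u))) \<and>
     (\<forall>p. scalar_product (fib_inner S p)) \<and>
     (\<forall>(P, \<Phi>)\<in>trivs S. \<forall>u v.
        smooth_fun (atlas S) P (\<lambda>p. fib_inner S p (inv (\<Phi> p) u) (inv (\<Phi> p) v)))"

definition bundle_morphism ::
  "('a::topological_space, 'n::finite, 'e::euclidean_space) sr_structure \<Rightarrow> bool" where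
  "bundle_morphism S \<longleftrightarrow> (\<forall>p. linear (anchor S p)) \<and>
     (\<forall>(P, \<Phi>)\<in>trivs S. \<forall>u. smooth_field (atlas S) P (\<lambda>p. anchor S p (inv (\<Phi> p) u)))"

definition smooth_section ::
  "('a, 'n::finite, 'e::euclidean_space) sr_structure \<Rightarrow> 'a set \<Rightarrow> ('a \<Rightarrow> 'e) \<Rightarrow> bool" where
  "smooth_section S W \<sigma> \<longleftrightarrow> (\<forall>(P, \<Phi>)\<in>trivs S. smooth_fun (atlas S) (W \<inter> P) (\<lambda>p. \<Phi> p (\<sigma> p)))"

text \<open>Horizontal fields of the structure restricted to the open set \<open>W\<close>.\<close>

definition horizontal ::
  "('a, 'n::finite, 'e::euclidean_space) sr_structure \<Rightarrow> 'a set \<Rightarrow> ('a, 'n) vfield set" where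
  "horizontal S W = {X. \<exists>\<sigma>. smooth_section S W \<sigma> \<and> (\<forall>q\<in>W. X q = anchor S q (\<sigma> q))}"

inductive_set lie_hull ::
  "('a, 'n::finite) chart set \<Rightarrow> ('a, 'n) vfield set \<Rightarrow> ('a, 'n) vfield set"
  for A :: "('a, 'n) chart set" and D :: "('a, 'n) vfield set" where
  base: "X \<in> D \<Longrightarrow> X \<in> lie_hull A D"
| add: "X \<in> lie_hull A D \<Longrightarrow> Y \<in> lie_hull A D \<Longrightarrow> (\<lambda>q. X q + Y q) \<in> lie_hull A D"
| scale: "X \<in> lie_hull A D \<Longrightarrow> (\<lambda>q. r *\<^sub>R X q) \<in> lie_hull A D"
| bracket: "X \<in> lie_hull A D \<Longrightarrow> Y \<in> lie_hull A D \<Longrightarrow> bracket A X Y \<in> lie_hull A D"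

definition sub_riemannian_manifold ::
  "('a::{t2_space,second_countable_topology}, 'n::finite, 'e::euclidean_space) sr_structure \<Rightarrow> bool" where
  "sub_riemannian_manifold S \<longleftrightarrow> connected (UNIV :: 'a set) \<and> smooth_atlas (atlas S) \<and>
     euclidean_bundle S \<and> bundle_morphism S \<and>
     (\<forall>p. {X p | X. X \<in> lie_hull (atlas S) (horizontal S UNIV)} = UNIV)"

definition sub_riemannian_measure_manifold ::
  "('a::{t2_space,second_countable_topology}, 'n::finite, 'e::euclidean_space) sr_structure \<Rightarrow>
   ('a \<Rightarrow> ('n \<Rightarrow> real ^ 'n) \<Rightarrow> real) \<Rightarrow> bool" where
  "sub_riemannian_measure_manifold S \<omega> \<longleftrightarrow> sub_riemannian_manifold S \<and>
     oriented_atlas (atlas S) \<and> positive_volume_form (atlas S) \<omega>"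

text \<open>\<open>flag S W k\<close> is $D^k$ over \<open>W\<close>, where \<open>[D\<^sup>k, D]\<close> is the linear span of the brackets
  (coefficients are absorbed, as $D^k$ is closed under scaling). Index 0 is the zero space, so that
  its dimension is $n_0 = 0$.\<close>

fun flag ::
  "('a, 'n::finite, 'e::euclidean_space) sr_structure \<Rightarrow> 'a set \<Rightarrow> nat \<Rightarrow> ('a, 'n) vfield set" where
  "flag S W 0 = {\<lambda>q. 0}"
| "flag S W (Suc 0) = horizontal S W"
| "flag S W (Suc (Suc k)) =
     {\<lambda>q. X q + (\<Sum>i<N. bracket (atlas S) (Y i) (Z i) q) | X Y Z (N::nat).
        X \<in> flag S W (Suc k) \<and> (\<forall>i<N. Y i \<in> flag S W (Suc k) \<and> Z i \<in> horizontal S W)}"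

definition flag_at ::
  "('a, 'n::finite, 'e::euclidean_space) sr_structure \<Rightarrow> 'a set \<Rightarrow> nat \<Rightarrow> 'a \<Rightarrow> (real ^ 'n) set" where
  "flag_at S W k q = {X q | X. X \<in> flag S W k}"

definition sr_energy ::
  "('a, 'n::finite, 'e::euclidean_space) sr_structure \<Rightarrow> 'a \<Rightarrow> real ^ 'n \<Rightarrow> real" where
  "sr_energy S p v = (LEAST r. \<exists>u. anchor S p u = v \<and> r = fib_inner S p u u)"

text \<open>The scalar product is recovered from its quadratic form by polarization.\<close>

definition sr_metric ::
  "('a, 'n::finite, 'e::euclidean_space) sr_structure \<Rightarrow> 'a \<Rightarrow> real ^ 'n \<Rightarrow> real ^ 'n \<Rightarrow> real" where
  "sr_metric S p v w = (sr_energy S p (v + w) - sr_energy S p (v - w)) / 4"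

definition extends_sr_metric ::
  "('a, 'n::finite, 'e::euclidean_space) sr_structure \<Rightarrow> ('a \<Rightarrow> real ^ 'n \<Rightarrow> real ^ 'n \<Rightarrow> real) \<Rightarrow> bool" where
  "extends_sr_metric S g \<longleftrightarrow>
     (\<forall>p. \<forall>v\<in>flag_at S UNIV 1 p. \<forall>w\<in>flag_at S UNIV 1 p. g p v w = sr_metric S p v w)"

definition equiregular_on ::
  "('a, 'n::finite, 'e::euclidean_space) sr_structure \<Rightarrow> 'a set \<Rightarrow> nat \<Rightarrow> (nat \<Rightarrow> nat) \<Rightarrow> bool" where
  "equiregular_on S W s nn \<longleftrightarrow> nn 0 = 0 \<and> s \<ge> 1 \<and>
     (\<forall>q\<in>W. flag_at S W s q = UNIV \<and> (\<forall>k\<in>{1..s}. dim (flag_at S W k q) = nn k))"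

definition regular_point ::
  "('a::topological_space, 'n::finite, 'e::euclidean_space) sr_structure \<Rightarrow> 'a \<Rightarrow> bool" where
  "regular_point S p \<longleftrightarrow> (\<exists>W s nn. open W \<and> connected W \<and> p \<in> W \<and> equiregular_on S W s nn)"

section \<open>Privileged frames\<close>

definition basis_family :: "'i set \<Rightarrow> ('i \<Rightarrow> 'v::real_vector) \<Rightarrow> 'v set \<Rightarrow> bool" where
  "basis_family I b S \<longleftrightarrow> inj_on b I \<and> independent (b ` I) \<and> span (b ` I) = S"

definition iterated_bracket ::
  "('a, 'n::finite) chart set \<Rightarrow> ('i \<Rightarrow> ('a, 'n) vfield) \<Rightarrow> 'i list \<Rightarrow> ('a, 'n) vfield" where
  "iterated_bracket A X ks = foldl (\<lambda>Z k. bracket A Z (X k)) (X (hd ks)) (tl ks)"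

definition privileged_frame ::
  "('a::topological_space, 'n::{finite,linorder}, 'e::euclidean_space) sr_structure \<Rightarrow> 'a set \<Rightarrow>
   nat \<Rightarrow> (nat \<Rightarrow> nat) \<Rightarrow> ('n \<Rightarrow> ('a, 'n) vfield) \<Rightarrow> bool" where
  "privileged_frame S W s nn X \<longleftrightarrow> open W \<and> equiregular_on S W s nn \<and>
     (\<forall>i. smooth_field (atlas S) W (X i)) \<and>
     (\<forall>q\<in>W. basis_family UNIV (\<lambda>i. X i q) UNIV) \<and>
     (\<forall>q\<in>W. basis_family {i. pos i \<le> nn 1} (\<lambda>i. X i q) (flag_at S W 1 q)) \<and>
     (\<forall>j\<in>{1..s}. \<forall>i. nn (j - 1) < pos i \<and> pos i \<le> nn j \<longrightarrow>
        (\<exists>ks. length ks = j \<and> (\<forall>k\<in>set ks. pos k \<le> nn 1) \<and>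
              (\<forall>q\<in>W. X i q = iterated_bracket (atlas S) X ks q))) \<and>
     (\<forall>q\<in>W. \<forall>j\<in>{1..s}. basis_family {i. pos i \<le> nn j} (\<lambda>i. X i q) (flag_at S W j q))"

definition privileged_orthonormal_frame ::
  "('a::topological_space, 'n::{finite,linorder}, 'e::euclidean_space) sr_structure \<Rightarrow>
   ('a \<Rightarrow> (real, 'n) vec \<Rightarrow> (real, 'n) vec \<Rightarrow> real) \<Rightarrow> 'a set \<Rightarrow>
   nat \<Rightarrow> (nat \<Rightarrow> nat) \<Rightarrow> ('n \<Rightarrow> ('a, 'n) vfield) \<Rightarrow> bool" where
  "privileged_orthonormal_frame S g W s nn X \<longleftrightarrow> privileged_frame S W s nn X \<and>
     (\<forall>q\<in>W. \<forall>i j. g q (X i q) (X j q) = (if i = j then 1 else 0))"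

definition weight :: "nat \<Rightarrow> (nat \<Rightarrow> nat) \<Rightarrow> 'n::{finite,linorder} \<Rightarrow> nat" where
  "weight s nn i = (THE j. j \<in> {1..s} \<and> nn (j - 1) < pos i \<and> pos i \<le> nn j)"

definition dilation :: "('n::finite \<Rightarrow> nat) \<Rightarrow> real \<Rightarrow> real ^ 'n \<Rightarrow> real ^ 'n" where
  "dilation w r x = (\<chi> i. r ^ w i * x $ i)"

section \<open>Exponential coordinates of the first kind\<close>

text \<open>\<open>exp_reaches A W X p q\<close>: the integral curve of \<open>X\<close> in \<open>W\<close> starting at \<open>p\<close> exists up to time one
  and reaches \<open>q = exp(X)(p)\<close>.\<close>

definition exp_reaches ::
  "('a::topological_space, 'n::finite) chart set \<Rightarrow> 'a set \<Rightarrow> ('a, 'n) vfield \<Rightarrow> 'a \<Rightarrow> 'a \<Rightarrow> bool" where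
  "exp_reaches A W X p q \<longleftrightarrow> (\<exists>\<gamma>::real \<Rightarrow> 'a.
     continuous_on {0..1} \<gamma> \<and> \<gamma> ` {0..1} \<subseteq> W \<and> \<gamma> 0 = p \<and> \<gamma> 1 = q \<and>
     (\<forall>t\<in>{0..1}. ((snd (chart_at A (\<gamma> t)) \<circ> \<gamma>) has_vector_derivative X (\<gamma> t)) (at t within {0..1})))"

definition exponential_coordinates ::
  "('a::topological_space, 'n::finite) chart set \<Rightarrow> 'a set \<Rightarrow> ('n \<Rightarrow> ('a, 'n) vfield) \<Rightarrow> 'a \<Rightarrow>
   (real ^ 'n) set \<Rightarrow> (real ^ 'n \<Rightarrow> 'a) \<Rightarrow> bool" where
  "exponential_coordinates A W X p V F \<longleftrightarrow>
     open V \<and> 0 \<in> V \<and>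
     (\<forall>x\<in>V. exp_reaches A W (\<lambda>q. \<Sum>i\<in>UNIV. (x $ i) *\<^sub>R X i q) p (F x)) \<and>
     inj_on F V \<and> open (F ` V) \<and>
     continuous_on V F \<and> (\<forall>c\<in>A. smooth_on (V \<inter> F -` fst c) (snd c \<circ> F)) \<and>
     smooth_fun A (F ` V) (inv_into V F)"

section \<open>Nilpotent approximation\<close>

text \<open>The push-forward of \<open>X\<close> under the inverse of \<open>F\<close>, a field on \<open>V\<close>.\<close>

definition field_in_coordinates ::
  "('a, 'n::finite) chart set \<Rightarrow> (real ^ 'n) set \<Rightarrow> (real ^ 'n \<Rightarrow> 'a) \<Rightarrow> ('a, 'n) vfield \<Rightarrow>
   real ^ 'n \<Rightarrow> real ^ 'n" where
  "field_in_coordinates A V F X x = differential A (inv_into V F) (F x) (X (F x))"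

primrec iterated_partial :: "'n::finite list \<Rightarrow> (real ^ 'n \<Rightarrow> real) \<Rightarrow> real ^ 'n \<Rightarrow> real" where
  "iterated_partial [] a = a"
| "iterated_partial (k # ks) a = (\<lambda>x. frechet_derivative (iterated_partial ks a) (at x) (axis k 1))"

text \<open>The Taylor expansion at 0 is written as the sum, over all finite sequences
  $k_1, ..., k_l$ of indices, of the monomials
  $(1/l!) (\partial_{k_1} ... \partial_{k_l} a)(0) x_{k_1} ... x_{k_l}$,
  which are homogeneous of degree $w_{k_1} + ... + w_{k_l}$. For positive weights the sum below is finite,
  and it is empty if \<open>d < 0\<close>.\<close>

definition taylor_homogeneous_part ::
  "('n::finite \<Rightarrow> nat) \<Rightarrow> int \<Rightarrow> (real ^ 'n \<Rightarrow> real) \<Rightarrow> real ^ 'n \<Rightarrow> real" where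
  "taylor_homogeneous_part w d a x =
     (\<Sum>ks | int (sum_list (map w ks)) = d.
        iterated_partial ks a 0 / fact (length ks) * prod_list (map (\<lambda>k. x $ k) ks))"

definition nilpotent_approximation ::
  "('a, 'n::finite) chart set \<Rightarrow> ('n \<Rightarrow> nat) \<Rightarrow> (real ^ 'n) set \<Rightarrow> (real ^ 'n \<Rightarrow> 'a) \<Rightarrow>
   ('n \<Rightarrow> ('a, 'n) vfield) \<Rightarrow> 'n \<Rightarrow> real ^ 'n \<Rightarrow> real ^ 'n" where
  "nilpotent_approximation A w V F X i x =
     (\<chi> j. taylor_homogeneous_part w (int (w j) - int (w i))
             (\<lambda>y. field_in_coordinates A V F (X i) y $ j) x)"

section \<open>Sub-Riemannian distance of a frame\<close>

definition absolutely_continuous_on :: "real set \<Rightarrow> (real \<Rightarrow> 'v::metric_space) \<Rightarrow> bool" where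
  "absolutely_continuous_on T \<gamma> \<longleftrightarrow> (\<forall>\<epsilon>>0. \<exists>\<delta>>0. \<forall>P.
     finite P \<and> (\<forall>(a, b)\<in>P. a \<le> b \<and> {a..b} \<subseteq> T) \<and>
     pairwise (\<lambda>(a, b) (c, d). {a<..<b} \<inter> {c<..<d} = {}) P \<and> (\<Sum>(a, b)\<in>P. b - a) < \<delta>
     \<longrightarrow> (\<Sum>(a, b)\<in>P. dist (\<gamma> a) (\<gamma> b)) < \<epsilon>)"

definition horizontal_curve ::
  "'i set \<Rightarrow> ('i \<Rightarrow> real ^ 'n::finite \<Rightarrow> real ^ 'n) \<Rightarrow> real ^ 'n \<Rightarrow> real ^ 'n \<Rightarrow>
   (real \<Rightarrow> real ^ 'n) \<Rightarrow> ('i \<Rightarrow> real \<Rightarrow> real) \<Rightarrow> bool" where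
  "horizontal_curve I Z x y \<gamma> h \<longleftrightarrow>
     absolutely_continuous_on {0..1} \<gamma> \<and> \<gamma> 0 = x \<and> \<gamma> 1 = y \<and>
     (\<forall>i\<in>I. h i \<in> borel_measurable (lebesgue_on {0..1})) \<and>
     (AE t in lebesgue_on {0..1}.
        (\<gamma> has_vector_derivative (\<Sum>i\<in>I. h i t *\<^sub>R Z i (\<gamma> t))) (at t within {0..1}))"

text \<open>The infimum is taken in \<open>ennreal\<close>, so it is \<open>\<infinity>\<close> if no horizontal curve joins the points.\<close>

definition frame_distance ::
  "'i set \<Rightarrow> ('i \<Rightarrow> real ^ 'n::finite \<Rightarrow> real ^ 'n) \<Rightarrow> real ^ 'n \<Rightarrow> real ^ 'n \<Rightarrow> ennreal" where
  "frame_distance I Z x y =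
     (INF (\<gamma>, h) \<in> {(\<gamma>, h). horizontal_curve I Z x y \<gamma> h}.
        \<integral>\<^sup>+ t. ennreal (sqrt (\<Sum>i\<in>I. (h i t)\<^sup>2)) \<partial>lebesgue_on {0..1})"

end

theory Submission
  imports Defs
begin

text \<open>Two facts carry the proof: the transition matrix between the frames respects the weights, and
  exponential coordinates of the first kind are privileged.

  Write $X_j = \sum_i c_{ij} Y_i$ on \<open>W\<close>. Both frames span the same flag, so the matrix \<open>c\<close> is block
  triangular in both directions, and both are orthonormal for \<open>g\<close>, so it is orthogonal; hence it
  is orthogonal and block diagonal at every point (\<open>c_block\<close>, \<open>c_columns\<close>). Its value at \<open>p\<close> is the
  matrix of \<open>L\<close>. At the origin of the coordinates both frames are the standard basis, which gives the
  differential of the transition map there (\<open>Phi_derivative_zero\<close>).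

  In the coordinates of the first frame the fields satisfy the Euler identity $\sum_i x_i X_i(x) = x$,
  because rays are the integral curves that define the exponential map (\<open>euler_identity\<close>; this is
  where uniqueness of integral curves on the manifold is used). Differentiating it yields an
  equation for the frame along rays, with the structure functions of the frame as coefficients
  (\<open>radial_derivative\<close>). The bracket of two fields of weights \<open>i\<close> and \<open>k\<close> lies in the step \<open>i + k\<close>
  of the flag: this follows from the definition of the flag, equiregularity and the Jacobi identity
  (\<open>structure_weights\<close>). Consequently the equations satisfied by the rescaled frames have uniformly
  bounded coefficients, and the rescaled frames are uniformly close to the standard basis near the
  origin (\<open>Xe_estimate\<close>). Boundedness of a rescaled smooth function already forces convergence to the
  homogeneous part of its Taylor expansion (\<open>bounded_rescaling_limit\<close>), so the rescaled frames
  converge to the nilpotent approximations, uniformly on bounded sets (\<open>Xe_limit\<close>).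

  The rescaled transition map carries the first rescaled frame to the second one through the
  matrix \<open>c\<close>, without any power of the parameter since \<open>c\<close> is block diagonal (\<open>DPhie_frame\<close>). The
  image of the ray of \<open>x\<close> therefore solves an equation whose coefficients tend to \<open>L x\<close>, and by the Euler
  identity of the second frame the ray of \<open>L x\<close> solves the limit equation. A comparison of the two
  gives convergence on a small ball (\<open>Phie_close\<close>), and homogeneity gives it on all bounded sets
  (\<open>Phie_limit\<close>).

  The same relation bounds the differentials of the rescaled transition maps, which therefore
  converge as well, necessarily to \<open>L\<close> (\<open>G_eq\<close>). In the limit \<open>L\<close> maps the first nilpotent frame to the second one
  through the orthogonal matrix \<open>c p\<close> (\<open>hat_frames\<close>), so it maps horizontal curves to horizontal curves of the
  same length (\<open>frame_distance_le\<close>).\<close>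

section \<open>Calculus of smooth maps\<close>

lemma frechet_derivative_cong_open:
  assumes "open S" "x \<in> S" "\<And>y. y \<in> S \<Longrightarrow> f y = g y"
  shows "frechet_derivative f (at x) = frechet_derivative g (at x)"
proof -
  have "(f has_derivative D) (at x) \<longleftrightarrow> (g has_derivative D) (at x)" for D
    using assms has_derivative_transform_within_open[of f D x UNIV S g]
      has_derivative_transform_within_open[of g D x UNIV S f] by auto
  then show ?thesis
    by (simp add: frechet_derivative_def)
qed

lemma differentiable_cong_open:
  assumes "open S" "x \<in> S" "\<And>y. y \<in> S \<Longrightarrow> f y = g y" "f differentiable (at x)"
  shows "g differentiable (at x)"
  using assms has_derivative_transform_within_open[of f _ x UNIV S g]
  by (auto simp: differentiable_def)

lemma Ck_on_cong:
  assumes "open S" "\<And>x. x \<in> S \<Longrightarrow> f x = g x" "Ck_on k S f"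
  shows "Ck_on k S g"
  using assms(2,3)
proof (induction k arbitrary: f g)
  case 0
  then show ?case by (simp cong: continuous_on_cong)
next
  case (Suc k)
  have eq: "frechet_derivative f (at x) = frechet_derivative g (at x)" if "x \<in> S" for x
    by (rule frechet_derivative_cong_open[OF assms(1) that]) (use Suc.prems in auto)
  have "Ck_on k S (\<lambda>x. frechet_derivative g (at x) v)" for v
    by (rule Suc.IH[of "\<lambda>x. frechet_derivative f (at x) v"]) (use Suc.prems eq in auto)
  moreover have "g differentiable (at x)" if "x \<in> S" for x
    by (rule differentiable_cong_open[OF assms(1) that, of f]) (use Suc.prems that in auto)
  ultimately show ?case by simp
qed

lemma Ck_on_subset: "Ck_on k S f \<Longrightarrow> T \<subseteq> S \<Longrightarrow> Ck_on k T f"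
  by (induction k arbitrary: f) (auto intro: continuous_on_subset)

text \<open>Differentiability and continuity are decided near each point, so a map may be checked to be smooth
  in a different chart at every point.\<close>

lemma Ck_on_local:
  assumes "\<And>x. x \<in> S \<Longrightarrow> \<exists>T. open T \<and> x \<in> T \<and> Ck_on k T f"
  shows "Ck_on k S f"
  using assms
proof (induction k arbitrary: f)
  case 0
  have "continuous (at x within S) f" if x: "x \<in> S" for x
  proof -
    obtain T where "open T" "x \<in> T" "continuous_on T f" using 0[OF x] by auto
    then show ?thesis
      using continuous_on_eq_continuous_at continuous_at_imp_continuous_at_within by blast
  qed
  then show ?case by (simp add: continuous_on_eq_continuous_within)
next
  case (Suc k)
  have "\<exists>T. open T \<and> x \<in> T \<and> Ck_on k T (\<lambda>x. frechet_derivative f (at x) v)" if "x \<in> S" for x v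
    using Suc.prems[OF that] by auto
  then have "Ck_on k S (\<lambda>x. frechet_derivative f (at x) v)" for v
    by (rule Suc.IH)
  then show ?case using Suc.prems by fastforce
qed

lemma Ck_on_SucD: "Ck_on (Suc k) S f \<Longrightarrow> Ck_on k S f"
proof (induction k arbitrary: f)
  case 0
  then have "\<forall>x\<in>S. f differentiable (at x)" by simp
  then show ?case
    by (auto intro!: continuous_at_imp_continuous_on differentiable_imp_continuous_within)
next
  case (Suc k)
  have "\<forall>v. Ck_on (Suc k) S (\<lambda>x. frechet_derivative f (at x) v)"
    using Suc.prems by (subst (asm) Ck_on.simps) blast
  then have "\<forall>v. Ck_on k S (\<lambda>x. frechet_derivative f (at x) v)"
    using Suc.IH by blast
  moreover have "\<forall>x\<in>S. f differentiable (at x)" using Suc.prems by simp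
  ultimately show ?case by simp
qed

lemma Ck_on_const: "Ck_on k S (\<lambda>x. c)"
  by (induction k arbitrary: c) (auto simp: frechet_derivative_const)

lemma Ck_on_add:
  assumes "open S" "Ck_on k S f" "Ck_on k S g"
  shows "Ck_on k S (\<lambda>x. f x + g x)"
  using assms(2,3)
proof (induction k arbitrary: f g)
  case 0
  then show ?case by (auto intro: continuous_on_add)
next
  case (Suc k)
  have D: "frechet_derivative (\<lambda>x. f x + g x) (at x) v =
      frechet_derivative f (at x) v + frechet_derivative g (at x) v" if "x \<in> S" for x v
  proof -
    have "((\<lambda>x. f x + g x) has_derivative
        (\<lambda>v. frechet_derivative f (at x) v + frechet_derivative g (at x) v)) (at x)"
      by (rule has_derivative_add) (use Suc.prems that in \<open>auto simp: frechet_derivative_works\<close>)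
    then show ?thesis using frechet_derivative_at by metis
  qed
  have "Ck_on k S (\<lambda>x. frechet_derivative (\<lambda>x. f x + g x) (at x) v)" for v
    by (rule Ck_on_cong[OF assms(1) D[symmetric]]) (use Suc in auto)
  then show ?case using Suc.prems by auto
qed

lemma Ck_on_bilinear:
  assumes "bounded_bilinear prd" "open S" "Ck_on k S f" "Ck_on k S g"
  shows "Ck_on k S (\<lambda>x. prd (f x) (g x))"
  using assms(3,4)
proof (induction k arbitrary: f g)
  case 0
  then show ?case using bounded_bilinear.continuous_on[OF assms(1)] by auto
next
  case (Suc k)
  have D: "((\<lambda>x. prd (f x) (g x)) has_derivative (\<lambda>v. prd (f x) (frechet_derivative g (at x) v)
      + prd (frechet_derivative f (at x) v) (g x))) (at x)" if "x \<in> S" for x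
    by (rule bounded_bilinear.FDERIV[OF assms(1)])
      (use Suc.prems that in \<open>auto simp: frechet_derivative_works\<close>)
  have E: "prd (f x) (frechet_derivative g (at x) v) + prd (frechet_derivative f (at x) v) (g x) =
      frechet_derivative (\<lambda>x. prd (f x) (g x)) (at x) v" if "x \<in> S" for x v
    using frechet_derivative_at[OF D[OF that]] by metis
  have "Ck_on k S (\<lambda>x. frechet_derivative (\<lambda>x. prd (f x) (g x)) (at x) v)" for v
    by (rule Ck_on_cong[OF assms(2) E])
      (use Suc.prems Ck_on_SucD[OF Suc.prems(1)] Ck_on_SucD[OF Suc.prems(2)] in
        \<open>auto intro!: Ck_on_add[OF assms(2)] Suc.IH\<close>)
  then show ?case using D by (auto simp: differentiable_def)
qed

lemma Ck_on_sum:
  assumes "open S" "\<And>i. i \<in> I \<Longrightarrow> Ck_on k S (f i)"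
  shows "Ck_on k S (\<lambda>x. \<Sum>i\<in>I. f i x)"
  using assms(2)
  by (induction I rule: infinite_finite_induct) (auto intro!: Ck_on_const Ck_on_add[OF assms(1)])

lemma linear_apply_Basis:
  fixes v :: "'v::euclidean_space"
  assumes "linear D" shows "D v = (\<Sum>b\<in>Basis. (v \<bullet> b) *\<^sub>R D b)"
proof -
  have "D v = D (\<Sum>b\<in>Basis. (v \<bullet> b) *\<^sub>R b)" by (simp add: euclidean_representation)
  also have "\<dots> = (\<Sum>b\<in>Basis. (v \<bullet> b) *\<^sub>R D b)"
    using assms by (simp add: linear_sum linear_scale)
  finally show ?thesis .
qed

lemma linear_frechet: "f differentiable (at x) \<Longrightarrow> linear (frechet_derivative f (at x))"
  by (meson frechet_derivative_works has_derivative_linear)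

text \<open>Only directional derivatives are controlled, hence the chain rule is expanded over a basis of the
  intermediate space; every term is then a product of maps of lower order.\<close>

lemma Ck_on_compose:
  fixes f :: "'u::real_normed_vector \<Rightarrow> 'v::euclidean_space"
  assumes S: "open S" and T: "open T" and "\<And>x. x \<in> S \<Longrightarrow> f x \<in> T" and "Ck_on k S f" "Ck_on k T g"
  shows "Ck_on k S (\<lambda>x. g (f x))"
  using assms(3-)
proof (induction k arbitrary: g)
  case 0
  then show ?case by (auto intro: continuous_on_compose2)
next
  case (Suc k)
  let ?Df = "\<lambda>x v. frechet_derivative f (at x) v" and ?Dg = "\<lambda>y v. frechet_derivative g (at y) v"
  have D: "((\<lambda>x. g (f x)) has_derivative (\<lambda>v. ?Dg (f x) (?Df x v))) (at x)" if "x \<in> S" for x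
    by (rule has_derivative_compose)
      (use Suc.prems that in \<open>auto simp: frechet_derivative_works\<close>)
  have E: "(\<Sum>b\<in>Basis. (?Df x v \<bullet> b) *\<^sub>R ?Dg (f x) b) =
      frechet_derivative (\<lambda>x. g (f x)) (at x) v" if "x \<in> S" for x v
  proof -
    have "linear (?Dg (f x))" using linear_frechet[of g "f x"] Suc.prems that by auto
    then have "(\<Sum>b\<in>Basis. (?Df x v \<bullet> b) *\<^sub>R ?Dg (f x) b) = ?Dg (f x) (?Df x v)"
      by (rule linear_apply_Basis[symmetric])
    also have "\<dots> = frechet_derivative (\<lambda>x. g (f x)) (at x) v"
      by (rule fun_cong[OF frechet_derivative_at[OF D[OF that]]])
    finally show ?thesis .
  qed
  have "Ck_on k S (\<lambda>x. frechet_derivative (\<lambda>x. g (f x)) (at x) v)" for v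
  proof (rule Ck_on_cong[OF S E])
    have 1: "Ck_on k S (\<lambda>x. ?Df x v)" using Suc.prems by simp
    have "Ck_on k S (\<lambda>x. ?Df x v \<bullet> b)" for b
      by (rule Ck_on_bilinear[OF bounded_bilinear_inner S 1 Ck_on_const])
    moreover have "Ck_on k S (\<lambda>x. ?Dg (f x) b)" for b
      by (rule Suc.IH) (use Suc.prems Ck_on_SucD[OF Suc.prems(2)] in auto)
    ultimately show "Ck_on k S (\<lambda>x. \<Sum>b\<in>Basis. (?Df x v \<bullet> b) *\<^sub>R ?Dg (f x) b)"
      by (intro Ck_on_sum[OF S] Ck_on_bilinear[OF bounded_bilinear_scaleR S]) auto
  qed
  then show ?case using D by (auto simp: differentiable_def)
qed

lemma smooth_on_cong:
  "open S \<Longrightarrow> smooth_on S f \<Longrightarrow> (\<And>x. x \<in> S \<Longrightarrow> f x = g x) \<Longrightarrow> smooth_on S g"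
  using Ck_on_cong unfolding smooth_on_def by blast

lemma smooth_on_subset: "smooth_on S f \<Longrightarrow> T \<subseteq> S \<Longrightarrow> smooth_on T f"
  using Ck_on_subset unfolding smooth_on_def by blast

lemma smooth_on_local:
  assumes "\<And>x. x \<in> S \<Longrightarrow> \<exists>T. open T \<and> x \<in> T \<and> smooth_on T f"
  shows "smooth_on S f"
  using assms unfolding smooth_on_def by (meson Ck_on_local)

lemma smooth_on_const: "smooth_on S (\<lambda>x. c)"
  by (simp add: smooth_on_def Ck_on_const)

lemma smooth_on_add:
  "open S \<Longrightarrow> smooth_on S f \<Longrightarrow> smooth_on S g \<Longrightarrow> smooth_on S (\<lambda>x. f x + g x)"
  by (simp add: smooth_on_def Ck_on_add)

lemma smooth_on_bilinear:
  "bounded_bilinear prd \<Longrightarrow> open S \<Longrightarrow> smooth_on S f \<Longrightarrow> smooth_on S g \<Longrightarrow>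
    smooth_on S (\<lambda>x. prd (f x) (g x))"
  by (simp add: smooth_on_def Ck_on_bilinear)

lemmas smooth_on_scaleR = smooth_on_bilinear[OF bounded_bilinear_scaleR]

lemma smooth_on_sum:
  "open S \<Longrightarrow> (\<And>i. i \<in> I \<Longrightarrow> smooth_on S (f i)) \<Longrightarrow> smooth_on S (\<lambda>x. \<Sum>i\<in>I. f i x)"
  by (simp add: smooth_on_def Ck_on_sum)

lemma smooth_on_compose:
  fixes f :: "'u::real_normed_vector \<Rightarrow> 'v::euclidean_space"
  assumes "open S" "open T" "\<And>x. x \<in> S \<Longrightarrow> f x \<in> T" "smooth_on S f" "smooth_on T g"
  shows "smooth_on S (\<lambda>x. g (f x))"
  using assms Ck_on_compose unfolding smooth_on_def by metis

lemma smooth_on_diff: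
  fixes f :: "'u::real_normed_vector \<Rightarrow> 'w::real_normed_vector"
  assumes "open S" "smooth_on S f" "smooth_on S g"
  shows "smooth_on S (\<lambda>x. f x - g x)"
  using smooth_on_add[OF assms(1,2) smooth_on_scaleR[OF assms(1) smooth_on_const[of S "-1"] assms(3)]]
  by simp

lemma smooth_on_inner_right:
  "open S \<Longrightarrow> smooth_on S f \<Longrightarrow> smooth_on S (\<lambda>x. f x \<bullet> b)"
  by (rule smooth_on_bilinear[OF bounded_bilinear_inner _ _ smooth_on_const])

lemma smooth_on_vec_nth:
  fixes f :: "'u::real_normed_vector \<Rightarrow> real ^ 'n"
  shows "open S \<Longrightarrow> smooth_on S f \<Longrightarrow> smooth_on S (\<lambda>x. f x $ i)"
  using smooth_on_inner_right[of S f "axis i 1"] by (simp add: inner_axis)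

lemma smooth_on_imp_differentiable: "smooth_on S f \<Longrightarrow> x \<in> S \<Longrightarrow> f differentiable (at x)"
  unfolding smooth_on_def by (metis Ck_on.simps(2))

lemma smooth_on_imp_continuous_on: "smooth_on S f \<Longrightarrow> continuous_on S f"
  unfolding smooth_on_def by (metis Ck_on.simps(1))

lemma smooth_on_has_derivative:
  "smooth_on S f \<Longrightarrow> x \<in> S \<Longrightarrow> (f has_derivative frechet_derivative f (at x)) (at x)"
  using smooth_on_imp_differentiable frechet_derivative_works by blast

lemma smooth_on_linear_frechet: "smooth_on S f \<Longrightarrow> x \<in> S \<Longrightarrow> linear (frechet_derivative f (at x))"
  using smooth_on_imp_differentiable linear_frechet by blast

lemma smooth_on_derivative: "smooth_on S f \<Longrightarrow> smooth_on S (\<lambda>x. frechet_derivative f (at x) v)"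
  unfolding smooth_on_def by (metis Ck_on.simps(2))

lemma smooth_on_directional:
  fixes f :: "'v::euclidean_space \<Rightarrow> 'w::real_normed_vector"
  assumes "open S" "smooth_on S f" "smooth_on S u"
  shows "smooth_on S (\<lambda>x. frechet_derivative f (at x) (u x))"
proof (rule smooth_on_cong[OF assms(1)])
  show "smooth_on S (\<lambda>x. \<Sum>b\<in>Basis. (u x \<bullet> b) *\<^sub>R frechet_derivative f (at x) b)"
    by (intro smooth_on_sum smooth_on_scaleR smooth_on_inner_right smooth_on_derivative assms)
  show "(\<Sum>b\<in>Basis. (u x \<bullet> b) *\<^sub>R frechet_derivative f (at x) b) =
      frechet_derivative f (at x) (u x)" if "x \<in> S" for x
    using linear_apply_Basis[OF smooth_on_linear_frechet[OF assms(2) that]] by metis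
qed

text \<open>Two applications of the mean value theorem turn the second difference quotient into the mixed
  derivative at a nearby point. The quotient is symmetric in the two directions, so the mixed
  derivatives in either order are limits of the same expression.\<close>

lemma mixed_difference_quotient:
  fixes f :: "'v::real_normed_vector \<Rightarrow> real"
  assumes "open S" "smooth_on S f" "x \<in> S" "e > 0"
  shows "\<exists>d>0. \<forall>h. 0 < h \<and> h < d \<longrightarrow>
    \<bar>(f (x + h *\<^sub>R u + h *\<^sub>R v) - f (x + h *\<^sub>R u) - f (x + h *\<^sub>R v) + f x) / h\<^sup>2
      - frechet_derivative (\<lambda>y. frechet_derivative f (at y) u) (at x) v\<bar> < e"
proof -
  let ?D1 = "\<lambda>y. frechet_derivative f (at y) u"
  let ?D2 = "\<lambda>y. frechet_derivative ?D1 (at y) v"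
  have s1: "smooth_on S ?D1" and s2: "smooth_on S ?D2"
    using assms(2) by (auto intro: smooth_on_derivative)
  have "continuous_on S ?D2" using s2 by (rule smooth_on_imp_continuous_on)
  then have "isCont ?D2 x"
    using assms(1,3) continuous_on_eq_continuous_at by blast
  then obtain r where r: "r > 0" "\<And>y. dist y x < r \<Longrightarrow> \<bar>?D2 y - ?D2 x\<bar> < e"
    using assms(4) unfolding continuous_at_eps_delta dist_real_def by blast
  obtain r' where r': "r' > 0" "ball x r' \<subseteq> S" using assms(1,3) open_contains_ball by blast
  define d where "d = min r r' / (norm u + norm v + 1)"
  have nz: "norm u + norm v + 1 > 0" by (simp add: add_nonneg_pos)
  have d: "d > 0" using r r' nz by (simp add: d_def)
  have small: "dist (x + a *\<^sub>R u + b *\<^sub>R v) x < min r r'"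
    if "0 \<le> a" "a \<le> h" "0 \<le> b" "b \<le> h" "0 < h" "h < d" for a b h
  proof -
    have "norm (a *\<^sub>R u + b *\<^sub>R v) \<le> a * norm u + b * norm v"
      using that by (metis abs_of_nonneg norm_scaleR norm_triangle_ineq)
    also have "\<dots> \<le> h * norm u + h * norm v"
      using that by (intro add_mono mult_right_mono) auto
    also have "\<dots> < h * (norm u + norm v + 1)" using that by (simp add: algebra_simps)
    also have "\<dots> < d * (norm u + norm v + 1)"
      using that nz mult_less_cancel_right_pos by blast
    also have "\<dots> = min r r'" using nz by (simp add: d_def)
    finally show ?thesis by (simp add: dist_norm algebra_simps)
  qed
  have inS: "x + a *\<^sub>R u + b *\<^sub>R v \<in> S"
    if "0 \<le> a" "a \<le> h" "0 \<le> b" "b \<le> h" "0 < h" "h < d" for a b h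
    using small[OF that] r'(2) by (auto simp: dist_commute mem_ball subset_iff)
  show ?thesis
  proof (intro exI[of _ d] conjI allI impI d)
    fix h :: real assume h: "0 < h \<and> h < d"
    define \<phi> where "\<phi> s = f (x + s *\<^sub>R u + h *\<^sub>R v) - f (x + s *\<^sub>R u)" for s
    have f1: "((\<lambda>s. f (x + s *\<^sub>R u + b *\<^sub>R v)) has_real_derivative ?D1 (x + s *\<^sub>R u + b *\<^sub>R v)) (at s)"
      if "0 \<le> s" "s \<le> h" "0 \<le> b" "b \<le> h" for s b
    proof -
      have "((\<lambda>s. f (x + s *\<^sub>R u + b *\<^sub>R v)) has_derivative
          (\<lambda>t. frechet_derivative f (at (x + s *\<^sub>R u + b *\<^sub>R v)) (t *\<^sub>R u))) (at s)"
        by (rule has_derivative_compose[where g=f])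
          (auto intro!: derivative_eq_intros smooth_on_has_derivative[OF assms(2)] inS that h[THEN conjunct1] h[THEN conjunct2])
      moreover have "frechet_derivative f (at (x + s *\<^sub>R u + b *\<^sub>R v)) (t *\<^sub>R u) =
          ?D1 (x + s *\<^sub>R u + b *\<^sub>R v) * t" for t
        using linear_scale[OF smooth_on_linear_frechet[OF assms(2) inS]] that h by (simp add: mult.commute)
      ultimately show ?thesis
        by (simp add: has_field_derivative_def)
    qed
    have "\<exists>\<xi>. 0 < \<xi> \<and> \<xi> < h \<and> \<phi> h - \<phi> 0 = (h - 0) * (?D1 (x + \<xi> *\<^sub>R u + h *\<^sub>R v) - ?D1 (x + \<xi> *\<^sub>R u))"
    proof (rule MVT2)
      show "(\<phi> has_real_derivative (?D1 (x + s *\<^sub>R u + h *\<^sub>R v) - ?D1 (x + s *\<^sub>R u))) (at s)"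
        if "0 \<le> s" "s \<le> h" for s
        unfolding \<phi>_def using f1[of s h] f1[of s 0] that h
        by (auto intro!: DERIV_diff)
    qed (use h in auto)
    then obtain \<xi> where \<xi>: "0 < \<xi>" "\<xi> < h"
      "\<phi> h - \<phi> 0 = h * (?D1 (x + \<xi> *\<^sub>R u + h *\<^sub>R v) - ?D1 (x + \<xi> *\<^sub>R u))" by auto
    define \<psi> where "\<psi> t = ?D1 (x + \<xi> *\<^sub>R u + t *\<^sub>R v)" for t
    have "\<exists>\<eta>. 0 < \<eta> \<and> \<eta> < h \<and> \<psi> h - \<psi> 0 = (h - 0) * ?D2 (x + \<xi> *\<^sub>R u + \<eta> *\<^sub>R v)"
    proof (rule MVT2)
      show "(\<psi> has_real_derivative ?D2 (x + \<xi> *\<^sub>R u + t *\<^sub>R v)) (at t)" if "0 \<le> t" "t \<le> h" for t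
      proof -
        have i: "x + \<xi> *\<^sub>R u + t *\<^sub>R v \<in> S" using inS[of \<xi> h t] \<xi> that h by auto
        have "(\<psi> has_derivative (\<lambda>z. frechet_derivative ?D1 (at (x + \<xi> *\<^sub>R u + t *\<^sub>R v)) (z *\<^sub>R v))) (at t)"
          unfolding \<psi>_def by (rule has_derivative_compose[where g="?D1"])
            (auto intro!: derivative_eq_intros smooth_on_has_derivative[OF s1] i)
        moreover have "frechet_derivative ?D1 (at (x + \<xi> *\<^sub>R u + t *\<^sub>R v)) (z *\<^sub>R v) =
            ?D2 (x + \<xi> *\<^sub>R u + t *\<^sub>R v) * z" for z
          using linear_scale[OF smooth_on_linear_frechet[OF s1 i]] by (simp add: mult.commute)
        ultimately show ?thesis by (simp add: has_field_derivative_def)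
      qed
    qed (use h in auto)
    then obtain \<eta> where \<eta>: "0 < \<eta>" "\<eta> < h" "\<psi> h - \<psi> 0 = h * ?D2 (x + \<xi> *\<^sub>R u + \<eta> *\<^sub>R v)" by auto
    have "f (x + h *\<^sub>R u + h *\<^sub>R v) - f (x + h *\<^sub>R u) - f (x + h *\<^sub>R v) + f x = \<phi> h - \<phi> 0"
      by (simp add: \<phi>_def)
    also have "\<dots> = h\<^sup>2 * ?D2 (x + \<xi> *\<^sub>R u + \<eta> *\<^sub>R v)"
      using \<xi>(3) \<eta>(3) by (simp add: \<psi>_def power2_eq_square)
    finally have "(f (x + h *\<^sub>R u + h *\<^sub>R v) - f (x + h *\<^sub>R u) - f (x + h *\<^sub>R v) + f x) / h\<^sup>2 =
        ?D2 (x + \<xi> *\<^sub>R u + \<eta> *\<^sub>R v)" using h by simp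
    moreover have "\<bar>?D2 (x + \<xi> *\<^sub>R u + \<eta> *\<^sub>R v) - ?D2 x\<bar> < e"
      using small[of \<xi> h \<eta>] \<xi> \<eta> h by (intro r(2)) auto
    ultimately show "\<bar>(f (x + h *\<^sub>R u + h *\<^sub>R v) - f (x + h *\<^sub>R u) - f (x + h *\<^sub>R v) + f x) / h\<^sup>2
      - ?D2 x\<bar> < e" by simp
  qed
qed

lemma second_derivative_symmetric_real:
  fixes f :: "'v::real_normed_vector \<Rightarrow> real"
  assumes "open S" "smooth_on S f" "x \<in> S"
  shows "frechet_derivative (\<lambda>y. frechet_derivative f (at y) u) (at x) v =
    frechet_derivative (\<lambda>y. frechet_derivative f (at y) v) (at x) u" (is "?a = ?b")
proof (rule ccontr)
  assume "?a \<noteq> ?b"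
  then have e: "\<bar>?a - ?b\<bar> / 2 > 0" by simp
  obtain d1 where d1: "d1 > 0" "\<And>h. 0 < h \<and> h < d1 \<Longrightarrow>
    \<bar>(f (x + h *\<^sub>R u + h *\<^sub>R v) - f (x + h *\<^sub>R u) - f (x + h *\<^sub>R v) + f x) / h\<^sup>2 - ?a\<bar> < \<bar>?a - ?b\<bar> / 2"
    using mixed_difference_quotient[OF assms e, of u v] by blast
  obtain d2 where d2: "d2 > 0" "\<And>h. 0 < h \<and> h < d2 \<Longrightarrow>
    \<bar>(f (x + h *\<^sub>R v + h *\<^sub>R u) - f (x + h *\<^sub>R v) - f (x + h *\<^sub>R u) + f x) / h\<^sup>2 - ?b\<bar> < \<bar>?a - ?b\<bar> / 2"
    using mixed_difference_quotient[OF assms e, of v u] by blast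
  define h where "h = min d1 d2 / 2"
  define q where "q = (f (x + h *\<^sub>R u + h *\<^sub>R v) - f (x + h *\<^sub>R u) - f (x + h *\<^sub>R v) + f x) / h\<^sup>2"
  have "\<bar>q - ?a\<bar> < \<bar>?a - ?b\<bar> / 2" unfolding q_def using d1 d2 by (intro d1(2)) (auto simp: h_def)
  moreover have "\<bar>q - ?b\<bar> < \<bar>?a - ?b\<bar> / 2"
    using d2(2)[of h] d1(1) d2(1) by (auto simp: h_def q_def algebra_simps)
  ultimately show False by argo
qed

lemma frechet_derivative_inner:
  assumes "f differentiable (at x)"
  shows "frechet_derivative (\<lambda>y. f y \<bullet> b) (at x) v = frechet_derivative f (at x) v \<bullet> b"
proof -
  have "(f has_derivative frechet_derivative f (at x)) (at x)"
    using assms frechet_derivative_works by blast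
  then have "((\<lambda>y. f y \<bullet> b) has_derivative (\<lambda>v. frechet_derivative f (at x) v \<bullet> b)) (at x)"
    by (auto intro!: derivative_eq_intros)
  then show ?thesis using frechet_derivative_at by metis
qed

lemma second_derivative_symmetric:
  fixes f :: "'v::real_normed_vector \<Rightarrow> 'w::euclidean_space"
  assumes "open S" "smooth_on S f" "x \<in> S"
  shows "frechet_derivative (\<lambda>y. frechet_derivative f (at y) u) (at x) v =
    frechet_derivative (\<lambda>y. frechet_derivative f (at y) v) (at x) u"
proof (rule euclidean_eqI)
  fix b :: 'w
  have s: "smooth_on S (\<lambda>y. f y \<bullet> b)" using assms by (auto intro: smooth_on_inner_right)
  have D: "frechet_derivative (\<lambda>y. frechet_derivative (\<lambda>y. f y \<bullet> b) (at y) u) (at x) v =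
      frechet_derivative (\<lambda>y. frechet_derivative f (at y) u) (at x) v \<bullet> b" for u v
  proof -
    have "frechet_derivative (\<lambda>y. frechet_derivative (\<lambda>y. f y \<bullet> b) (at y) u) (at x) v =
      frechet_derivative (\<lambda>y. frechet_derivative f (at y) u \<bullet> b) (at x) v"
      by (rule fun_cong[OF frechet_derivative_cong_open[OF assms(1,3)]])
        (use smooth_on_imp_differentiable[OF assms(2)] in \<open>auto simp: frechet_derivative_inner\<close>)
    also have "\<dots> = frechet_derivative (\<lambda>y. frechet_derivative f (at y) u) (at x) v \<bullet> b"
      by (rule frechet_derivative_inner[OF smooth_on_imp_differentiable[OF smooth_on_derivative[OF assms(2)] assms(3)]])
    finally show ?thesis .
  qed
  show "frechet_derivative (\<lambda>y. frechet_derivative f (at y) u) (at x) v \<bullet> b =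
    frechet_derivative (\<lambda>y. frechet_derivative f (at y) v) (at x) u \<bullet> b"
    using second_derivative_symmetric_real[OF assms(1) s assms(3), of u v] by (simp add: D)
qed

section \<open>Lie brackets of vector fields on open sets\<close>

text \<open>The sign is that of the bracket on the manifold, read in one fixed coordinate system.\<close>

definition lie_bracket :: "('v::real_normed_vector \<Rightarrow> 'v) \<Rightarrow> ('v \<Rightarrow> 'v) \<Rightarrow> 'v \<Rightarrow> 'v" where
  "lie_bracket Y Z x = frechet_derivative Z (at x) (Y x) - frechet_derivative Y (at x) (Z x)"

lemma smooth_on_lie_bracket:
  fixes Y Z :: "'v::euclidean_space \<Rightarrow> 'v"
  shows "open S \<Longrightarrow> smooth_on S Y \<Longrightarrow> smooth_on S Z \<Longrightarrow> smooth_on S (lie_bracket Y Z)"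
  unfolding lie_bracket_def[abs_def] by (intro smooth_on_diff smooth_on_directional)

lemma lie_bracket_cong:
  assumes "open S" "x \<in> S" "\<And>y. y \<in> S \<Longrightarrow> Y y = Y' y" "\<And>y. y \<in> S \<Longrightarrow> Z y = Z' y"
  shows "lie_bracket Y Z x = lie_bracket Y' Z' x"
  using assms frechet_derivative_cong_open[OF assms(1,2), of Y Y']
    frechet_derivative_cong_open[OF assms(1,2), of Z Z'] by (simp add: lie_bracket_def)

lemma lie_bracket_antisym: "lie_bracket Y Z x = - lie_bracket Z Y x"
  by (simp add: lie_bracket_def)

lemma frechet_derivative_diff:
  assumes "f differentiable (at x)" "g differentiable (at x)"
  shows "frechet_derivative (\<lambda>y. f y - g y) (at x) v =
    frechet_derivative f (at x) v - frechet_derivative g (at x) v"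
proof -
  have "((\<lambda>y. f y - g y) has_derivative
      (\<lambda>v. frechet_derivative f (at x) v - frechet_derivative g (at x) v)) (at x)"
    by (rule has_derivative_diff) (use assms frechet_derivative_works in blast)+
  then show ?thesis using frechet_derivative_at by metis
qed

lemma lie_bracket_diff_left:
  assumes "Y differentiable (at x)" "Y' differentiable (at x)" "Z differentiable (at x)"
  shows "lie_bracket (\<lambda>y. Y y - Y' y) Z x = lie_bracket Y Z x - lie_bracket Y' Z x"
  using linear_diff[OF linear_frechet[OF assms(3)]] assms
  by (simp add: lie_bracket_def frechet_derivative_diff algebra_simps)

text \<open>The base point and the direction vary together; separating the two contributions is what makes the
  second order terms in the Jacobi identity and in the naturality of the bracket visible.\<close>

lemma has_derivative_directional:
  fixes f :: "'v::euclidean_space \<Rightarrow> 'w::euclidean_space" and u :: "'v \<Rightarrow> 'v"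
  assumes S: "open S" and f: "smooth_on S f" and x: "x \<in> S" and u: "(u has_derivative u') (at x)"
  shows "((\<lambda>y. frechet_derivative f (at y) (u y)) has_derivative
    (\<lambda>v. frechet_derivative (\<lambda>y. frechet_derivative f (at y) (u x)) (at x) v
      + frechet_derivative f (at x) (u' v))) (at x)"
proof -
  define E where "E b v = frechet_derivative (\<lambda>y. frechet_derivative f (at y) b) (at x) v" for b v
  have E: "((\<lambda>y. frechet_derivative f (at y) b) has_derivative E b) (at x)" for b
    using smooth_on_has_derivative[OF smooth_on_derivative[OF f] x] by (simp add: E_def[abs_def])
  have e: "(\<Sum>b\<in>Basis. (w \<bullet> b) *\<^sub>R frechet_derivative f (at y) b) = frechet_derivative f (at y) w"
    if "y \<in> S" for y w
    by (rule linear_apply_Basis[OF smooth_on_linear_frechet[OF f that], symmetric])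
  have inn: "((\<lambda>y. u y \<bullet> b) has_derivative (\<lambda>v. u' v \<bullet> b)) (at x)" for b
    by (rule has_derivative_inner_left[OF u])
  have "((\<lambda>y. \<Sum>b\<in>Basis. (u y \<bullet> b) *\<^sub>R frechet_derivative f (at y) b) has_derivative
      (\<lambda>v. \<Sum>b\<in>Basis. (u x \<bullet> b) *\<^sub>R E b v + (u' v \<bullet> b) *\<^sub>R frechet_derivative f (at x) b)) (at x)"
    by (rule has_derivative_sum, rule has_derivative_scaleR[OF inn E])
  then have 2: "((\<lambda>y. frechet_derivative f (at y) (u y)) has_derivative
      (\<lambda>v. \<Sum>b\<in>Basis. (u x \<bullet> b) *\<^sub>R E b v + (u' v \<bullet> b) *\<^sub>R frechet_derivative f (at x) b)) (at x)"
    by (rule has_derivative_transform_within_open[OF _ S x]) (rule e)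
  have "((\<lambda>y. \<Sum>b\<in>Basis. (u x \<bullet> b) *\<^sub>R frechet_derivative f (at y) b) has_derivative
      (\<lambda>v. \<Sum>b\<in>Basis. (u x \<bullet> b) *\<^sub>R E b v)) (at x)"
    by (rule has_derivative_sum, rule has_derivative_scaleR_right[OF E])
  then have "((\<lambda>y. frechet_derivative f (at y) (u x)) has_derivative
      (\<lambda>v. \<Sum>b\<in>Basis. (u x \<bullet> b) *\<^sub>R E b v)) (at x)"
    by (rule has_derivative_transform_within_open[OF _ S x]) (rule e)
  then have "(\<lambda>v. \<Sum>b\<in>Basis. (u x \<bullet> b) *\<^sub>R E b v) = E (u x)"
    using E by (rule has_derivative_unique)
  then have "(\<Sum>b\<in>Basis. (u x \<bullet> b) *\<^sub>R E b v + (u' v \<bullet> b) *\<^sub>R frechet_derivative f (at x) b) =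
      E (u x) v + frechet_derivative f (at x) (u' v)" for v
    by (simp only: sum.distrib e[OF x]) (simp add: fun_eq_iff)
  with 2 show ?thesis by (simp add: E_def)
qed

lemma frechet_derivative_directional:
  fixes f :: "'v::euclidean_space \<Rightarrow> 'w::euclidean_space" and u :: "'v \<Rightarrow> 'v"
  assumes "open S" "smooth_on S f" "smooth_on S u" "x \<in> S"
  shows "frechet_derivative (\<lambda>y. frechet_derivative f (at y) (u y)) (at x) v =
    frechet_derivative (\<lambda>y. frechet_derivative f (at y) (u x)) (at x) v
    + frechet_derivative f (at x) (frechet_derivative u (at x) v)"
  using fun_cong[OF frechet_derivative_at[OF has_derivative_directional[OF assms(1,2,4)
    smooth_on_has_derivative[OF assms(3,4)]]], of v] by simp

text \<open>All terms with second derivatives cancel in pairs by symmetry. The form is that of a derivation,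
  which suits the induction over iterated brackets.\<close>

lemma lie_bracket_jacobi:
  fixes X Y Z :: "'v::euclidean_space \<Rightarrow> 'v"
  assumes S: "open S" and X: "smooth_on S X" and Y: "smooth_on S Y" and Z: "smooth_on S Z"
    and x: "x \<in> S"
  shows "lie_bracket Y (lie_bracket Z X) x = lie_bracket (lie_bracket Y Z) X x + lie_bracket Z (lie_bracket Y X) x"
proof -
  define D where "D f v = frechet_derivative f (at x) v" for f :: "'v \<Rightarrow> 'v" and v
  define H where "H f u v = frechet_derivative (\<lambda>y. frechet_derivative f (at y) u) (at x) v" for f :: "'v \<Rightarrow> 'v" and u v
  have Dl: "D (lie_bracket A B) v = H B (A x) v + D B (D A v) - H A (B x) v - D A (D B v)"
    if "smooth_on S A" "smooth_on S B" for A B v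
  proof -
    have "D (lie_bracket A B) v = frechet_derivative (\<lambda>y. frechet_derivative B (at y) (A y)) (at x) v
        - frechet_derivative (\<lambda>y. frechet_derivative A (at y) (B y)) (at x) v"
      unfolding D_def lie_bracket_def[abs_def]
      by (rule frechet_derivative_diff; rule smooth_on_imp_differentiable[OF _ x];
          rule smooth_on_directional[OF S]) (rule that)+
    then show ?thesis
      by (simp add: frechet_derivative_directional[OF S _ _ x] that D_def H_def)
  qed
  have sym: "H A u v = H A v u" if "smooth_on S A" for A u v
    unfolding H_def by (rule second_derivative_symmetric[OF S that x])
  have lin: "D A (u - v) = D A u - D A v" if "smooth_on S A" for A u v
    unfolding D_def using linear_diff[OF smooth_on_linear_frechet[OF that x]] .
  have L: "lie_bracket A B x = D B (A x) - D A (B x)" for A B by (simp add: lie_bracket_def D_def)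
  show ?thesis
    by (simp only: L Dl X Y Z lin) (simp add: L lin X Y Z sym[OF X, of "Y x" "Z x"]
      sym[OF Y, of "X x" "Z x"] sym[OF Z, of "X x" "Y x"])
qed

text \<open>Differentiating the relation along the other field produces the second derivative of the map
  evaluated at both fields; it is symmetric and drops out of the difference.\<close>

lemma lie_bracket_related:
  fixes G :: "'v::euclidean_space \<Rightarrow> 'v"
  assumes S: "open S" and G: "smooth_on S G" and x: "x \<in> S"
    and Y: "Y differentiable (at x)" and Z: "Z differentiable (at x)"
    and Y': "Y' differentiable (at (G x))" and Z': "Z' differentiable (at (G x))"
    and relY: "\<And>y. y \<in> S \<Longrightarrow> Y' (G y) = frechet_derivative G (at y) (Y y)"
    and relZ: "\<And>y. y \<in> S \<Longrightarrow> Z' (G y) = frechet_derivative G (at y) (Z y)"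
  shows "lie_bracket Y' Z' (G x) = frechet_derivative G (at x) (lie_bracket Y Z x)"
proof -
  let ?H = "\<lambda>u v. frechet_derivative (\<lambda>y. frechet_derivative G (at y) u) (at x) v"
  have key: "frechet_derivative W' (at (G x)) (frechet_derivative G (at x) v) =
      ?H (W x) v + frechet_derivative G (at x) (frechet_derivative W (at x) v)"
    if W: "W differentiable (at x)" and W': "W' differentiable (at (G x))"
      and rel: "\<And>y. y \<in> S \<Longrightarrow> W' (G y) = frechet_derivative G (at y) (W y)" for W W' v
  proof -
    have 1: "((\<lambda>y. W' (G y)) has_derivative
        (\<lambda>v. frechet_derivative W' (at (G x)) (frechet_derivative G (at x) v))) (at x)"
      by (rule has_derivative_compose) (use W' smooth_on_has_derivative[OF G x] in \<open>auto simp: frechet_derivative_works\<close>)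
    have 2: "((\<lambda>y. frechet_derivative G (at y) (W y)) has_derivative
        (\<lambda>v. ?H (W x) v + frechet_derivative G (at x) (frechet_derivative W (at x) v))) (at x)"
      by (rule has_derivative_directional[OF S G x frechet_derivative_works[THEN iffD1, OF W]])
    have 3: "((\<lambda>y. W' (G y)) has_derivative
        (\<lambda>v. ?H (W x) v + frechet_derivative G (at x) (frechet_derivative W (at x) v))) (at x)"
      by (rule has_derivative_transform_within_open[OF 2 S x]) (simp add: rel)
    show ?thesis
      by (rule fun_cong[OF has_derivative_unique[OF 1 3]])
  qed
  have "lie_bracket Y' Z' (G x) = ?H (Z x) (Y x) - ?H (Y x) (Z x) +
      (frechet_derivative G (at x) (frechet_derivative Z (at x) (Y x)) -
       frechet_derivative G (at x) (frechet_derivative Y (at x) (Z x)))"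
    using key[OF Y Y' relY, of "Z x"] key[OF Z Z' relZ, of "Y x"] by (simp add: lie_bracket_def relY[OF x] relZ[OF x])
  also have "?H (Z x) (Y x) - ?H (Y x) (Z x) = 0"
    using second_derivative_symmetric[OF S G x] by simp
  also have "frechet_derivative G (at x) (frechet_derivative Z (at x) (Y x)) -
       frechet_derivative G (at x) (frechet_derivative Y (at x) (Z x)) =
      frechet_derivative G (at x) (lie_bracket Y Z x)"
    unfolding lie_bracket_def by (rule linear_diff[OF smooth_on_linear_frechet[OF G x], symmetric])
  finally show ?thesis by simp
qed

section \<open>Coefficients with respect to a frame\<close>

definition frame_det :: "('n::finite \<Rightarrow> real ^ 'n) \<Rightarrow> real" where
  "frame_det E = det (\<chi> i j. E j $ i)"

text \<open>Cramer's rule, so that the coefficients visibly depend continuously on the frame.\<close>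

definition frame_coef :: "('n::finite \<Rightarrow> real ^ 'n) \<Rightarrow> real ^ 'n \<Rightarrow> real ^ 'n" where
  "frame_coef E v = (\<chi> k. det (\<chi> i j. if j = k then v $ i else E j $ i) / frame_det E)"

lemma matrix_columns_vector: "(\<chi> i j. E j $ i) *v c = (\<Sum>k\<in>UNIV. c $ k *\<^sub>R E k)"
  for E :: "'n::finite \<Rightarrow> real ^ 'n"
  by (simp add: matrix_vector_mult_def vec_eq_iff mult.commute)

lemma frame_coef_iff:
  fixes E :: "'n::finite \<Rightarrow> real ^ 'n"
  assumes "frame_det E \<noteq> 0"
  shows "(\<Sum>k\<in>UNIV. c $ k *\<^sub>R E k) = v \<longleftrightarrow> c = frame_coef E v"
  using cramer[of "\<chi> i j. E j $ i" c v] assms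
  by (simp add: matrix_columns_vector frame_coef_def frame_det_def cong: if_cong)

lemma frame_coef_expand:
  fixes E :: "'n::finite \<Rightarrow> real ^ 'n"
  assumes "frame_det E \<noteq> 0"
  shows "(\<Sum>k\<in>UNIV. frame_coef E v $ k *\<^sub>R E k) = v"
  using frame_coef_iff[OF assms] by blast

lemma frame_coef_unique:
  "frame_det E \<noteq> 0 \<Longrightarrow> (\<Sum>k\<in>UNIV. c $ k *\<^sub>R E k) = v \<Longrightarrow> frame_coef E v = c"
  using frame_coef_iff by metis

lemma frame_coef_linear:
  fixes E :: "'n::finite \<Rightarrow> real ^ 'n"
  assumes "frame_det E \<noteq> 0"
  shows "linear (frame_coef E)"
proof (rule linearI)
  fix u v :: "real ^ 'n" and r :: real
  show "frame_coef E (u + v) = frame_coef E u + frame_coef E v"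
    by (rule frame_coef_unique[OF assms])
      (simp add: scaleR_add_left sum.distrib frame_coef_expand[OF assms])
  show "frame_coef E (r *\<^sub>R u) = r *\<^sub>R frame_coef E u"
    by (rule frame_coef_unique[OF assms])
      (simp flip: scaleR_scaleR scaleR_sum_right add: frame_coef_expand[OF assms])
qed

lemma frame_coef_frame:
  fixes E :: "'n::finite \<Rightarrow> real ^ 'n"
  assumes "frame_det E \<noteq> 0"
  shows "frame_coef E (E k) = axis k 1"
proof (rule frame_coef_unique[OF assms])
  have "(\<Sum>j\<in>UNIV. axis k 1 $ j *\<^sub>R E j) = (\<Sum>j\<in>UNIV. if j = k then E j else 0)"
    by (rule sum.cong) (auto simp: axis_def)
  then show "(\<Sum>j\<in>UNIV. axis k 1 $ j *\<^sub>R E j) = E k" by simp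
qed

lemma frame_det_nonzero:
  fixes E :: "'n::finite \<Rightarrow> real ^ 'n"
  assumes "span (range E) = UNIV"
  shows "frame_det E \<noteq> 0"
proof -
  have "columns (\<chi> i j. E j $ i) = range E"
    by (auto simp: columns_def column_def)
  then have "\<exists>B. (\<chi> i j. E j $ i) ** B = mat 1"
    using assms by (simp add: matrix_right_invertible_span_columns span_vec_eq)
  then have "invertible (\<chi> i j. E j $ i)"
    using matrix_left_right_inverse by (auto simp: invertible_def)
  then show ?thesis by (simp add: frame_det_def invertible_det_nz)
qed

lemma span_frame_iff:
  fixes E :: "'n::finite \<Rightarrow> real ^ 'n"
  assumes "frame_det E \<noteq> 0"
  shows "v \<in> span (E ` I) \<longleftrightarrow> (\<forall>i. i \<notin> I \<longrightarrow> frame_coef E v $ i = 0)"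
proof
  assume "v \<in> span (E ` I)"
  moreover have "subspace {v. \<forall>i. i \<notin> I \<longrightarrow> frame_coef E v $ i = 0}"
    using frame_coef_linear[OF assms]
    by (auto simp: subspace_def linear_0 linear_add linear_scale)
  moreover have "E ` I \<subseteq> {v. \<forall>i. i \<notin> I \<longrightarrow> frame_coef E v $ i = 0}"
    by (auto simp: frame_coef_frame[OF assms] axis_def)
  ultimately show "\<forall>i. i \<notin> I \<longrightarrow> frame_coef E v $ i = 0"
    using span_minimal by blast
next
  assume 0: "\<forall>i. i \<notin> I \<longrightarrow> frame_coef E v $ i = 0"
  have "(\<Sum>k\<in>UNIV. frame_coef E v $ k *\<^sub>R E k) \<in> span (E ` I)"
  proof (rule span_sum)
    fix k show "frame_coef E v $ k *\<^sub>R E k \<in> span (E ` I)"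
      using 0 by (cases "k \<in> I") (auto intro: span_scale span_base span_zero)
  qed
  then show "v \<in> span (E ` I)" by (simp add: frame_coef_expand[OF assms])
qed

lemma tendsto_det:
  fixes M :: "'x \<Rightarrow> real ^ 'n ^ 'n"
  assumes "(M \<longlongrightarrow> M0) F"
  shows "((\<lambda>x. det (M x)) \<longlongrightarrow> det M0) F"
  unfolding det_def by (intro tendsto_intros assms)

lemma tendsto_frame_det:
  assumes "\<And>k. ((\<lambda>x. E x k) \<longlongrightarrow> E0 k) F"
  shows "((\<lambda>x. frame_det (E x)) \<longlongrightarrow> frame_det E0) F"
  unfolding frame_det_def
  by (rule tendsto_det, rule vec_tendstoI, simp, rule vec_tendstoI, simp, rule tendsto_vec_nth, rule assms)

lemma tendsto_frame_coef:
  assumes "\<And>k. ((\<lambda>x. E x k) \<longlongrightarrow> E0 k) F" "(v \<longlongrightarrow> v0) F" "frame_det E0 \<noteq> 0"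
  shows "((\<lambda>x. frame_coef (E x) (v x)) \<longlongrightarrow> frame_coef E0 v0) F"
proof (rule vec_tendstoI)
  fix k
  have "((\<lambda>x. det (\<chi> i j. if j = k then v x $ i else E x j $ i)) \<longlongrightarrow>
      det (\<chi> i j. if j = k then v0 $ i else E0 j $ i)) F"
    by (rule tendsto_det, rule vec_tendstoI, simp, rule vec_tendstoI)
      (auto intro!: tendsto_vec_nth assms(1,2))
  then show "((\<lambda>x. frame_coef (E x) (v x) $ k) \<longlongrightarrow> frame_coef E0 v0 $ k) F"
    unfolding frame_coef_def
    by (simp add: tendsto_divide tendsto_frame_det[OF assms(1)] assms(3))
qed

section \<open>Coordinate systems on a manifold\<close>

text \<open>A diffeomorphism from an open part of the model space onto an open part of the manifold. The
  exponential coordinates of both frames are of this kind. Everything on the manifold is transported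
  to such coordinates once, so that the analysis takes place on open sets of the model space.\<close>

locale coordinates =
  fixes A :: "('a::t2_space, 'n::finite) chart set" and V :: "(real ^ 'n) set" and F :: "real ^ 'n \<Rightarrow> 'a"
  assumes atlas: "smooth_atlas A"
    and open_V: "open V" and inj_F: "inj_on F V" and open_FV: "open (F ` V)"
    and cont_F: "continuous_on V F"
    and smooth_F: "\<And>c. c \<in> A \<Longrightarrow> smooth_on (V \<inter> F -` fst c) (snd c \<circ> F)"
    and smooth_inv_F: "smooth_fun A (F ` V) (inv_into V F)"
begin

text \<open>The transported fields; for the fields of a frame they are the fields with a tilde of the
  nilpotent approximation.\<close>

abbreviation "in_coords \<equiv> field_in_coordinates A V F"

lemma chartD:
  assumes "c \<in> A"
  shows "open (fst c)" "open (snd c ` fst c)" "continuous_on (fst c) (snd c)"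
    "continuous_on (snd c ` fst c) (chart_inv c)"
    "\<And>q. q \<in> fst c \<Longrightarrow> chart_inv c (snd c q) = q"
  using atlas assms by (auto simp: smooth_atlas_def is_chart_def homeomorphism_def)

lemma chart_at: "chart_at A q \<in> A" "q \<in> fst (chart_at A q)"
proof -
  have "q \<in> (\<Union>c\<in>A. fst c)" using atlas by (simp add: smooth_atlas_def)
  then have "\<exists>c. c \<in> A \<and> q \<in> fst c" by blast
  then have "chart_at A q \<in> A \<and> q \<in> fst (chart_at A q)"
    unfolding chart_at_def by (rule someI_ex)
  then show "chart_at A q \<in> A" "q \<in> fst (chart_at A q)" by auto
qed

lemma open_chart_image:
  assumes c: "c \<in> A" and "open U"
  shows "open (snd c ` (U \<inter> fst c))"
proof -
  have "snd c ` (U \<inter> fst c) = snd c ` fst c \<inter> chart_inv c -` U"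
    using chartD(5)[OF c] by force
  then show ?thesis
    using continuous_open_preimage[OF chartD(4)[OF c] chartD(2)[OF c] assms(2)] by simp
qed

lemma smooth_transition:
  "c \<in> A \<Longrightarrow> c' \<in> A \<Longrightarrow> smooth_on (snd c ` (fst c \<inter> fst c')) (snd c' \<circ> chart_inv c)"
  using atlas by (auto simp: smooth_atlas_def)

lemma open_preimage: "open U \<Longrightarrow> open (V \<inter> F -` U)"
  using continuous_open_preimage[OF cont_F open_V] .

definition chart_to_coords :: "('a, 'n) chart \<Rightarrow> real ^ 'n \<Rightarrow> real ^ 'n" where
  "chart_to_coords c = inv_into V F \<circ> chart_inv c"

lemma smooth_chart_to_coords: "c \<in> A \<Longrightarrow> smooth_on (snd c ` (F ` V \<inter> fst c)) (chart_to_coords c)"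
  using smooth_inv_F by (auto simp: smooth_fun_def chart_to_coords_def)

lemma inv_F: "x \<in> V \<Longrightarrow> inv_into V F (F x) = x"
  using inj_F by simp

lemma chart_to_coords_chart: "c \<in> A \<Longrightarrow> x \<in> V \<Longrightarrow> F x \<in> fst c \<Longrightarrow> chart_to_coords c (snd c (F x)) = x"
  by (simp add: chart_to_coords_def chartD(5) inv_F)

lemma chart_to_coords_domain:
  assumes "c \<in> A" "y \<in> snd c ` (F ` V \<inter> fst c)"
  shows "chart_to_coords c y \<in> V" "F (chart_to_coords c y) \<in> fst c" "snd c (F (chart_to_coords c y)) = y"
proof -
  obtain x where x: "x \<in> V" "F x \<in> fst c" "y = snd c (F x)" using assms by blast
  then show "chart_to_coords c y \<in> V" "F (chart_to_coords c y) \<in> fst c" "snd c (F (chart_to_coords c y)) = y"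
    using chart_to_coords_chart[OF assms(1) x(1,2)] by simp_all
qed

lemma frechet_id_near:
  assumes "open S" "x \<in> S" "\<And>y. y \<in> S \<Longrightarrow> f y = y"
  shows "frechet_derivative f (at x) v = v"
proof -
  have "frechet_derivative f (at x) = frechet_derivative (\<lambda>x. x) (at x)"
    by (rule frechet_derivative_cong_open[OF assms])
  then show ?thesis using frechet_derivative_at[OF has_derivative_ident] by metis
qed

text \<open>Tangent vectors are represented in the chart chosen at their base point.\<close>

definition coords_diff :: "real ^ 'n \<Rightarrow> real ^ 'n \<Rightarrow> real ^ 'n" where
  "coords_diff x = differential A (inv_into V F) (F x)"

lemma in_coords_lx: "in_coords Z x = coords_diff x (Z (F x))"
  by (simp add: field_in_coordinates_def coords_diff_def)

lemma coords_diff_alt: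
  "coords_diff x v = frechet_derivative (chart_to_coords (chart_at A (F x))) (at (snd (chart_at A (F x)) (F x))) v"
  by (simp add: coords_diff_def differential_def chart_to_coords_def)

lemma in_chart_image: "x \<in> V \<Longrightarrow> F x \<in> fst c \<Longrightarrow> snd c (F x) \<in> snd c ` (F ` V \<inter> fst c)"
  by auto

lemma coords_diff_linear: "x \<in> V \<Longrightarrow> linear (coords_diff x)"
  unfolding coords_diff_alt[abs_def]
  by (rule smooth_on_linear_frechet[OF smooth_chart_to_coords[OF chart_at(1)]]) (use chart_at in auto)

text \<open>Chain rule: the derivative of the coordinates may be computed in any chart.\<close>

lemma coords_diff_components:
  assumes c: "c \<in> A" and x: "x \<in> V" "F x \<in> fst c"
  shows "coords_diff x v = frechet_derivative (chart_to_coords c) (at (snd c (F x))) (components A c (F x) v)"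
proof -
  define c0 where "c0 = chart_at A (F x)"
  have c0: "c0 \<in> A" "F x \<in> fst c0" using chart_at by (auto simp: c0_def)
  let ?T = "snd c \<circ> chart_inv c0" and ?y = "snd c0 (F x)"
  let ?N = "snd c0 ` (F ` V \<inter> fst c \<inter> fst c0)"
  have N: "open ?N" "?y \<in> ?N"
    using open_chart_image[OF c0(1) open_Int[OF open_FV chartD(1)[OF c]]] x c0 by auto
  have T: "(?T has_derivative frechet_derivative ?T (at ?y)) (at ?y)"
    by (rule smooth_on_has_derivative[OF smooth_transition[OF c0(1) c]]) (use x c0 in auto)
  have Ty: "?T ?y = snd c (F x)" using c0 by (simp add: chartD(5))
  have G: "(chart_to_coords c has_derivative frechet_derivative (chart_to_coords c) (at (snd c (F x)))) (at (snd c (F x)))"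
    by (rule smooth_on_has_derivative[OF smooth_chart_to_coords[OF c]]) (use x in auto)
  have "((\<lambda>y. chart_to_coords c (?T y)) has_derivative
      (\<lambda>v. frechet_derivative (chart_to_coords c) (at (snd c (F x))) (frechet_derivative ?T (at ?y) v))) (at ?y)"
    by (rule has_derivative_compose[OF T]) (use G Ty in simp)
  then have "(chart_to_coords c0 has_derivative
      (\<lambda>v. frechet_derivative (chart_to_coords c) (at (snd c (F x))) (frechet_derivative ?T (at ?y) v))) (at ?y)"
    by (rule has_derivative_transform_within_open[OF _ N]) (use c c0 in \<open>auto simp: chart_to_coords_def chartD(5)\<close>)
  from fun_cong[OF frechet_derivative_at[OF this], of v] show ?thesis
    by (simp add: coords_diff_alt components_def coord_change_def flip: c0_def)
qed

lemma components_chart_at: "components A (chart_at A q) q v = v"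
proof -
  let ?c = "chart_at A q"
  have "open (snd ?c ` (UNIV \<inter> fst ?c))"
    by (rule open_chart_image[OF chart_at(1)]) simp
  then show ?thesis
    unfolding components_def coord_change_def
    by (rule frechet_id_near) (use chart_at chartD(5)[OF chart_at(1)] in auto)
qed

lemma in_coords_chart:
  assumes c: "c \<in> A" and x: "x \<in> V" "F x \<in> fst c"
  shows "in_coords Z x = frechet_derivative (chart_to_coords c) (at (snd c (F x))) (field_in_chart A c Z (snd c (F x)))"
  using coords_diff_components[OF assms] chartD(5)[OF c x(2)] by (simp add: in_coords_lx field_in_chart_def)

lemma chart_derivative_inverse:
  assumes c: "c \<in> A" and x: "x \<in> V" "F x \<in> fst c"
  shows "frechet_derivative (snd c \<circ> F) (at x)
      (frechet_derivative (chart_to_coords c) (at (snd c (F x))) v) = v"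
    "frechet_derivative (chart_to_coords c) (at (snd c (F x)))
      (frechet_derivative (snd c \<circ> F) (at x) v) = v"
proof -
  let ?y = "snd c (F x)"
  have G: "(chart_to_coords c has_derivative frechet_derivative (chart_to_coords c) (at ?y)) (at ?y)"
    by (rule smooth_on_has_derivative[OF smooth_chart_to_coords[OF c]]) (use x in auto)
  have P: "((snd c \<circ> F) has_derivative frechet_derivative (snd c \<circ> F) (at x)) (at x)"
    by (rule smooth_on_has_derivative[OF smooth_F[OF c]]) (use x in auto)
  have Gy: "chart_to_coords c ?y = x" by (rule chart_to_coords_chart[OF assms])
  have 1: "((\<lambda>y. (snd c \<circ> F) (chart_to_coords c y)) has_derivative
      (\<lambda>v. frechet_derivative (snd c \<circ> F) (at x) (frechet_derivative (chart_to_coords c) (at ?y) v))) (at ?y)"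
    by (rule has_derivative_compose[OF G]) (use P Gy in \<open>simp del: o_apply\<close>)
  have "frechet_derivative (\<lambda>y. (snd c \<circ> F) (chart_to_coords c y)) (at ?y) v = v"
    by (rule frechet_id_near[OF open_chart_image[OF c open_FV] in_chart_image[OF x]])
      (use chart_to_coords_domain[OF c] in auto)
  then show "frechet_derivative (snd c \<circ> F) (at x)
      (frechet_derivative (chart_to_coords c) (at ?y) v) = v"
    using fun_cong[OF frechet_derivative_at[OF 1]] by metis
  have 2: "((\<lambda>x. chart_to_coords c ((snd c \<circ> F) x)) has_derivative
      (\<lambda>v. frechet_derivative (chart_to_coords c) (at ?y) (frechet_derivative (snd c \<circ> F) (at x) v))) (at x)"
    by (rule has_derivative_compose[OF P]) (use G in simp)
  have "frechet_derivative (\<lambda>x. chart_to_coords c ((snd c \<circ> F) x)) (at x) v = v"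
    by (rule frechet_id_near[OF open_preimage[OF chartD(1)[OF c]]])
      (use x chart_to_coords_chart[OF c] in auto)
  then show "frechet_derivative (chart_to_coords c) (at ?y)
      (frechet_derivative (snd c \<circ> F) (at x) v) = v"
    using fun_cong[OF frechet_derivative_at[OF 2]] by metis
qed

lemma coords_diff_inj:
  assumes x: "x \<in> V" shows "inj (coords_diff x)"
proof (rule inj_on_inverseI)
  show "frechet_derivative (snd (chart_at A (F x)) \<circ> F) (at x) (coords_diff x v) = v" for v
    unfolding coords_diff_alt by (rule chart_derivative_inverse(1)[OF chart_at(1) x chart_at(2)])
qed

lemma field_in_chart_in_coords:
  assumes c: "c \<in> A" and x: "x \<in> V" "F x \<in> fst c"
  shows "field_in_chart A c Z (snd c (F x)) = frechet_derivative (snd c \<circ> F) (at x) (in_coords Z x)"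
  by (simp add: in_coords_chart[OF assms] chart_derivative_inverse[OF assms])

lemma smooth_coords_to_chart:
  assumes "c \<in> A" "N \<subseteq> V" "N \<subseteq> F -` fst c"
  shows "smooth_on N (\<lambda>x. snd c (F x))"
  using smooth_on_subset[OF smooth_F[OF assms(1)], of N] assms by (auto simp: comp_def)

lemma smooth_fun_coordinates:
  assumes N: "open N" "N \<subseteq> V" "F ` N \<subseteq> W" and W: "open W" and h: "smooth_fun A W h"
  shows "smooth_on N (\<lambda>x. h (F x))"
proof (rule smooth_on_local)
  fix x assume x: "x \<in> N"
  define c where "c = chart_at A (F x)"
  have c: "c \<in> A" "F x \<in> fst c" using chart_at by (auto simp: c_def)
  let ?N = "N \<inter> (V \<inter> F -` fst c)"
  have oN: "open ?N" using N(1) open_preimage[OF chartD(1)[OF c(1)]] by auto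
  have "smooth_on ?N (\<lambda>x. (h \<circ> chart_inv c) (snd c (F x)))"
  proof (rule smooth_on_compose[OF oN open_chart_image[OF c(1) W]])
    show "smooth_on ?N (\<lambda>x. snd c (F x))" by (rule smooth_coords_to_chart[OF c(1)]) auto
    show "smooth_on (snd c ` (W \<inter> fst c)) (h \<circ> chart_inv c)"
      using h c(1) by (auto simp: smooth_fun_def)
  qed (use N in auto)
  then have "smooth_on ?N (\<lambda>x. h (F x))"
    by (rule smooth_on_cong[OF oN]) (use chartD(5)[OF c(1)] in auto)
  then show "\<exists>T. open T \<and> x \<in> T \<and> smooth_on T (\<lambda>x. h (F x))"
    using oN x c N by blast
qed

lemma smooth_field_coordinates:
  assumes N: "open N" "N \<subseteq> V" "F ` N \<subseteq> W" and W: "open W" and Z: "smooth_field A W Z"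
  shows "smooth_on N (in_coords Z)"
proof (rule smooth_on_local)
  fix x assume x: "x \<in> N"
  define c where "c = chart_at A (F x)"
  have c: "c \<in> A" "F x \<in> fst c" using chart_at by (auto simp: c_def)
  let ?N = "N \<inter> (V \<inter> F -` fst c)" and ?C = "snd c ` ((F ` V \<inter> W) \<inter> fst c)"
  have oN: "open ?N" using N(1) open_preimage[OF chartD(1)[OF c(1)]] by auto
  have oC: "open ?C" by (rule open_chart_image[OF c(1) open_Int[OF open_FV W]])
  have "smooth_on ?N (\<lambda>x. frechet_derivative (chart_to_coords c) (at (snd c (F x))) (field_in_chart A c Z (snd c (F x))))"
  proof (rule smooth_on_compose[OF oN oC, where f = "\<lambda>x. snd c (F x)"])
    show "smooth_on ?N (\<lambda>x. snd c (F x))" by (rule smooth_coords_to_chart[OF c(1)]) auto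
    show "smooth_on ?C (\<lambda>y. frechet_derivative (chart_to_coords c) (at y) (field_in_chart A c Z y))"
    proof (rule smooth_on_directional[OF oC])
      show "smooth_on ?C (chart_to_coords c)" by (rule smooth_on_subset[OF smooth_chart_to_coords[OF c(1)]]) auto
      have "smooth_on (snd c ` (W \<inter> fst c)) (field_in_chart A c Z)"
        using Z c(1) by (auto simp: smooth_field_def)
      then show "smooth_on ?C (field_in_chart A c Z)" by (rule smooth_on_subset) auto
    qed
  qed (use N in auto)
  then have "smooth_on ?N (in_coords Z)"
    by (rule smooth_on_cong[OF oN]) (use in_coords_chart[OF c(1)] in auto)
  then show "\<exists>T. open T \<and> x \<in> T \<and> smooth_on T (in_coords Z)"
    using oN x c N by blast
qed

text \<open>Near a point both sides are pushed forward from the chart chosen there, in which the bracket on the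
  manifold is the bracket of the component fields.\<close>

lemma in_coords_bracket:
  assumes Y: "smooth_on V (in_coords Y)" and Z: "smooth_on V (in_coords Z)" and x: "x \<in> V"
  shows "in_coords (bracket A Y Z) x = lie_bracket (in_coords Y) (in_coords Z) x"
proof -
  define c where "c = chart_at A (F x)"
  have c: "c \<in> A" "F x \<in> fst c" using chart_at by (auto simp: c_def)
  let ?C = "snd c ` (F ` V \<inter> fst c)" and ?y = "snd c (F x)"
  have oC: "open ?C" by (rule open_chart_image[OF c(1) open_FV])
  have y: "?y \<in> ?C" using x c by auto
  have val: "field_in_chart A c W ?y = W (F x)" for W
    using components_chart_at[of "F x"] c by (simp add: field_in_chart_def chartD(5) flip: c_def)
  have diff: "field_in_chart A c W differentiable (at ?y)" if W: "smooth_on V (in_coords W)" for W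
  proof -
    let ?N = "V \<inter> F -` fst c"
    have oN: "open ?N" by (rule open_preimage[OF chartD(1)[OF c(1)]])
    have "smooth_on ?C (\<lambda>y. frechet_derivative (snd c \<circ> F) (at (chart_to_coords c y)) (in_coords W (chart_to_coords c y)))"
      by (rule smooth_on_compose[OF oC oN _ smooth_chart_to_coords[OF c(1)]])
        (use chart_to_coords_domain[OF c(1)] smooth_F[OF c(1)] in \<open>auto intro!: smooth_on_directional oN smooth_on_subset[OF W] simp: comp_def\<close>)
    then have "smooth_on ?C (field_in_chart A c W)"
      by (rule smooth_on_cong[OF oC])
        (use chart_to_coords_domain[OF c(1)] field_in_chart_in_coords[OF c(1) chart_to_coords_domain(1,2)[OF c(1)]] in auto)
    then show ?thesis using y by (rule smooth_on_imp_differentiable)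
  qed
  have Gy: "chart_to_coords c ?y = x" by (rule chart_to_coords_chart[OF c(1) x c(2)])
  have rel: "in_coords W (chart_to_coords c y) = frechet_derivative (chart_to_coords c) (at y) (field_in_chart A c W y)"
    if "y \<in> ?C" for W y
    using in_coords_chart[OF c(1) chart_to_coords_domain(1,2)[OF c(1) that], of W] chart_to_coords_domain(3)[OF c(1) that] by simp
  have "lie_bracket (in_coords Y) (in_coords Z) (chart_to_coords c ?y) =
      frechet_derivative (chart_to_coords c) (at ?y) (lie_bracket (field_in_chart A c Y) (field_in_chart A c Z) ?y)"
    by (rule lie_bracket_related[OF oC smooth_chart_to_coords[OF c(1)] y diff[OF Y] diff[OF Z] _ _ rel rel])
      (use Y Z x Gy smooth_on_imp_differentiable in auto)
  moreover have "lie_bracket (field_in_chart A c Y) (field_in_chart A c Z) ?y = bracket A Y Z (F x)"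
    by (simp add: lie_bracket_def bracket_def Let_def val flip: c_def)
  ultimately show ?thesis
    using Gy by (simp add: in_coords_lx coords_diff_alt flip: c_def)
qed

end

section \<open>Weights\<close>

lemma pos_bounds: "1 \<le> pos i" "pos i \<le> CARD('n)" for i :: "'n::{finite,linorder}"
proof -
  have "card {i} \<le> card {..i}" by (rule card_mono) auto
  then show "1 \<le> pos i" by (simp add: pos_def)
  show "pos i \<le> CARD('n)" unfolding pos_def by (rule card_mono) auto
qed

text \<open>The numbers do not decrease with the step and end with the dimension, so the intervals that define
  the weights, some of which may be empty, partition the positions.\<close>

lemma weight_iff:
  fixes i :: "'n::{finite,linorder}"
  assumes nn0: "nn 0 = 0" and mono: "\<And>j. 1 \<le> j \<Longrightarrow> j < s \<Longrightarrow> nn j \<le> nn (Suc j)" and top: "nn s = CARD('n)"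
  shows "weight s nn i \<in> {1..s}" "nn (weight s nn i - 1) < pos i" "pos i \<le> nn (weight s nn i)"
    "j \<in> {1..s} \<Longrightarrow> weight s nn i \<le> j \<longleftrightarrow> pos i \<le> nn j"
proof -
  have le: "nn j \<le> nn k" if "1 \<le> j" "j \<le> k" "k \<le> s" for j k
    using that(2,1,3) by (induction k rule: dec_induct) (auto intro: order_trans[OF _ mono])
  define j0 where "j0 = (LEAST j. pos i \<le> nn j)"
  have ex: "pos i \<le> nn s" using pos_bounds(2)[of i] top by simp
  have j0: "pos i \<le> nn j0" "j0 \<le> s" unfolding j0_def by (rule LeastI[of "\<lambda>j. pos i \<le> nn j", OF ex], rule Least_le[of "\<lambda>j. pos i \<le> nn j", OF ex])
  have j1: "1 \<le> j0" using j0(1) nn0 pos_bounds(1)[of i] by (cases j0) auto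
  have j2: "nn (j0 - 1) < pos i"
    using not_less_Least[of "j0 - 1" "\<lambda>j. pos i \<le> nn j"] j1 by (auto simp: j0_def)
  have uniq: "j = j0" if "j \<in> {1..s}" "nn (j - 1) < pos i" "pos i \<le> nn j" for j
  proof -
    have "j0 \<le> j" unfolding j0_def by (rule Least_le[of "\<lambda>j. pos i \<le> nn j", OF that(3)])
    moreover have "\<not> j0 < j" using le[of j0 "j - 1"] j0 j1 that by fastforce
    ultimately show ?thesis by simp
  qed
  have w: "weight s nn i = j0"
    unfolding weight_def
  proof (rule the_equality)
    show "j0 \<in> {1..s} \<and> nn (j0 - 1) < pos i \<and> pos i \<le> nn j0"
      by (intro conjI j2 j0(1)) (use j0(2) j1 in simp)
  qed (use uniq in blast)
  show "weight s nn i \<in> {1..s}" unfolding w using j0(2) j1 by simp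
  show "nn (weight s nn i - 1) < pos i" unfolding w by (rule j2)
  show "pos i \<le> nn (weight s nn i)" unfolding w by (rule j0(1))
  show "weight s nn i \<le> j \<longleftrightarrow> pos i \<le> nn j" if "j \<in> {1..s}"
    unfolding w
  proof
    assume "j0 \<le> j"
    then show "pos i \<le> nn j" using le[of j0 j] j0(1) j1 that by simp
  next
    assume "pos i \<le> nn j"
    then show "j0 \<le> j" unfolding j0_def by (rule Least_le[of "\<lambda>j. pos i \<le> nn j"])
  qed
qed

section \<open>The filtration generated by the horizontal fields\<close>

locale frame_coordinates = coordinates "atlas S" V F
  for S :: "('a::{t2_space,second_countable_topology}, 'n::{finite,linorder}, 'e::euclidean_space) sr_structure"
    and V F +
  fixes W :: "'a set" and s :: nat and nn :: "nat \<Rightarrow> nat" and X :: "'n \<Rightarrow> 'a \<Rightarrow> (real, 'n) vec"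
  assumes euclidean: "euclidean_bundle S" and morphism: "bundle_morphism S"
    and frame: "privileged_frame S W s nn X" and FV_W: "F ` V \<subseteq> W" and zero_V: "0 \<in> V"
begin

abbreviation w :: "'n \<Rightarrow> nat" where "w \<equiv> weight s nn"
abbreviation "Xt i \<equiv> in_coords (X i)"

lemma open_W: "open W" using frame by (simp add: privileged_frame_def)

lemma s_ge_1: "1 \<le> s" using frame by (simp add: privileged_frame_def equiregular_on_def)

lemma F_in_W: "x \<in> V \<Longrightarrow> F x \<in> W" using FV_W by auto

lemma X_smooth: "smooth_field (atlas S) W (X i)"
  using frame by (simp add: privileged_frame_def)

lemma Xt_smooth: "smooth_on V (Xt i)"
  by (rule smooth_field_coordinates[OF open_V order_refl FV_W open_W X_smooth])

lemma flag_basis: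
  assumes "q \<in> W" "j \<in> {1..s}"
  shows "span ((\<lambda>i. X i q) ` {i. pos i \<le> nn j}) = flag_at S W j q"
  using frame assms by (simp add: privileged_frame_def basis_family_def)

lemma flag_mono: "Z \<in> flag S W k \<Longrightarrow> 1 \<le> k \<Longrightarrow> Z \<in> flag S W (Suc k)"
  by (cases k, simp, simp only: flag.simps, rule CollectI, rule exI[of _ Z], rule exI[of _ "\<lambda>_. Z"],
      rule exI[of _ "\<lambda>_. Z"], rule exI[of _ "0::nat"]) simp

lemma weights:
  fixes i :: 'n
  shows "w i \<in> {1..s}" "nn (w i - 1) < pos i" "pos i \<le> nn (w i)"
    "j \<in> {1..s} \<Longrightarrow> w i \<le> j \<longleftrightarrow> pos i \<le> nn j"
proof -
  have q: "F 0 \<in> W" using F_in_W[OF zero_V] .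
  have 0: "nn 0 = 0" "flag_at S W s (F 0) = UNIV" "\<And>k. k \<in> {1..s} \<Longrightarrow> dim (flag_at S W k (F 0)) = nn k"
    using frame q by (auto simp: privileged_frame_def equiregular_on_def)
  have "nn j \<le> nn (Suc j)" if "1 \<le> j" "j < s" for j
  proof -
    have "flag_at S W j (F 0) \<subseteq> flag_at S W (Suc j) (F 0)"
      using flag_mono that by (auto simp: flag_at_def)
    then have "dim (flag_at S W j (F 0)) \<le> dim (flag_at S W (Suc j) (F 0))" by (rule dim_subset)
    then show ?thesis using 0(3)[of j] 0(3)[of "Suc j"] that by simp
  qed
  moreover have "nn s = CARD('n)" using 0(2) 0(3)[of s] s_ge_1 by simp
  ultimately show "w i \<in> {1..s}" "nn (w i - 1) < pos i" "pos i \<le> nn (w i)"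
    "j \<in> {1..s} \<Longrightarrow> w i \<le> j \<longleftrightarrow> pos i \<le> nn j"
    using weight_iff[where nn=nn and s=s and i=i, OF 0(1)] by auto
qed

lemma Xt_det: "x \<in> V \<Longrightarrow> frame_det (\<lambda>i. Xt i x) \<noteq> 0"
proof (rule frame_det_nonzero)
  assume x: "x \<in> V"
  have "span (range (\<lambda>i. X i (F x))) = UNIV"
    using frame F_in_W[OF x] by (simp add: privileged_frame_def basis_family_def)
  moreover have "range (\<lambda>i. Xt i x) = coords_diff x ` range (\<lambda>i. X i (F x))"
    by (auto simp: in_coords_lx)
  moreover have "surj (coords_diff x)"
    using linear_injective_imp_surjective coords_diff_linear[OF x] coords_diff_inj[OF x] by blast
  ultimately show "span (range (\<lambda>i. Xt i x)) = UNIV"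
    using linear_span_image[OF coords_diff_linear[OF x]] by simp
qed

text \<open>In coordinates, the value at a point of the flag of the distribution. Expressed through the frame,
  membership becomes the vanishing of continuous coefficient functions.\<close>

definition filtration_at :: "nat \<Rightarrow> (real, 'n) vec \<Rightarrow> ((real, 'n) vec) set" where
  "filtration_at k x = span ((\<lambda>i. Xt i x) ` {i. w i \<le> k})"

lemma filtration_at_iff: "x \<in> V \<Longrightarrow> v \<in> filtration_at k x \<longleftrightarrow> (\<forall>i. k < w i \<longrightarrow> frame_coef (\<lambda>i. Xt i x) v $ i = 0)"
  unfolding filtration_at_def by (subst span_frame_iff[OF Xt_det]) (auto simp: not_le)

lemma filtration_at_subspace: "subspace (filtration_at k x)" by (simp add: filtration_at_def)

lemma filtration_at_mono: "k \<le> l \<Longrightarrow> filtration_at k x \<subseteq> filtration_at l x"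
  unfolding filtration_at_def by (rule span_mono) auto

lemma w_le_s: "w i \<le> s" and w_pos: "0 < w i"
  using weights(1)[of i] by auto

lemma filtration_at_top: "x \<in> V \<Longrightarrow> s \<le> k \<Longrightarrow> v \<in> filtration_at k x"
  using w_le_s by (subst filtration_at_iff) (meson not_le order_trans)+

lemma filtration_at_flag:
  assumes x: "x \<in> V" and k: "k \<in> {1..s}"
  shows "filtration_at k x = coords_diff x ` flag_at S W k (F x)"
proof -
  have "{i. w i \<le> k} = {i. pos i \<le> nn k}" using weights(4)[OF k] by simp
  moreover have "(\<lambda>i. Xt i x) ` I = coords_diff x ` ((\<lambda>i. X i (F x)) ` I)" for I
    by (auto simp: in_coords_lx)
  ultimately show ?thesis
    unfolding filtration_at_def using linear_span_image[OF coords_diff_linear[OF x]] flag_basis[OF F_in_W[OF x] k] by simp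
qed

text \<open>In a local trivialization a section has smooth components, and the anchor maps the constant
  sections to smooth fields.\<close>

lemma horizontal_in_coords_smooth:
  assumes "Z \<in> horizontal S W"
  shows "smooth_on V (in_coords Z)"
proof (rule smooth_on_local)
  fix x assume x: "x \<in> V"
  obtain \<sigma> where \<sigma>: "smooth_section S W \<sigma>" "\<And>q. q \<in> W \<Longrightarrow> Z q = anchor S q (\<sigma> q)"
    using assms by (auto simp: horizontal_def)
  have "F x \<in> (\<Union>(P, \<Phi>)\<in>trivs S. P)" using euclidean by (simp add: euclidean_bundle_def)
  then obtain P \<Phi> where t: "(P, \<Phi>) \<in> trivs S" "F x \<in> P" by auto
  have P: "open P" "\<And>p. p \<in> P \<Longrightarrow> linear (\<Phi> p)" "\<And>p. p \<in> P \<Longrightarrow> bij (\<Phi> p)"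
    using euclidean t(1) unfolding euclidean_bundle_def by blast+
  define E where "E b = (\<lambda>q. anchor S q (inv (\<Phi> q) b))" for b
  have E: "smooth_field (atlas S) P (E b)" for b
    using morphism t(1) unfolding bundle_morphism_def E_def by blast
  have sec: "smooth_fun (atlas S) (W \<inter> P) (\<lambda>p. \<Phi> p (\<sigma> p))"
    using \<sigma>(1) t(1) unfolding smooth_section_def by blast
  let ?N = "V \<inter> F -` P"
  have oN: "open ?N" by (rule open_preimage[OF P(1)])
  have 1: "smooth_on ?N (in_coords (E b))" for b
    by (rule smooth_field_coordinates[OF oN _ _ P(1) E]) auto
  have 2: "smooth_on ?N (\<lambda>x. \<Phi> (F x) (\<sigma> (F x)))"
    by (rule smooth_fun_coordinates[OF oN _ _ _ sec]) (use FV_W open_W P(1) in auto)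
  have "smooth_on ?N (\<lambda>x. \<Sum>b\<in>Basis. (\<Phi> (F x) (\<sigma> (F x)) \<bullet> b) *\<^sub>R in_coords (E b) x)"
    by (intro smooth_on_sum oN smooth_on_scaleR smooth_on_inner_right 1 2)
  then have "smooth_on ?N (in_coords Z)"
  proof (rule smooth_on_cong[OF oN])
    fix y assume y: "y \<in> ?N"
    let ?q = "F y"
    have l: "linear (\<lambda>u. coords_diff y (anchor S ?q (inv (\<Phi> ?q) u)))"
    proof -
      have "linear (inv (\<Phi> ?q))"
        using P(2,3)[of ?q] y by (auto simp: bij_def intro: inj_linear_imp_inv_linear)
      note l1 = this
      have l2: "linear (anchor S ?q)" using morphism by (simp add: bundle_morphism_def)
      show ?thesis
      proof -
        have "linear (coords_diff y \<circ> (anchor S ?q \<circ> inv (\<Phi> ?q)))"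
          by (intro linear_compose l1 l2 coords_diff_linear) (use y in simp)
        then show ?thesis unfolding comp_def .
      qed
    qed
    have "in_coords Z y = coords_diff y (anchor S ?q (inv (\<Phi> ?q) (\<Phi> ?q (\<sigma> ?q))))"
    proof -
      have "inv (\<Phi> ?q) (\<Phi> ?q (\<sigma> ?q)) = \<sigma> ?q"
        by (intro inv_f_f bij_is_inj P(3)) (use y in simp)
      moreover have "Z ?q = anchor S ?q (\<sigma> ?q)" by (rule \<sigma>(2)[OF F_in_W]) (use y in simp)
      ultimately show ?thesis unfolding in_coords_lx by simp
    qed
    also have "\<dots> = (\<Sum>b\<in>Basis. (\<Phi> ?q (\<sigma> ?q) \<bullet> b) *\<^sub>R in_coords (E b) y)"
      unfolding in_coords_lx E_def by (rule linear_apply_Basis[OF l])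
    finally show "(\<Sum>b\<in>Basis. (\<Phi> ?q (\<sigma> ?q) \<bullet> b) *\<^sub>R in_coords (E b) y) = in_coords Z y" by simp
  qed
  then show "\<exists>T. open T \<and> x \<in> T \<and> smooth_on T (in_coords Z)"
    using oN x t(2) by blast
qed

lemma in_coords_sum: "x \<in> V \<Longrightarrow> in_coords (\<lambda>q. Y q + (\<Sum>i<N. Z i q)) x = in_coords Y x + (\<Sum>i<N. in_coords (Z i) x)"
  for N :: nat
  using coords_diff_linear[of x] by (simp add: in_coords_lx linear_add linear_sum)

lemma in_coords_bracket_smooth:
  "smooth_on V (in_coords Y) \<Longrightarrow> smooth_on V (in_coords Z) \<Longrightarrow> smooth_on V (in_coords (bracket (atlas S) Y Z))"
  by (rule smooth_on_cong[OF open_V smooth_on_lie_bracket[OF open_V, of "in_coords Y" "in_coords Z"]]) (simp_all add: in_coords_bracket)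

lemma flag_in_coords_smooth: "Z \<in> flag S W k \<Longrightarrow> smooth_on V (in_coords Z)"
proof (induction k arbitrary: Z rule: nat_less_induct)
  case (1 k)
  consider "k = 0" | "k = Suc 0" | l where "k = Suc (Suc l)" by (metis nat.exhaust)
  then show ?case
  proof cases
    assume k: "k = 0"
    show ?thesis
      by (rule smooth_on_cong[OF open_V smooth_on_const[of V 0]])
        (use 1 k coords_diff_linear in \<open>auto simp: in_coords_lx linear_0\<close>)
  next
    assume "k = Suc 0"
    then show ?thesis using 1 horizontal_in_coords_smooth by auto
  next
    fix l assume k: "k = Suc (Suc l)"
    then obtain Y Z1 Z2 and N :: nat where Z: "Z = (\<lambda>q. Y q + (\<Sum>i<N. bracket (atlas S) (Z1 i) (Z2 i) q))"
      "Y \<in> flag S W (Suc l)" "\<And>i. i < N \<Longrightarrow> Z1 i \<in> flag S W (Suc l) \<and> Z2 i \<in> horizontal S W"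
      using 1(2) by auto
    have IH: "smooth_on V (in_coords Y')" if "Y' \<in> flag S W (Suc l)" for Y'
      using 1(1) k that by blast
    have "smooth_on V (\<lambda>x. in_coords Y x + (\<Sum>i<N. in_coords (bracket (atlas S) (Z1 i) (Z2 i)) x))"
      by (intro smooth_on_add smooth_on_sum open_V IH in_coords_bracket_smooth horizontal_in_coords_smooth)
        (use Z in auto)
    then show ?thesis
      by (rule smooth_on_cong[OF open_V]) (simp add: Z(1) in_coords_sum)
  qed
qed

text \<open>Pointwise membership in the flag, as opposed to being a global section of it: for smooth fields of
  this kind the coefficients in any local basis of the flag are available.\<close>

definition filtered :: "nat \<Rightarrow> ((real, 'n) vec \<Rightarrow> (real, 'n) vec) set" where
  "filtered k = {Y. smooth_on V Y \<and> (\<forall>x\<in>V. Y x \<in> filtration_at k x)}"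

text \<open>The derivative is a limit of difference quotients, which lie in the flag at nearby points. The flag
  is cut out by continuous coefficient functions, so the limit lies in the flag at the base point.\<close>

lemma derivative_in_filtration_at:
  assumes R: "smooth_on V R" "\<And>x. x \<in> V \<Longrightarrow> R x \<in> filtration_at k x" and x: "x \<in> V" "R x = 0"
  shows "frechet_derivative R (at x) v \<in> filtration_at k x"
proof -
  let ?c = "\<lambda>t. frame_coef (\<lambda>i. Xt i (x + t *\<^sub>R v)) ((1 / t) *\<^sub>R R (x + t *\<^sub>R v))"
  have path: "((\<lambda>t. x + t *\<^sub>R v) \<longlongrightarrow> x) (at 0)" by (auto intro!: tendsto_eq_intros)
  have ev: "\<forall>\<^sub>F t in at 0. x + t *\<^sub>R v \<in> V"
    by (rule topological_tendstoD[OF path open_V x(1)])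
  have "((\<lambda>t. R (x + t *\<^sub>R v)) has_derivative (\<lambda>t. frechet_derivative R (at x) (t *\<^sub>R v))) (at 0)"
    by (rule has_derivative_compose[where g=R])
      (auto intro!: derivative_eq_intros smooth_on_has_derivative[OF R(1)] x)
  then have vd: "((\<lambda>t. R (x + t *\<^sub>R v)) has_vector_derivative frechet_derivative R (at x) v) (at 0)"
    using linear_scale[OF smooth_on_linear_frechet[OF R(1) x(1)]] by (simp add: has_vector_derivative_def)
  have quot: "((\<lambda>t. (1 / t) *\<^sub>R R (x + t *\<^sub>R v)) \<longlongrightarrow> frechet_derivative R (at x) v) (at 0)"
  proof -
    let ?v = "frechet_derivative R (at x) v"
    from vd have q0: "((\<lambda>t. norm (R (x + t *\<^sub>R v) - t *\<^sub>R ?v) / \<bar>t\<bar>) \<longlongrightarrow> 0) (at 0)"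
      using x(2) by (simp add: has_vector_derivative_def has_derivative_iff_norm)
    have "norm (R (x + t *\<^sub>R v) - t *\<^sub>R ?v) / \<bar>t\<bar> = norm ((1 / t) *\<^sub>R R (x + t *\<^sub>R v) - ?v)"
      if "t \<noteq> 0" for t
    proof -
      have "(1 / t) *\<^sub>R R (x + t *\<^sub>R v) - ?v = (1 / t) *\<^sub>R (R (x + t *\<^sub>R v) - t *\<^sub>R ?v)"
        using that by (simp add: scaleR_diff_right)
      then show ?thesis by (simp add: divide_inverse mult.commute)
    qed
    then have ev: "\<forall>\<^sub>F t in at 0. norm (R (x + t *\<^sub>R v) - t *\<^sub>R ?v) / \<bar>t\<bar> =
        norm ((1 / t) *\<^sub>R R (x + t *\<^sub>R v) - ?v)"
      by (auto simp: eventually_at_filter)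
    have "((\<lambda>t. norm ((1 / t) *\<^sub>R R (x + t *\<^sub>R v) - ?v)) \<longlongrightarrow> 0) (at 0)"
      by (rule Lim_transform_eventually[OF q0 ev])
    then have "((\<lambda>t. (1 / t) *\<^sub>R R (x + t *\<^sub>R v) - ?v) \<longlongrightarrow> 0) (at 0)"
      by (rule tendsto_norm_zero_cancel)
    then show ?thesis by (subst Lim_null)
  qed
  have "isCont (Xt i) x" for i
    using smooth_on_imp_continuous_on[OF Xt_smooth] open_V x(1) continuous_on_eq_continuous_at by blast
  then have fr: "((\<lambda>t. Xt i (x + t *\<^sub>R v)) \<longlongrightarrow> Xt i x) (at 0)" for i
    using isCont_tendsto_compose[OF _ path] by auto
  have lim: "(?c \<longlongrightarrow> frame_coef (\<lambda>i. Xt i x) (frechet_derivative R (at x) v)) (at 0)"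
    by (rule tendsto_frame_coef[OF fr quot Xt_det[OF x(1)]])
  show ?thesis
  proof (subst filtration_at_iff[OF x(1)], intro allI impI)
    fix i assume i: "k < w i"
    have "\<forall>\<^sub>F t in at 0. ?c t $ i = 0"
      using ev
    proof eventually_elim
      case (elim t)
      have "(1 / t) *\<^sub>R R (x + t *\<^sub>R v) \<in> filtration_at k (x + t *\<^sub>R v)"
        by (rule subspace_scale[OF filtration_at_subspace R(2)[OF elim]])
      then show ?case using filtration_at_iff[OF elim] i by blast
    qed
    then have "((\<lambda>t. ?c t $ i) \<longlongrightarrow> 0) (at 0)" by (rule tendsto_eventually)
    moreover have "((\<lambda>t. ?c t $ i) \<longlongrightarrow> frame_coef (\<lambda>i. Xt i x) (frechet_derivative R (at x) v) $ i) (at 0)"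
      by (rule tendsto_vec_nth[OF lim])
    ultimately show "frame_coef (\<lambda>i. Xt i x) (frechet_derivative R (at x) v) $ i = 0"
      by (rule tendsto_unique[OF trivial_limit_at, symmetric])
  qed
qed

lemma flag_through:
  assumes "Y \<in> filtered k" "x \<in> V" "k \<in> {1..s}"
  obtains Z where "Z \<in> flag S W k" "in_coords Z x = Y x" "in_coords Z \<in> filtered k"
proof -
  have "Y x \<in> coords_diff x ` flag_at S W k (F x)" using assms filtration_at_flag by (auto simp: filtered_def)
  then obtain Z where Z: "Z \<in> flag S W k" "Y x = coords_diff x (Z (F x))" by (auto simp: flag_at_def)
  have "in_coords Z y \<in> filtration_at k y" if "y \<in> V" for y
    using filtration_at_flag[OF that assms(3)] Z(1) by (auto simp: in_coords_lx flag_at_def)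
  with Z that show ?thesis by (auto simp: in_coords_lx filtered_def flag_in_coords_smooth)
qed

lemma filtered_diff: "Y \<in> filtered k \<Longrightarrow> Z \<in> filtered k \<Longrightarrow> (\<lambda>x. Y x - Z x) \<in> filtered k"
  by (auto simp: filtered_def intro: smooth_on_diff[OF open_V] subspace_diff[OF filtration_at_subspace])

text \<open>At a given point, replace both fields by members of the flag with the same values there. Their
  bracket is in the next step by definition. The differences vanish at the point, so their brackets
  reduce to a derivative of a field of the flag and stay in the flag.\<close>

lemma lie_bracket_horizontal:
  assumes Y: "Y \<in> filtered k" and Z: "Z \<in> filtered 1" and k: "1 \<le> k"
  shows "lie_bracket Y Z \<in> filtered (Suc k)"
proof -
  have sm: "smooth_on V Y" "smooth_on V Z" using Y Z by (auto simp: filtered_def)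
  have "lie_bracket Y Z x \<in> filtration_at (Suc k) x" if x: "x \<in> V" for x
  proof (cases "Suc k \<le> s")
    case False
    then show ?thesis using filtration_at_top[OF x] by auto
  next
    case True
    obtain Y' where Y': "Y' \<in> flag S W k" "in_coords Y' x = Y x" "in_coords Y' \<in> filtered k"
      by (rule flag_through[OF Y x]) (use True k in auto)
    obtain Z' where Z': "Z' \<in> flag S W 1" "in_coords Z' x = Z x" "in_coords Z' \<in> filtered 1"
      by (rule flag_through[OF Z x]) (use s_ge_1 in auto)
    have sm': "smooth_on V (in_coords Y')" "smooth_on V (in_coords Z')" using Y' Z' by (auto simp: filtered_def)
    note d = smooth_on_imp_differentiable[OF _ x]
    have RY: "(\<lambda>x. Y x - in_coords Y' x) \<in> filtered k" and RZ: "(\<lambda>x. in_coords Z' x - Z x) \<in> filtered 1"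
      using Y Y' Z Z' by (auto intro: filtered_diff)
    have z0: "frechet_derivative A (at x) 0 = 0" if "smooth_on V A" for A :: "(real, 'n) vec \<Rightarrow> (real, 'n) vec"
      by (rule linear_0[OF smooth_on_linear_frechet[OF that x]])
    have "lie_bracket (\<lambda>x. Y x - in_coords Y' x) Z x = - frechet_derivative (\<lambda>x. Y x - in_coords Y' x) (at x) (Z x)"
      using z0[OF sm(2)] by (simp add: lie_bracket_def Y'(2))
    moreover have "\<dots> \<in> filtration_at k x"
      using RY x Y'(2) by (auto simp: filtered_def intro!: subspace_neg[OF filtration_at_subspace] derivative_in_filtration_at)
    ultimately have 1: "lie_bracket (\<lambda>x. Y x - in_coords Y' x) Z x \<in> filtration_at (Suc k) x"
      using filtration_at_mono[of k "Suc k" x] by auto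
    have "lie_bracket (\<lambda>x. in_coords Z' x - Z x) (in_coords Y') x = - frechet_derivative (\<lambda>x. in_coords Z' x - Z x) (at x) (in_coords Y' x)"
      using z0[OF sm'(1)] by (simp add: lie_bracket_def Z'(2))
    moreover have "\<dots> \<in> filtration_at 1 x"
      using RZ x Z'(2) by (auto simp: filtered_def intro!: subspace_neg[OF filtration_at_subspace] derivative_in_filtration_at)
    ultimately have 2: "lie_bracket (\<lambda>x. in_coords Z' x - Z x) (in_coords Y') x \<in> filtration_at (Suc k) x"
      using filtration_at_mono[of 1 "Suc k" x] by auto
    have 3: "lie_bracket (in_coords Y') (in_coords Z') x \<in> filtration_at (Suc k) x"
    proof -
      obtain l where l: "k = Suc l" using k by (cases k) auto
      (* the members of the next step of the flag are sums that start with a member of the previous one *)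
      let ?B = "\<lambda>q. Y' q + (\<Sum>i<(1::nat). bracket (atlas S) Y' Z' q)"
      have "?B \<in> flag S W (Suc k)"
        unfolding l flag.simps mem_Collect_eq
        by (rule exI[of _ Y'], rule exI[of _ "\<lambda>_. Y'"], rule exI[of _ "\<lambda>_. Z'"],
            rule exI[of _ "1::nat"]) (use Y'(1) Z'(1) l in simp)
      then have "in_coords ?B x \<in> filtration_at (Suc k) x"
        using filtration_at_flag[OF x, of "Suc k"] True by (auto simp: in_coords_lx flag_at_def)
      moreover have "in_coords ?B x = in_coords Y' x + lie_bracket (in_coords Y') (in_coords Z') x"
        by (subst in_coords_sum[OF x]) (simp add: in_coords_bracket[OF sm' x])
      moreover have "in_coords Y' x \<in> filtration_at (Suc k) x"
        using Y'(3) x filtration_at_mono[of k "Suc k" x] by (auto simp: filtered_def)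
      ultimately show ?thesis
        using subspace_diff[OF filtration_at_subspace, of "in_coords ?B x" "Suc k" x "in_coords Y' x"] by simp
    qed
    have "lie_bracket Y Z x = lie_bracket (\<lambda>x. Y x - in_coords Y' x) Z x + lie_bracket (in_coords Y') Z x"
      using lie_bracket_diff_left[OF d d d, of Y "in_coords Y'" Z] sm sm' by simp
    moreover have "lie_bracket (in_coords Y') Z x = lie_bracket (in_coords Y') (in_coords Z') x + lie_bracket (\<lambda>x. in_coords Z' x - Z x) (in_coords Y') x"
      using lie_bracket_diff_left[OF d d d, of "in_coords Z'" Z "in_coords Y'"] sm sm'
        lie_bracket_antisym[of "in_coords Z'" "in_coords Y'" x] lie_bracket_antisym[of Z "in_coords Y'" x] by simp
    ultimately show ?thesis
      using 1 2 3 by (auto intro!: subspace_add[OF filtration_at_subspace])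
  qed
  then show ?thesis using smooth_on_lie_bracket[OF open_V sm] by (simp add: filtered_def)
qed

lemma Xt_filtered: "w i \<le> k \<Longrightarrow> Xt i \<in> filtered k"
  using Xt_smooth by (auto simp: filtered_def filtration_at_def intro!: span_base)

lemma iterated_bracket_snoc:
  "ks \<noteq> [] \<Longrightarrow> iterated_bracket A X (ks @ [k]) = bracket A (iterated_bracket A X ks) (X k)"
  by (simp add: iterated_bracket_def)

lemma filtered_cong: "Y \<in> filtered k \<Longrightarrow> (\<And>x. x \<in> V \<Longrightarrow> Y x = Z x) \<Longrightarrow> Z \<in> filtered k"
  unfolding filtered_def using smooth_on_cong[OF open_V] by auto

text \<open>Induction over the length: the Jacobi identity trades the bracket with an iterated bracket for
  brackets with a shorter one and with a single horizontal field.\<close>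

lemma iterated_bracket_filtration:
  assumes "ks \<noteq> []" "\<forall>k\<in>set ks. pos k \<le> nn 1"
  shows "smooth_on V (in_coords (iterated_bracket (atlas S) X ks)) \<and>
    in_coords (iterated_bracket (atlas S) X ks) \<in> filtered (length ks) \<and>
    (\<forall>k Y. 1 \<le> k \<longrightarrow> Y \<in> filtered k \<longrightarrow> lie_bracket Y (in_coords (iterated_bracket (atlas S) X ks)) \<in> filtered (k + length ks))"
  using assms
proof (induction ks rule: rev_nonempty_induct)
  case (single i)
  then have "w i \<le> 1" using weights(4)[of 1 i] s_ge_1 by simp
  then show ?case
    using Xt_filtered[of i 1] lie_bracket_horizontal Xt_smooth by (simp add: iterated_bracket_def)
next
  case (snoc i ks)
  let ?Z = "in_coords (iterated_bracket (atlas S) X ks)"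
  have IH: "smooth_on V ?Z" "?Z \<in> filtered (length ks)"
    "\<And>k Y. 1 \<le> k \<Longrightarrow> Y \<in> filtered k \<Longrightarrow> lie_bracket Y ?Z \<in> filtered (k + length ks)"
    using snoc by auto
  have "w i \<le> 1" using weights(4)[of 1 i] s_ge_1 snoc.prems by simp
  then have Xi: "Xt i \<in> filtered 1" by (rule Xt_filtered)
  have len: "1 \<le> length ks" using snoc(1) by (simp add: Suc_leI)
  have eq: "lie_bracket ?Z (Xt i) x = in_coords (iterated_bracket (atlas S) X (ks @ [i])) x" if "x \<in> V" for x
    using in_coords_bracket[OF IH(1) Xt_smooth that, of i] iterated_bracket_snoc[OF snoc(1)] by metis
  have "lie_bracket ?Z (Xt i) \<in> filtered (Suc (length ks))"
    by (rule lie_bracket_horizontal[OF IH(2) Xi len])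
  then have A: "in_coords (iterated_bracket (atlas S) X (ks @ [i])) \<in> filtered (length (ks @ [i]))"
    using filtered_cong[OF _ eq] by simp
  moreover have "lie_bracket Y (in_coords (iterated_bracket (atlas S) X (ks @ [i]))) \<in> filtered (k + length (ks @ [i]))"
    if k: "1 \<le> k" and Y: "Y \<in> filtered k" for k Y
  proof -
    have Ys: "smooth_on V Y" using Y by (simp add: filtered_def)
    have "lie_bracket (lie_bracket Y ?Z) (Xt i) \<in> filtered (Suc (k + length ks))"
      using lie_bracket_horizontal[OF IH(3)[OF k Y] Xi] k by simp
    moreover have "lie_bracket (lie_bracket Y (Xt i)) ?Z \<in> filtered (Suc k + length ks)"
      using IH(3)[OF _ lie_bracket_horizontal[OF Y Xi k]] by simp
    ultimately have "(\<lambda>x. lie_bracket (lie_bracket Y ?Z) (Xt i) x - lie_bracket (lie_bracket Y (Xt i)) ?Z x) \<in> filtered (Suc (k + length ks))"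
      using filtered_diff by simp
    then have "lie_bracket Y (lie_bracket ?Z (Xt i)) \<in> filtered (Suc (k + length ks))"
    proof (rule filtered_cong)
      fix x assume x: "x \<in> V"
      show "lie_bracket (lie_bracket Y ?Z) (Xt i) x - lie_bracket (lie_bracket Y (Xt i)) ?Z x = lie_bracket Y (lie_bracket ?Z (Xt i)) x"
        using lie_bracket_jacobi[OF open_V Xt_smooth Ys IH(1) x] lie_bracket_antisym[of ?Z "lie_bracket Y (Xt i)" x] by simp
    qed
    then have "lie_bracket Y (in_coords (iterated_bracket (atlas S) X (ks @ [i]))) \<in> filtered (Suc (k + length ks))"
      by (rule filtered_cong) (rule lie_bracket_cong[OF open_V _ refl eq])
    then show ?thesis by simp
  qed
  ultimately show ?case by (simp add: filtered_def)
qed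

text \<open>Since the fields of the frame are iterated brackets, the previous lemma bounds the step of their
  brackets.\<close>

lemma structure_weights:
  assumes x: "x \<in> V" and j: "w i + w k < w j"
  shows "frame_coef (\<lambda>l. Xt l x) (lie_bracket (Xt i) (Xt k) x) $ j = 0"
proof -
  have "\<forall>j\<in>{1..s}. \<forall>i. nn (j - 1) < pos i \<and> pos i \<le> nn j \<longrightarrow>
        (\<exists>ks. length ks = j \<and> (\<forall>k\<in>set ks. pos k \<le> nn 1) \<and>
              (\<forall>q\<in>W. X i q = iterated_bracket (atlas S) X ks q))"
    using frame by (simp add: privileged_frame_def)
  then obtain ks where ks: "length ks = w k" "\<forall>k\<in>set ks. pos k \<le> nn 1"
    "\<And>q. q \<in> W \<Longrightarrow> X k q = iterated_bracket (atlas S) X ks q"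
    using weights(1)[of k] weights(2)[of k] weights(3)[of k] by meson
  have ne: "ks \<noteq> []" using ks(1) weights(1)[of k] by auto
  have "lie_bracket (Xt i) (in_coords (iterated_bracket (atlas S) X ks)) \<in> filtered (w i + w k)"
    using iterated_bracket_filtration[OF ne ks(2)] Xt_filtered[of i "w i"] weights(1)[of i] ks(1) by auto
  moreover have "lie_bracket (Xt i) (in_coords (iterated_bracket (atlas S) X ks)) x = lie_bracket (Xt i) (Xt k) x"
    by (rule lie_bracket_cong[OF open_V x refl]) (simp add: in_coords_lx ks(3) F_in_W)
  ultimately have "lie_bracket (Xt i) (Xt k) x \<in> filtration_at (w i + w k) x"
    using x by (auto simp: filtered_def)
  then show ?thesis using filtration_at_iff[OF x] j by blast
qed

end

section \<open>Uniqueness of integral curves\<close>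

lemma smooth_on_lipschitz:
  fixes f :: "'v::euclidean_space \<Rightarrow> 'w::real_normed_vector"
  assumes f: "smooth_on S f" and K: "compact K" "convex K" "K \<subseteq> S" and S: "open S"
  shows "\<exists>L\<ge>0. \<forall>x\<in>K. \<forall>y\<in>K. norm (f x - f y) \<le> L * norm (x - y)"
proof -
  have "\<exists>B. \<forall>x\<in>K. norm (frechet_derivative f (at x) b) \<le> B" for b
  proof -
    have "continuous_on K (\<lambda>x. frechet_derivative f (at x) b)"
      using smooth_on_imp_continuous_on[OF smooth_on_derivative[OF f]] K(3) continuous_on_subset by blast
    then have "bounded ((\<lambda>x. frechet_derivative f (at x) b) ` K)"
      using K(1) compact_continuous_image compact_imp_bounded by blast
    then show ?thesis by (auto simp: bounded_iff)
  qed
  then obtain B where B: "\<And>b x. x \<in> K \<Longrightarrow> norm (frechet_derivative f (at x) b) \<le> B b" by metis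
  define L where "L = (\<Sum>b\<in>(Basis::'v set). \<bar>B b\<bar>)"
  have "onorm (frechet_derivative f (at x)) \<le> L" if x: "x \<in> K" for x
  proof (rule onorm_le)
    fix v :: 'v
    have "frechet_derivative f (at x) v = (\<Sum>b\<in>Basis. (v \<bullet> b) *\<^sub>R frechet_derivative f (at x) b)"
      by (rule linear_apply_Basis, rule smooth_on_linear_frechet[OF f]) (use x K in auto)
    also have "norm \<dots> \<le> (\<Sum>b\<in>Basis. norm v * \<bar>B b\<bar>)"
    proof (rule sum_norm_le)
      fix b :: 'v assume "b \<in> Basis"
      then have "\<bar>v \<bullet> b\<bar> \<le> norm v" by (rule Basis_le_norm)
      moreover have "norm (frechet_derivative f (at x) b) \<le> \<bar>B b\<bar>" using B[OF x, of b] by simp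
      ultimately show "norm ((v \<bullet> b) *\<^sub>R frechet_derivative f (at x) b) \<le> norm v * \<bar>B b\<bar>"
        by (simp add: mult_mono)
    qed
    also have "\<dots> = L * norm v" by (simp add: L_def sum_distrib_left mult.commute)
    finally show "norm (frechet_derivative f (at x) v) \<le> L * norm v" .
  qed
  then have "norm (f x - f y) \<le> L * norm (x - y)" if "x \<in> K" "y \<in> K" for x y
    using differentiable_bound[OF K(2), of f "\<lambda>x. frechet_derivative f (at x)" L x y] that
      smooth_on_has_derivative[OF f] K(3) has_derivative_at_withinI by blast
  moreover have "0 \<le> L" by (simp add: L_def sum_nonneg)
  ultimately show ?thesis by blast
qed

text \<open>On an interval short compared with the Lipschitz constant the maximal distance of two solutions is
  at most half of itself.\<close>

lemma ode_unique_short: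
  fixes u v :: "real \<Rightarrow> 'v::euclidean_space"
  assumes J: "t0 \<in> {a..b}" "L * (b - a) \<le> 1 / 2" "0 \<le> L"
    and u: "\<And>t. t \<in> {a..b} \<Longrightarrow> (u has_vector_derivative f (u t)) (at t within {a..b})"
    and v: "\<And>t. t \<in> {a..b} \<Longrightarrow> (v has_vector_derivative f (v t)) (at t within {a..b})"
    and K: "\<And>t. t \<in> {a..b} \<Longrightarrow> u t \<in> K \<and> v t \<in> K"
    and lip: "\<And>x y. x \<in> K \<Longrightarrow> y \<in> K \<Longrightarrow> norm (f x - f y) \<le> L * norm (x - y)"
    and eq: "u t0 = v t0" and t: "t \<in> {a..b}"
  shows "u t = v t"
proof -
  have d: "((\<lambda>t. u t - v t) has_vector_derivative (f (u t) - f (v t))) (at t within {a..b})"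
    if "t \<in> {a..b}" for t
    using u v that by (intro has_vector_derivative_diff) auto
  have "continuous_on {a..b} (\<lambda>t. norm (u t - v t))"
    using d by (intro continuous_on_norm continuous_on_vector_derivative) auto
  then obtain t1 where t1: "t1 \<in> {a..b}" "\<And>t. t \<in> {a..b} \<Longrightarrow> norm (u t - v t) \<le> norm (u t1 - v t1)"
    using continuous_attains_sup[of "{a..b}" "\<lambda>t. norm (u t - v t)"] J(1) by auto
  define M where "M = norm (u t1 - v t1)"
  have "norm ((u t1 - v t1) - (u t0 - v t0)) \<le> (L * M) * norm (t1 - t0)"
  proof (rule differentiable_bound[where S="{a..b}" and f'="\<lambda>t h. h *\<^sub>R (f (u t) - f (v t))"])
    fix t assume t: "t \<in> {a..b}"
    show "((\<lambda>t. u t - v t) has_derivative (\<lambda>h. h *\<^sub>R (f (u t) - f (v t)))) (at t within {a..b})"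
      using d[OF t] by (simp add: has_vector_derivative_def)
    show "onorm (\<lambda>h. h *\<^sub>R (f (u t) - f (v t))) \<le> L * M"
    proof (rule onorm_le)
      fix h :: real
      have "norm (f (u t) - f (v t)) \<le> L * norm (u t - v t)" using K[OF t] lip by blast
      also have "\<dots> \<le> L * M" using t1(2)[OF t] J(3) by (auto simp: M_def intro: mult_left_mono)
      finally show "norm (h *\<^sub>R (f (u t) - f (v t))) \<le> L * M * norm h"
        by (simp add: mult.commute mult_left_mono)
    qed
  qed (use t1 J in auto)
  then have "M \<le> L * M * \<bar>t1 - t0\<bar>" by (simp add: eq M_def)
  also have "\<dots> \<le> L * M * (b - a)"
    using t1(1) J by (intro mult_left_mono mult_nonneg_nonneg) (auto simp: M_def)
  also have "\<dots> = (L * (b - a)) * M" by simp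
  also have "\<dots> \<le> 1 / 2 * M" using J(2) by (rule mult_right_mono) (simp add: M_def)
  finally have "M = 0" by (simp add: M_def)
  then show ?thesis using t1(2)[OF t] by (simp add: M_def)
qed

context coordinates
begin

definition integral_curve :: "'a set \<Rightarrow> ('a, 'n) vfield \<Rightarrow> (real \<Rightarrow> 'a) \<Rightarrow> bool" where
  "integral_curve W Z \<gamma> \<longleftrightarrow> continuous_on {0..1} \<gamma> \<and> \<gamma> ` {0..1} \<subseteq> W \<and>
     (\<forall>t\<in>{0..1}. ((snd (chart_at A (\<gamma> t)) \<circ> \<gamma>) has_vector_derivative Z (\<gamma> t)) (at t within {0..1}))"

lemma eventually_in_open:
  assumes "continuous_on T \<gamma>" "t \<in> T" "open U" "\<gamma> t \<in> U"
  shows "\<forall>\<^sub>F t' in at t within T. \<gamma> t' \<in> U"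
  using assms topological_tendstoD unfolding continuous_on_def by blast

lemma curve_in_chart:
  assumes \<gamma>: "integral_curve W Z \<gamma>" and t: "t \<in> {0..1}" and c: "c \<in> A" "\<gamma> t \<in> fst c"
  shows "((\<lambda>t. snd c (\<gamma> t)) has_vector_derivative field_in_chart A c Z (snd c (\<gamma> t))) (at t within {0..1})"
proof -
  define c0 where "c0 = chart_at A (\<gamma> t)"
  have c0: "c0 \<in> A" "\<gamma> t \<in> fst c0" using chart_at by (auto simp: c0_def)
  let ?T = "snd c \<circ> chart_inv c0" and ?y = "snd c0 (\<gamma> t)"
  have T: "(?T has_derivative frechet_derivative ?T (at ?y)) (at ?y)"
    by (rule smooth_on_has_derivative[OF smooth_transition[OF c0(1) c(1)]]) (use c c0 in auto)
  have g: "((\<lambda>t. snd c0 (\<gamma> t)) has_derivative (\<lambda>h. h *\<^sub>R Z (\<gamma> t))) (at t within {0..1})"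
    using \<gamma> t by (auto simp: integral_curve_def has_vector_derivative_def comp_def c0_def)
  have "((\<lambda>t. ?T (snd c0 (\<gamma> t))) has_derivative (\<lambda>h. frechet_derivative ?T (at ?y) (h *\<^sub>R Z (\<gamma> t))))
      (at t within {0..1})"
    by (rule has_derivative_compose[OF g T])
  moreover have "\<forall>\<^sub>F t' in at t within {0..1}. ?T (snd c0 (\<gamma> t')) = snd c (\<gamma> t')"
    using eventually_in_open[of "{0..1}" \<gamma> t "fst c0"] \<gamma> t c0 chartD[OF c0(1)]
    by (auto simp: integral_curve_def elim: eventually_mono)
  ultimately have "((\<lambda>t. snd c (\<gamma> t)) has_derivative (\<lambda>h. frechet_derivative ?T (at ?y) (h *\<^sub>R Z (\<gamma> t))))
      (at t within {0..1})"
    by (rule has_derivative_transform_eventually) (use c0 t chartD(5)[OF c0(1)] in auto)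
  moreover have "frechet_derivative ?T (at ?y) (h *\<^sub>R Z (\<gamma> t)) = h *\<^sub>R field_in_chart A c Z (snd c (\<gamma> t))" for h
    using linear_scale[OF has_derivative_linear[OF T]] chartD(5)[OF c]
    by (simp add: field_in_chart_def components_def coord_change_def flip: c0_def)
  ultimately show ?thesis by (simp add: has_vector_derivative_def)
qed

text \<open>The set of times at which the curves agree is open by the local uniqueness in a chart and closed by
  the Hausdorff property, and the interval is connected.\<close>

lemma integral_curve_unique:
  assumes W: "open W" and Z: "smooth_field A W Z"
    and \<alpha>: "integral_curve W Z \<alpha>" and \<beta>: "integral_curve W Z \<beta>" and eq0: "\<alpha> 0 = \<beta> 0"
    and t: "t \<in> {0..1}"
  shows "\<alpha> t = \<beta> t"
proof -
  let ?I = "{0..1::real}"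
  define T where "T = {t \<in> ?I. \<alpha> t = \<beta> t}"
  have c\<alpha>: "continuous_on ?I \<alpha>" and c\<beta>: "continuous_on ?I \<beta>"
    using \<alpha> \<beta> by (auto simp: integral_curve_def)
  have opn: "\<exists>e>0. \<forall>t'\<in>?I. dist t' t0 < e \<longrightarrow> t' \<in> T" if t0: "t0 \<in> T" for t0
  proof -
    have t0I: "t0 \<in> ?I" and eqt: "\<alpha> t0 = \<beta> t0" using t0 by (auto simp: T_def)
    define c where "c = chart_at A (\<alpha> t0)"
    have c: "c \<in> A" "\<alpha> t0 \<in> fst c" using chart_at by (auto simp: c_def)
    have W0: "\<alpha> t0 \<in> W" using \<alpha> t0I by (auto simp: integral_curve_def)
    let ?O = "snd c ` (W \<inter> fst c)" and ?f = "field_in_chart A c Z"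
    have oO: "open ?O" by (rule open_chart_image[OF c(1) W])
    have f: "smooth_on ?O ?f" using Z c(1) by (auto simp: smooth_field_def)
    obtain r where r: "r > 0" "cball (snd c (\<alpha> t0)) r \<subseteq> ?O"
      using oO W0 c open_contains_cball by blast
    obtain L where L: "L \<ge> 0"
      "\<And>x y. x \<in> cball (snd c (\<alpha> t0)) r \<Longrightarrow> y \<in> cball (snd c (\<alpha> t0)) r \<Longrightarrow> norm (?f x - ?f y) \<le> L * norm (x - y)"
      using smooth_on_lipschitz[OF f compact_cball convex_cball r(2) oO] by blast
    let ?U = "fst c \<inter> snd c -` ball (snd c (\<alpha> t0)) r"
    have U: "open ?U" "\<alpha> t0 \<in> ?U" "\<beta> t0 \<in> ?U"
      using continuous_open_preimage[OF chartD(3,1)[OF c(1)]] c r eqt by auto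
    have "\<forall>\<^sub>F t in at t0 within ?I. \<alpha> t \<in> ?U \<and> \<beta> t \<in> ?U"
      using eventually_in_open[OF c\<alpha> t0I U(1,2)] eventually_in_open[OF c\<beta> t0I U(1,3)]
      by (rule eventually_conj)
    then obtain d where d: "d > 0" "\<And>t. t \<in> ?I \<Longrightarrow> t \<noteq> t0 \<Longrightarrow> dist t t0 < d \<Longrightarrow> \<alpha> t \<in> ?U \<and> \<beta> t \<in> ?U"
      unfolding eventually_at by blast
    define e where "e = min (d / 2) (1 / (4 * (L + 1)))"
    have e: "e > 0" "e < d" "4 * (L * e) \<le> 1"
    proof -
      show "e > 0" "e < d" using d L by (auto simp: e_def min_def)
      have "L * e \<le> (L + 1) * (1 / (4 * (L + 1)))"
        using L(1) \<open>e > 0\<close> by (intro mult_mono) (auto simp: e_def)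
      also have "\<dots> = 1 / 4" using L(1) by (simp add: field_simps)
      finally show "4 * (L * e) \<le> 1" by simp
    qed
    define a b where "a = max 0 (t0 - e)" and "b = min 1 (t0 + e)"
    have ab: "{a..b} \<subseteq> ?I" "t0 \<in> {a..b}" "\<And>t. t \<in> {a..b} \<Longrightarrow> dist t t0 \<le> e"
      using t0I e by (auto simp: a_def b_def dist_real_def)
    have Lab: "L * (b - a) \<le> 1 / 2"
    proof -
      have "b - a \<le> 2 * e" by (auto simp: a_def b_def)
      then have "L * (b - a) \<le> L * (2 * e)" using L(1) by (rule mult_left_mono)
      then show ?thesis using e(3) by simp
    qed
    have inU: "\<alpha> t \<in> ?U \<and> \<beta> t \<in> ?U" if "t \<in> {a..b}" for t
      using d(2)[of t] ab(1) ab(3)[OF that] e(2) U that by (cases "t = t0") auto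
    have "\<alpha> t \<in> fst c \<and> snd c (\<alpha> t) = snd c (\<beta> t)" if t: "t \<in> {a..b}" for t
    proof -
      have D: "((\<lambda>t. snd c (\<gamma> t)) has_vector_derivative ?f (snd c (\<gamma> t))) (at t within {a..b})"
        if "integral_curve W Z \<gamma>" "t \<in> {a..b}" "\<gamma> t \<in> ?U" for \<gamma> t
        using curve_in_chart[OF that(1) _ c(1), of t] that ab(1)
        by (auto intro: has_vector_derivative_within_subset)
      have "snd c (\<alpha> t) = snd c (\<beta> t)"
        by (rule ode_unique_short[where u="\<lambda>t. snd c (\<alpha> t)" and v="\<lambda>t. snd c (\<beta> t)" and f="?f"
              and K="cball (snd c (\<alpha> t0)) r", OF ab(2) Lab L(1)])
          (use D \<alpha> \<beta> inU L(2) t eqt in \<open>auto simp: less_imp_le\<close>)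
      then show ?thesis using inU[OF t] by auto
    qed
    then have "\<alpha> t = \<beta> t" if "t \<in> {a..b}" for t
      using inU[OF that] chartD(5)[OF c(1)] that by (metis IntD1)
    from this have "\<forall>t'\<in>?I. dist t' t0 < e \<longrightarrow> t' \<in> T"
      by (auto simp: T_def a_def b_def dist_real_def abs_less_iff)
    then show ?thesis using e(1) by blast
  qed
  have cls: "\<exists>e>0. \<forall>t'\<in>?I. dist t' t0 < e \<longrightarrow> t' \<in> ?I - T" if t0: "t0 \<in> ?I - T" for t0
  proof -
    have t0I: "t0 \<in> ?I" and ne: "\<alpha> t0 \<noteq> \<beta> t0" using t0 by (auto simp: T_def)
    obtain U1 U2 where U: "open U1" "open U2" "\<alpha> t0 \<in> U1" "\<beta> t0 \<in> U2" "U1 \<inter> U2 = {}"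
      using hausdorff[OF ne] by blast
    have "\<forall>\<^sub>F t in at t0 within ?I. \<alpha> t \<in> U1 \<and> \<beta> t \<in> U2"
      using eventually_in_open[OF c\<alpha> t0I U(1,3)] eventually_in_open[OF c\<beta> t0I U(2,4)]
      by (rule eventually_conj)
    then obtain d where d: "d > 0" "\<And>t. t \<in> ?I \<Longrightarrow> t \<noteq> t0 \<Longrightarrow> dist t t0 < d \<Longrightarrow> \<alpha> t \<in> U1 \<and> \<beta> t \<in> U2"
      unfolding eventually_at by blast
    have "t' \<in> ?I - T" if "t' \<in> ?I" "dist t' t0 < d" for t'
      using d(2)[OF that(1) _ that(2)] U(5) t0 that(1) by (cases "t' = t0") (auto simp: T_def)
    then show ?thesis using d(1) by blast
  qed
  have "openin (top_of_set ?I) T" "openin (top_of_set ?I) (?I - T)"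
    unfolding openin_euclidean_subtopology_iff using opn cls by (auto simp: T_def)
  then have "closedin (top_of_set ?I) T"
    by (simp add: closedin_def T_def subset_iff)
  then have "T = {} \<or> T = ?I"
    using \<open>openin (top_of_set ?I) T\<close> connected_clopen[of ?I] by auto
  moreover have "0 \<in> T" using eq0 by (simp add: T_def)
  ultimately have "T = ?I" by blast
  then show ?thesis using t unfolding T_def by blast
qed

lemma components_linear:
  assumes "c \<in> A" "q \<in> fst c" shows "linear (components A c q)"
  unfolding components_def coord_change_def
  by (rule smooth_on_linear_frechet[OF smooth_transition[OF chart_at(1) assms(1)]])
    (use assms chart_at in auto)

lemma smooth_field_combination:
  fixes x :: "real ^ 'n"
  assumes W: "open W" and Z: "\<And>i. smooth_field A W (Z i)"
  shows "smooth_field A W (\<lambda>q. \<Sum>i\<in>UNIV. x $ i *\<^sub>R Z i q)"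
  unfolding smooth_field_def
proof
  fix c assume c: "c \<in> A"
  have o: "open (snd c ` (W \<inter> fst c))" by (rule open_chart_image[OF c W])
  have "smooth_on (snd c ` (W \<inter> fst c)) (\<lambda>y. \<Sum>i\<in>UNIV. x $ i *\<^sub>R field_in_chart A c (Z i) y)"
    by (intro smooth_on_sum smooth_on_scaleR smooth_on_const o)
      (use Z c in \<open>auto simp: smooth_field_def\<close>)
  then show "smooth_on (snd c ` (W \<inter> fst c)) (field_in_chart A c (\<lambda>q. \<Sum>i\<in>UNIV. x $ i *\<^sub>R Z i q))"
  proof (rule smooth_on_cong[OF o])
    fix y assume "y \<in> snd c ` (W \<inter> fst c)"
    then have "chart_inv c y \<in> fst c" using chartD(5)[OF c] by auto
    from components_linear[OF c this]
    show "(\<Sum>i\<in>UNIV. x $ i *\<^sub>R field_in_chart A c (Z i) y) =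
        field_in_chart A c (\<lambda>q. \<Sum>i\<in>UNIV. x $ i *\<^sub>R Z i q) y"
      by (simp add: field_in_chart_def linear_sum linear_scale)
  qed
qed

end

section \<open>The Euler identity in exponential coordinates\<close>

locale exponential_frame = frame_coordinates S V F W s nn X
  for S :: "('a::{t2_space,second_countable_topology}, 'n::{finite,linorder}, 'e::euclidean_space) sr_structure"
    and V F and W :: "'a set" and s :: nat and nn :: "nat \<Rightarrow> nat" and X :: "'n \<Rightarrow> 'a \<Rightarrow> (real, 'n) vec" +
  fixes p :: 'a
  assumes reaches: "\<And>x. x \<in> V \<Longrightarrow> exp_reaches (atlas S) W (\<lambda>q. \<Sum>i\<in>UNIV. (x $ i) *\<^sub>R X i q) p (F x)"
begin

lemma exp_curve:
  assumes "x \<in> V"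
  obtains \<gamma> where "integral_curve W (\<lambda>q. \<Sum>i\<in>UNIV. (x $ i) *\<^sub>R X i q) \<gamma>" "\<gamma> 0 = p" "\<gamma> 1 = F x"
  using reaches[OF assms] unfolding exp_reaches_def integral_curve_def by blast

lemma integral_curve_rescale:
  assumes \<gamma>: "integral_curve W (\<lambda>q. \<Sum>i\<in>UNIV. (x $ i) *\<^sub>R X i q) \<gamma>" and \<tau>: "0 \<le> \<tau>" "\<tau> \<le> 1"
  shows "integral_curve W (\<lambda>q. \<Sum>i\<in>UNIV. ((\<tau> *\<^sub>R x) $ i) *\<^sub>R X i q) (\<lambda>t. \<gamma> (\<tau> * t))"
  unfolding integral_curve_def
proof (intro conjI ballI)
  have sub: "(\<lambda>t. \<tau> * t) ` {0..1} \<subseteq> {0..1}" using \<tau> by (auto simp: mult_le_one)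
  show "continuous_on {0..1} (\<lambda>t. \<gamma> (\<tau> * t))"
    by (rule continuous_on_compose2[of "{0..1}" \<gamma>]) (use \<gamma> sub in \<open>auto simp: integral_curve_def intro!: continuous_intros\<close>)
  show "(\<lambda>t. \<gamma> (\<tau> * t)) ` {0..1} \<subseteq> W"
    using \<gamma> sub by (auto simp: integral_curve_def)
  fix t :: real assume t: "t \<in> {0..1}"
  let ?c = "chart_at (atlas S) (\<gamma> (\<tau> * t))" and ?Z = "\<Sum>i\<in>UNIV. (x $ i) *\<^sub>R X i (\<gamma> (\<tau> * t))"
  have in1: "\<tau> * t \<in> {0..1}" using sub t by blast
  have 1: "((snd ?c \<circ> \<gamma>) has_derivative (\<lambda>h. h *\<^sub>R ?Z)) (at (\<tau> * t) within (\<lambda>t. \<tau> * t) ` {0..1})"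
    by (rule has_derivative_subset[OF _ sub])
      (use \<gamma> in1 in \<open>auto simp: integral_curve_def has_vector_derivative_def\<close>)
  have 2: "((\<lambda>t. \<tau> * t) has_derivative (\<lambda>h. \<tau> * h)) (at t within {0..1})"
    by (auto intro!: derivative_eq_intros)
  have "((\<lambda>t. (snd ?c \<circ> \<gamma>) (\<tau> * t)) has_derivative (\<lambda>h. (\<tau> * h) *\<^sub>R ?Z)) (at t within {0..1})"
    by (rule has_derivative_in_compose[OF 2 1])
  then show "((snd ?c \<circ> (\<lambda>t. \<gamma> (\<tau> * t))) has_vector_derivative
      (\<Sum>i\<in>UNIV. ((\<tau> *\<^sub>R x) $ i) *\<^sub>R X i (\<gamma> (\<tau> * t)))) (at t within {0..1})"
    by (simp add: has_vector_derivative_def comp_def scaleR_sum_right mult_ac)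
qed

lemma exp_ray:
  assumes x: "x \<in> V" and \<gamma>: "integral_curve W (\<lambda>q. \<Sum>i\<in>UNIV. (x $ i) *\<^sub>R X i q) \<gamma>" "\<gamma> 0 = p"
    and \<tau>: "0 \<le> \<tau>" "\<tau> \<le> 1" and \<tau>x: "\<tau> *\<^sub>R x \<in> V"
  shows "F (\<tau> *\<^sub>R x) = \<gamma> \<tau>"
proof -
  obtain \<alpha> where \<alpha>: "integral_curve W (\<lambda>q. \<Sum>i\<in>UNIV. ((\<tau> *\<^sub>R x) $ i) *\<^sub>R X i q) \<alpha>" "\<alpha> 0 = p" "\<alpha> 1 = F (\<tau> *\<^sub>R x)"
    by (rule exp_curve[OF \<tau>x])
  have "\<alpha> 1 = \<gamma> (\<tau> * 1)"
    by (rule integral_curve_unique[OF open_W smooth_field_combination[OF open_W X_smooth] \<alpha>(1)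
        integral_curve_rescale[OF \<gamma>(1) \<tau>]]) (use \<alpha> \<gamma> in auto)
  then show ?thesis using \<alpha>(3) by simp
qed

text \<open>By uniqueness the integral curve that reaches the point is the image of the ray, so its velocity
  at time one, transported to the coordinates, is the radial vector.\<close>

lemma euler_identity:
  assumes x: "\<And>\<tau>. 0 \<le> \<tau> \<Longrightarrow> \<tau> \<le> 1 \<Longrightarrow> \<tau> *\<^sub>R x \<in> V"
  shows "(\<Sum>i\<in>UNIV. x $ i *\<^sub>R Xt i x) = x"
proof -
  have xV: "x \<in> V" using x[of 1] by simp
  obtain \<gamma> where \<gamma>: "integral_curve W (\<lambda>q. \<Sum>i\<in>UNIV. (x $ i) *\<^sub>R X i q) \<gamma>" "\<gamma> 0 = p" "\<gamma> 1 = F x"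
    by (rule exp_curve[OF xV])
  define c where "c = chart_at (atlas S) (F x)"
  have c: "c \<in> atlas S" "F x \<in> fst c" using chart_at by (auto simp: c_def)
  let ?P = "snd c \<circ> F" and ?Z = "\<Sum>i\<in>UNIV. (x $ i) *\<^sub>R X i (F x)"
  have P: "(?P has_derivative frechet_derivative ?P (at x)) (at x)"
    by (rule smooth_on_has_derivative[OF smooth_F[OF c(1)]]) (use c xV in auto)
  have 1: "((\<lambda>\<tau>. ?P (\<tau> *\<^sub>R x)) has_derivative (\<lambda>h. frechet_derivative ?P (at x) (h *\<^sub>R x))) (at 1 within {0..1})"
    by (rule has_derivative_compose[where g="?P"]) (use P in \<open>auto intro!: derivative_eq_intros simp: comp_def\<close>)
  have 2: "((snd c \<circ> \<gamma>) has_derivative (\<lambda>h. h *\<^sub>R ?Z)) (at 1 within {0..1})"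
    using \<gamma>(1,3) by (auto simp: integral_curve_def has_vector_derivative_def c_def dest: bspec[of _ _ 1])
  have 3: "((\<lambda>\<tau>. ?P (\<tau> *\<^sub>R x)) has_derivative (\<lambda>h. h *\<^sub>R ?Z)) (at 1 within {0..1})"
    by (rule has_derivative_transform[OF _ _ 2])
      (use exp_ray[OF xV \<gamma>(1,2)] x in auto)
  have "(\<lambda>h. frechet_derivative ?P (at x) (h *\<^sub>R x)) = (\<lambda>h. h *\<^sub>R ?Z)"
    by (rule frechet_derivative_unique_within_closed_interval[of 0 1 1])
      (use 1 3 in \<open>simp_all only: cbox_interval, simp_all\<close>)
  from fun_cong[OF this, of 1] have "frechet_derivative ?P (at x) x = ?Z" by (simp only: scaleR_one)
  then have "coords_diff x ?Z = x"
    using chart_derivative_inverse(2)[OF c(1) xV c(2), of x] by (simp add: coords_diff_alt flip: c_def)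
  moreover have "coords_diff x ?Z = (\<Sum>i\<in>UNIV. x $ i *\<^sub>R Xt i x)"
    using coords_diff_linear[OF xV] by (simp add: in_coords_lx linear_sum linear_scale)
  ultimately show ?thesis by simp
qed

lemma euler_ball: "ball 0 R \<subseteq> V \<Longrightarrow> x \<in> ball 0 R \<Longrightarrow> (\<Sum>i\<in>UNIV. x $ i *\<^sub>R Xt i x) = x"
proof (rule euler_identity)
  fix \<tau> :: real assume a: "ball 0 R \<subseteq> V" "x \<in> ball 0 R" "0 \<le> \<tau>" "\<tau> \<le> 1"
  have "norm (\<tau> *\<^sub>R x) \<le> norm x" using a by (simp add: mult_left_le_one_le)
  then show "\<tau> *\<^sub>R x \<in> V" using a by auto
qed

lemma Xt_zero: "Xt i 0 = axis i 1"
proof -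
  obtain R where R: "R > 0" "ball 0 R \<subseteq> V" using open_V zero_V open_contains_ball by blast
  have path: "((\<lambda>r. r *\<^sub>R axis i 1) \<longlongrightarrow> (0 :: (real, 'n) vec)) (at_right 0)"
    by (auto intro!: tendsto_eq_intros)
  have "isCont (Xt i) 0"
    using smooth_on_imp_continuous_on[OF Xt_smooth] open_V zero_V continuous_on_eq_continuous_at by blast
  then have "((\<lambda>r. Xt i (r *\<^sub>R axis i 1)) \<longlongrightarrow> Xt i 0) (at_right 0)"
    using isCont_tendsto_compose[OF _ path] by auto
  moreover have "\<forall>\<^sub>F r in at_right 0. Xt i (r *\<^sub>R axis i 1) = axis i 1"
    using eventually_at_right_less eventually_at_right_real[OF R(1)]
  proof eventually_elim
    case (elim r)
    then have "(r *\<^sub>R axis i 1 :: (real, 'n) vec) \<in> ball 0 R" by (simp add: norm_axis_1)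
    from euler_ball[OF R(2) this]
    have "(\<Sum>j\<in>UNIV. (r *\<^sub>R axis i 1 :: (real, 'n) vec) $ j *\<^sub>R Xt j (r *\<^sub>R axis i 1)) = r *\<^sub>R axis i 1" .
    also have "(\<Sum>j\<in>UNIV. (r *\<^sub>R axis i 1 :: (real, 'n) vec) $ j *\<^sub>R Xt j (r *\<^sub>R axis i 1)) =
        (\<Sum>j\<in>UNIV. if j = i then r *\<^sub>R Xt j (r *\<^sub>R axis i 1) else 0)"
      by (rule sum.cong) (auto simp: axis_def)
    finally show ?case using elim by simp
  qed
  then have "((\<lambda>r. Xt i (r *\<^sub>R axis i 1)) \<longlongrightarrow> axis i 1) (at_right 0)"
    by (rule tendsto_eventually)
  ultimately show ?thesis using tendsto_unique[OF trivial_limit_at_right_real] by blast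
qed

end

section \<open>A radial differential inequality\<close>

text \<open>A bound that is reproduced strictly as long as it has held so far can never be violated: there would
  be a first time at which it fails.\<close>

lemma first_exit:
  fixes \<phi> :: "'k::finite \<Rightarrow> real \<Rightarrow> real"
  assumes cont: "\<And>k. continuous_on {0..1} (\<phi> k)"
    and step: "\<And>t k. t \<in> {0..1} \<Longrightarrow> (\<And>s k. 0 \<le> s \<Longrightarrow> s < t \<Longrightarrow> \<phi> k s < R) \<Longrightarrow> \<phi> k t < R"
    and t: "t \<in> {0..1}"
  shows "\<phi> k t < R"
proof (rule ccontr)
  define B where "B = (\<Union>k. {0..1} \<inter> \<phi> k -` {R..})"
  assume "\<not> \<phi> k t < R"
  then have "t \<in> {0..1} \<inter> \<phi> k -` {R..}" using t by auto
  then have ne: "B \<noteq> {}" unfolding B_def by blast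
  have "closed B"
    unfolding B_def
    by (intro closed_UN finite ballI continuous_closed_preimage cont closed_atLeast closed_atLeastAtMost)
  moreover have bb: "bdd_below B" by (auto simp: B_def intro!: bdd_belowI[of _ 0])
  ultimately have "Inf B \<in> B" using ne closed_contains_Inf by blast
  then obtain k0 where k0: "Inf B \<in> {0..1}" "R \<le> \<phi> k0 (Inf B)" by (auto simp: B_def)
  have "\<phi> k s < R" if "0 \<le> s" "s < Inf B" for s k
  proof (rule ccontr)
    assume "\<not> \<phi> k s < R"
    then have "s \<in> {0..1} \<inter> \<phi> k -` {R..}" using that k0(1) by auto
    then have "s \<in> B" unfolding B_def by blast
    then show False using cInf_lower[OF _ bb] that(2) by fastforce
  qed
  from step[OF k0(1) this, of k0] k0(2) show False by simp
qed

lemma norm_sum_scaleR_bound: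
  fixes f :: "'n::finite \<Rightarrow> real" and g :: "'n \<Rightarrow> 'v::real_normed_vector"
  assumes "\<And>i. \<bar>f i\<bar> \<le> a" "\<And>i. norm (g i) \<le> b" "0 \<le> a"
  shows "norm (\<Sum>i\<in>UNIV. f i *\<^sub>R g i) \<le> real CARD('n) * (a * b)"
proof -
  have "norm (\<Sum>i\<in>UNIV. f i *\<^sub>R g i) \<le> (\<Sum>i\<in>(UNIV::'n set). a * b)"
    by (rule sum_norm_le) (use assms in \<open>auto intro: mult_mono\<close>)
  then show ?thesis by simp
qed

lemma axis_combination: "(\<Sum>i\<in>UNIV. v $ i *\<^sub>R axis i 1) = v" for v :: "real ^ 'n"
  by (simp add: vec_eq_iff axis_def if_distrib cong: if_cong)

text \<open>Write the fields as \<open>axis k 1\<close> plus a remainder \<open>r\<close>. Along a ray the equation becomes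
  \<open>(t r)' = - r r + m Z\<close>, because the linear terms cancel. If \<open>r\<close> is bounded by a small \<open>R\<close>, then the
  quadratic term is at most half of \<open>R\<close> and the other one is of the order of \<open>norm x\<close>; so any \<open>R\<close> above
  a fixed multiple of \<open>norm x\<close> reproduces itself. The radius and the constant depend only on
  \<open>\<rho>\<close>, the dimension and \<open>C\<close>, which makes the estimate uniform over the rescaled frames.\<close>

lemma radial_estimate:
  fixes Z :: "'n::finite \<Rightarrow> real ^ 'n \<Rightarrow> real ^ 'n"
  defines "N \<equiv> real CARD('n)"
  assumes diff: "\<And>k x. norm x < \<rho> \<Longrightarrow> (Z k has_derivative DZ k x) (at x)"
    and Z0: "\<And>k. Z k 0 = axis k 1"
    and eq: "\<And>k x. norm x < \<rho> \<Longrightarrow>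
      DZ k x x = Z k x - (\<Sum>i\<in>UNIV. Z k x $ i *\<^sub>R Z i x) + (\<Sum>j\<in>UNIV. m j k x *\<^sub>R Z j x)"
    and m: "\<And>j k x. norm x < \<rho> \<Longrightarrow> \<bar>m j k x\<bar> \<le> C * norm x" and C: "0 \<le> C"
    and x: "norm x < \<rho>" "8 * N\<^sup>2 * C * norm x < 1"
  shows "norm (Z k x - axis k 1) \<le> 4 * N * C * norm x"
proof (rule dense_ge_bounded[of _ "1 / (2 * N)"])
  have N: "N \<ge> 1" by (simp add: N_def)
  show "4 * N * C * norm x < 1 / (2 * N)"
    using x(2) N by (simp add: field_simps power2_eq_square)
  fix R assume R: "4 * N * C * norm x < R" "R < 1 / (2 * N)"
  have R0: "R > 0" using R(1) N C by (smt (verit) mult_nonneg_nonneg norm_ge_zero)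
  have NR: "N * R < 1 / 2" using R(2) N by (simp add: field_simps)
  have R1: "R < 1" using NR N R0 mult_right_mono[of 1 N R] by linarith
  define r where "r k y = Z k y - axis k 1" for k y
  have ray: "norm (t *\<^sub>R x) < \<rho>" "norm (t *\<^sub>R x) \<le> norm x" if "t \<in> {0..1}" for t
    using that x(1) mult_left_le_one_le[of "norm x" t] by auto
  have hd: "((\<lambda>t. t *\<^sub>R r k (t *\<^sub>R x)) has_derivative
      (\<lambda>h. h *\<^sub>R (r k (t *\<^sub>R x) + DZ k (t *\<^sub>R x) (t *\<^sub>R x)))) (at t)" if t: "t \<in> {0..1}" for t k
  proof -
    have "((\<lambda>t. Z k (t *\<^sub>R x)) has_derivative (\<lambda>h. DZ k (t *\<^sub>R x) (h *\<^sub>R x))) (at t)"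
      by (rule has_derivative_compose[where g="Z k" and f="\<lambda>t. t *\<^sub>R x" and g'="DZ k (t *\<^sub>R x)"])
        (auto intro!: derivative_eq_intros diff ray(1)[OF t])
    then have "((\<lambda>t. t *\<^sub>R r k (t *\<^sub>R x)) has_derivative
      (\<lambda>h. t *\<^sub>R DZ k (t *\<^sub>R x) (h *\<^sub>R x) + h *\<^sub>R r k (t *\<^sub>R x))) (at t)"
      unfolding r_def by (auto intro!: derivative_eq_intros)
    moreover have "t *\<^sub>R DZ k (t *\<^sub>R x) (h *\<^sub>R x) + h *\<^sub>R r k (t *\<^sub>R x) =
        h *\<^sub>R (r k (t *\<^sub>R x) + DZ k (t *\<^sub>R x) (t *\<^sub>R x))" for h
      using linear_scale[OF has_derivative_linear[OF diff[OF ray(1)[OF t]]]]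
      by (simp add: algebra_simps)
    ultimately show ?thesis by simp
  qed
  have rad: "r k y + DZ k y y = - (\<Sum>i\<in>UNIV. r k y $ i *\<^sub>R r i y) + (\<Sum>j\<in>UNIV. m j k y *\<^sub>R Z j y)"
    if "norm y < \<rho>" for k y
  proof -
    have Zr: "Z k y = axis k 1 + r k y" for k by (simp add: r_def)
    have 1: "(\<Sum>i\<in>UNIV. axis k 1 $ i *\<^sub>R u i) = u k" for u :: "'n \<Rightarrow> real ^ 'n"
    proof -
      have "(\<Sum>i\<in>UNIV. axis k 1 $ i *\<^sub>R u i) = (\<Sum>i\<in>UNIV. if i = k then u i else 0)"
        by (rule sum.cong) (auto simp: axis_def)
      then show ?thesis by simp
    qed
    have "(\<Sum>i\<in>UNIV. Z k y $ i *\<^sub>R Z i y) =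
      (\<Sum>i\<in>UNIV. axis k 1 $ i *\<^sub>R axis i 1) + (\<Sum>i\<in>UNIV. axis k 1 $ i *\<^sub>R r i y) +
      (\<Sum>i\<in>UNIV. r k y $ i *\<^sub>R axis i 1) + (\<Sum>i\<in>UNIV. r k y $ i *\<^sub>R r i y)"
      by (simp add: Zr scaleR_add_left scaleR_add_right sum.distrib)
    also have "\<dots> = axis k 1 + r k y + r k y + (\<Sum>i\<in>UNIV. r k y $ i *\<^sub>R r i y)"
      by (simp only: 1 axis_combination)
    finally show ?thesis unfolding eq[OF that] by (simp add: r_def)
  qed
  have cont: "continuous_on {0..1} (\<lambda>t. norm (r k (t *\<^sub>R x)))" for k
  proof -
    have "continuous_on {0..1} (\<lambda>t. Z k (t *\<^sub>R x))"
    proof (rule continuous_at_imp_continuous_on, rule ballI)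
      fix t :: real assume "t \<in> {0..1}"
      then have "isCont (Z k) (t *\<^sub>R x)"
        by (intro has_derivative_continuous[OF diff[OF ray(1)]])
      moreover have "isCont (\<lambda>t. t *\<^sub>R x) t" by (intro continuous_intros)
      ultimately show "isCont (\<lambda>t. Z k (t *\<^sub>R x)) t" using isCont_o2[of t "\<lambda>t. t *\<^sub>R x" "Z k"] by simp
    qed
    then show ?thesis unfolding r_def by (intro continuous_intros)
  qed
  have "norm (r k (1 *\<^sub>R x)) < R"
  proof (rule first_exit[where \<phi>="\<lambda>k t. norm (r k (t *\<^sub>R x))", OF cont])
    fix t k assume t: "t \<in> {0..1::real}" and IH: "\<And>s k. 0 \<le> s \<Longrightarrow> s < t \<Longrightarrow> norm (r k (s *\<^sub>R x)) < R"
    show "norm (r k (t *\<^sub>R x)) < R"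
    proof (cases "t = 0")
      case True then show ?thesis using R0 Z0 by (simp add: r_def)
    next
      case False
      then have t0: "t > 0" using t by simp
      have "continuous_on {0..t} (\<lambda>t. t *\<^sub>R r k (t *\<^sub>R x))"
      proof (rule continuous_at_imp_continuous_on, rule ballI)
        fix \<tau> assume "\<tau> \<in> {0..t}"
        then have "\<tau> \<in> {0..1}" using t by auto
        then show "isCont (\<lambda>t. t *\<^sub>R r k (t *\<^sub>R x)) \<tau>" by (rule has_derivative_continuous[OF hd])
      qed
      then obtain \<tau> where \<tau>: "\<tau> \<in> {0<..<t}" "norm (t *\<^sub>R r k (t *\<^sub>R x) - 0 *\<^sub>R r k (0 *\<^sub>R x)) \<le>
          norm ((t - 0) *\<^sub>R (r k (\<tau> *\<^sub>R x) + DZ k (\<tau> *\<^sub>R x) (\<tau> *\<^sub>R x)))"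
        using mvt_general[OF t0, of "\<lambda>t. t *\<^sub>R r k (t *\<^sub>R x)"
          "\<lambda>t h. h *\<^sub>R (r k (t *\<^sub>R x) + DZ k (t *\<^sub>R x) (t *\<^sub>R x))"] hd t by fastforce
      have \<tau>1: "\<tau> \<in> {0..1}" using \<tau>(1) t by auto
      have small: "norm (r i (\<tau> *\<^sub>R x)) \<le> R" for i using IH[of \<tau> i] \<tau>(1) by auto
      have Zs: "norm (Z i (\<tau> *\<^sub>R x)) \<le> 2" for i
      proof -
        have "norm (Z i (\<tau> *\<^sub>R x)) \<le> norm (axis i 1 :: real ^ 'n) + norm (r i (\<tau> *\<^sub>R x))"
          unfolding r_def using norm_triangle_ineq[of "axis i 1 :: real ^ 'n" "Z i (\<tau> *\<^sub>R x) - axis i 1"] by simp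
        then show ?thesis using small[of i] R1 by (simp add: norm_axis_1)
      qed
      have comp: "\<bar>r k (\<tau> *\<^sub>R x) $ i\<bar> \<le> R" for i
        using component_le_norm_cart[of "r k (\<tau> *\<^sub>R x)" i] small[of k] by linarith
      have ms: "\<bar>m j k (\<tau> *\<^sub>R x)\<bar> \<le> C * norm x" for j
        using m[OF ray(1)[OF \<tau>1], of j k] mult_left_mono[OF ray(2)[OF \<tau>1] C] by linarith
      have "norm (r k (\<tau> *\<^sub>R x) + DZ k (\<tau> *\<^sub>R x) (\<tau> *\<^sub>R x)) \<le>
          norm (\<Sum>i\<in>UNIV. r k (\<tau> *\<^sub>R x) $ i *\<^sub>R r i (\<tau> *\<^sub>R x)) + norm (\<Sum>j\<in>UNIV. m j k (\<tau> *\<^sub>R x) *\<^sub>R Z j (\<tau> *\<^sub>R x))"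
        unfolding rad[OF ray(1)[OF \<tau>1]]
        using norm_triangle_ineq[of "- (\<Sum>i\<in>UNIV. r k (\<tau> *\<^sub>R x) $ i *\<^sub>R r i (\<tau> *\<^sub>R x))"
            "\<Sum>j\<in>UNIV. m j k (\<tau> *\<^sub>R x) *\<^sub>R Z j (\<tau> *\<^sub>R x)"] by (simp only: norm_minus_cancel)
      also have "\<dots> \<le> N * (R * R) + N * (C * norm x * 2)"
        unfolding N_def
        by (intro add_mono norm_sum_scaleR_bound comp small ms Zs) (use R0 C in auto)
      also have "\<dots> < R"
      proof -
        have "N * (R * R) \<le> R / 2" using mult_right_mono[of "N * R" "1 / 2" R] NR R0 by simp
        moreover have "N * (C * norm x * 2) < R / 2" using R(1) by simp
        ultimately show ?thesis by linarith
      qed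
      finally have "norm (r k (\<tau> *\<^sub>R x) + DZ k (\<tau> *\<^sub>R x) (\<tau> *\<^sub>R x)) < R" .
      moreover have "t * norm (r k (t *\<^sub>R x)) \<le> t * norm (r k (\<tau> *\<^sub>R x) + DZ k (\<tau> *\<^sub>R x) (\<tau> *\<^sub>R x))"
        using \<tau>(2) t0 by simp
      ultimately show ?thesis using t0 by (smt (verit) mult_le_cancel_left_pos)
    qed
  qed auto
  then show "norm (Z k x - axis k 1) \<le> R" by (simp add: r_def)
qed

section \<open>Dilations\<close>

lemma dilation_nth: "dilation w r x $ i = r ^ w i * x $ i"
  by (simp add: dilation_def)

lemma linear_dilation: "linear (dilation w r)"
  by (rule linearI) (simp_all add: vec_eq_iff dilation_nth algebra_simps)

lemma bounded_linear_dilation: "bounded_linear (dilation w r)"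
  using linear_dilation linear_conv_bounded_linear by blast

lemma dilation_zero: "dilation w r 0 = 0"
  using linear_0[OF linear_dilation] .

lemma dilation_mult: "dilation w r (dilation w r' x) = dilation w (r * r') x"
  by (simp add: vec_eq_iff dilation_nth power_mult_distrib)

lemma dilation_one: "dilation w 1 x = x"
  by (simp add: vec_eq_iff dilation_nth)

lemma dilation_inverse: "r \<noteq> 0 \<Longrightarrow> dilation w (1 / r) (dilation w r x) = x"
  "r \<noteq> 0 \<Longrightarrow> dilation w r (dilation w (1 / r) x) = x"
  by (simp_all add: dilation_mult dilation_one)

lemma norm_le_componentwise: "(\<And>i. \<bar>x $ i\<bar> \<le> \<bar>y $ i\<bar>) \<Longrightarrow> norm x \<le> norm y" for x y :: "real ^ 'n"
  by (simp add: norm_vec_def L2_set_mono)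

lemma norm_dilation_le:
  assumes "0 \<le> r" "r \<le> 1" shows "norm (dilation w r x) \<le> norm x"
  by (rule norm_le_componentwise)
    (use assms in \<open>auto simp: dilation_nth abs_mult power_le_one intro: mult_left_le_one_le\<close>)

lemma norm_dilation_le_linear:
  assumes "0 \<le> r" "r \<le> 1" "\<And>i. 0 < w i" shows "norm (dilation w r x) \<le> r * norm x"
proof -
  have "norm (dilation w r x) \<le> norm (r *\<^sub>R x)"
  proof (rule norm_le_componentwise)
    fix i
    have "r ^ w i \<le> r ^ 1" using assms(1,2) Suc_leI[OF assms(3)[of i]] by (intro power_decreasing) auto
    then show "\<bar>dilation w r x $ i\<bar> \<le> \<bar>(r *\<^sub>R x) $ i\<bar>"
      using assms(1) by (auto simp: dilation_nth abs_mult intro: mult_right_mono)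
  qed
  then show ?thesis using assms(1) by simp
qed

text \<open>The push-forward by \<open>dilation w (1 / \<epsilon>)\<close>, multiplied by the power that keeps the value at 0.\<close>

definition rescaled :: "('n::finite \<Rightarrow> nat) \<Rightarrow> real \<Rightarrow> ('n \<Rightarrow> real ^ 'n \<Rightarrow> real ^ 'n) \<Rightarrow> 'n \<Rightarrow> real ^ 'n \<Rightarrow> real ^ 'n" where
  "rescaled w \<epsilon> Z k x = \<epsilon> ^ w k *\<^sub>R dilation w (1 / \<epsilon>) (Z k (dilation w \<epsilon> x))"

section \<open>Exponential coordinates are privileged\<close>

context exponential_frame
begin

definition structure_coef :: "'n \<Rightarrow> 'n \<Rightarrow> 'n \<Rightarrow> (real, 'n) vec \<Rightarrow> real" where
  "structure_coef i k j x = frame_coef (\<lambda>l. Xt l x) (lie_bracket (Xt i) (Xt k) x) $ j"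

text \<open>The Euler identity is differentiated in the direction of \<open>Xt k\<close>. Replacing the derivatives of the
  other fields along \<open>Xt k\<close> by brackets leaves the radial derivative of \<open>Xt k\<close> itself.\<close>

lemma radial_derivative:
  assumes R: "ball 0 R \<subseteq> V" and x: "x \<in> ball 0 R"
  shows "frechet_derivative (Xt k) (at x) x = Xt k x - (\<Sum>i\<in>UNIV. Xt k x $ i *\<^sub>R Xt i x)
    + (\<Sum>j\<in>UNIV. (\<Sum>i\<in>UNIV. x $ i * structure_coef i k j x) *\<^sub>R Xt j x)"
proof -
  let ?D = "\<lambda>i. frechet_derivative (Xt i) (at x)"
  have xV: "x \<in> V" using R x by blast
  have D: "(Xt i has_derivative ?D i) (at x)" for i
    by (rule smooth_on_has_derivative[OF Xt_smooth xV])
  have "((\<lambda>y. \<Sum>i\<in>UNIV. y $ i *\<^sub>R Xt i y) has_derivative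
      (\<lambda>v. \<Sum>i\<in>UNIV. x $ i *\<^sub>R ?D i v + v $ i *\<^sub>R Xt i x)) (at x)"
    by (rule has_derivative_sum, rule has_derivative_scaleR[OF _ D])
      (rule bounded_linear_imp_has_derivative, rule bounded_linear_vec_nth)
  then have "((\<lambda>y. y) has_derivative (\<lambda>v. \<Sum>i\<in>UNIV. x $ i *\<^sub>R ?D i v + v $ i *\<^sub>R Xt i x)) (at x)"
    by (rule has_derivative_transform_within_open[OF _ open_ball x]) (rule euler_ball[OF R])
  then have uniq: "(\<lambda>v. v) = (\<lambda>v. \<Sum>i\<in>UNIV. x $ i *\<^sub>R ?D i v + v $ i *\<^sub>R Xt i x)"
    using has_derivative_ident by (rule has_derivative_unique[symmetric])
  have E: "v = (\<Sum>i\<in>UNIV. x $ i *\<^sub>R ?D i v) + (\<Sum>i\<in>UNIV. v $ i *\<^sub>R Xt i x)" for v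
    using fun_cong[OF uniq, of v] by (simp only: sum.distrib)
  have "?D k x = ?D k (\<Sum>i\<in>UNIV. x $ i *\<^sub>R Xt i x)" using euler_ball[OF R x] by simp
  also have "\<dots> = (\<Sum>i\<in>UNIV. x $ i *\<^sub>R ?D k (Xt i x))"
    using has_derivative_linear[OF D] by (simp add: linear_sum linear_scale)
  also have "\<dots> = (\<Sum>i\<in>UNIV. x $ i *\<^sub>R lie_bracket (Xt i) (Xt k) x) + (\<Sum>i\<in>UNIV. x $ i *\<^sub>R ?D i (Xt k x))"
    by (simp add: lie_bracket_def flip: sum.distrib scaleR_add_right)
  also have "(\<Sum>i\<in>UNIV. x $ i *\<^sub>R ?D i (Xt k x)) = Xt k x - (\<Sum>i\<in>UNIV. Xt k x $ i *\<^sub>R Xt i x)"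
    using E[of "Xt k x"] by (simp add: algebra_simps)
  also have "(\<Sum>i\<in>UNIV. x $ i *\<^sub>R lie_bracket (Xt i) (Xt k) x) =
      (\<Sum>j\<in>UNIV. (\<Sum>i\<in>UNIV. x $ i * structure_coef i k j x) *\<^sub>R Xt j x)"
  proof -
    have "(\<Sum>i\<in>UNIV. x $ i *\<^sub>R lie_bracket (Xt i) (Xt k) x) =
        (\<Sum>i\<in>UNIV. x $ i *\<^sub>R (\<Sum>j\<in>UNIV. structure_coef i k j x *\<^sub>R Xt j x))"
      by (simp add: structure_coef_def frame_coef_expand[OF Xt_det[OF xV]])
    also have "\<dots> = (\<Sum>i\<in>UNIV. \<Sum>j\<in>UNIV. (x $ i * structure_coef i k j x) *\<^sub>R Xt j x)"
      by (simp add: scaleR_sum_right)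
    also have "\<dots> = (\<Sum>j\<in>UNIV. \<Sum>i\<in>UNIV. (x $ i * structure_coef i k j x) *\<^sub>R Xt j x)"
      by (rule sum.swap)
    finally show ?thesis by (simp add: scaleR_sum_left)
  qed
  finally show ?thesis by simp
qed

lemma structure_coef_continuous: "continuous_on V (structure_coef i k j)"
proof -
  have c: "(f \<longlongrightarrow> f x) (at x within V)" if "smooth_on V f" "x \<in> V" for f :: "(real, 'n) vec \<Rightarrow> (real, 'n) vec" and x
    using smooth_on_imp_continuous_on[OF that(1)] that(2) by (simp add: continuous_on_def)
  show ?thesis
    unfolding continuous_on_def structure_coef_def
    by (intro ballI tendsto_vec_nth tendsto_frame_coef c Xt_smooth smooth_on_lie_bracket open_V Xt_det)
qed

definition Xe :: "real \<Rightarrow> 'n \<Rightarrow> (real, 'n) vec \<Rightarrow> (real, 'n) vec" where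
  "Xe \<epsilon> = rescaled w \<epsilon> Xt"

lemma Xe_zero: "\<epsilon> > 0 \<Longrightarrow> Xe \<epsilon> k 0 = axis k 1"
  by (simp add: Xe_def rescaled_def dilation_zero Xt_zero vec_eq_iff dilation_nth axis_def power_one_over)

lemma Xe_has_derivative:
  assumes "dilation w \<epsilon> x \<in> V"
  shows "(Xe \<epsilon> k has_derivative
    (\<lambda>v. \<epsilon> ^ w k *\<^sub>R dilation w (1 / \<epsilon>) (frechet_derivative (Xt k) (at (dilation w \<epsilon> x)) (dilation w \<epsilon> v)))) (at x)"
  unfolding Xe_def rescaled_def[abs_def]
  by (intro has_derivative_scaleR_right bounded_linear.has_derivative[OF bounded_linear_dilation]
      has_derivative_compose[of "dilation w \<epsilon>", OF _ smooth_on_has_derivative[OF Xt_smooth assms]]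
      bounded_linear_imp_has_derivative bounded_linear_dilation)

text \<open>The radial equation is preserved by the rescaling. A structure function acquires the power of
  \<epsilon> given by the difference of the weights, and it vanishes whenever this power is
  negative.\<close>

lemma Xe_radial_derivative:
  assumes R: "ball 0 R \<subseteq> V" and x: "norm x < R" and \<epsilon>: "0 < \<epsilon>" "\<epsilon> \<le> 1"
  shows "\<epsilon> ^ w k *\<^sub>R dilation w (1 / \<epsilon>) (frechet_derivative (Xt k) (at (dilation w \<epsilon> x)) (dilation w \<epsilon> x)) =
    Xe \<epsilon> k x - (\<Sum>i\<in>UNIV. Xe \<epsilon> k x $ i *\<^sub>R Xe \<epsilon> i x)
    + (\<Sum>j\<in>UNIV. (\<Sum>i\<in>UNIV. x $ i * (\<epsilon> ^ (w i + w k) / \<epsilon> ^ w j * structure_coef i k j (dilation w \<epsilon> x))) *\<^sub>R Xe \<epsilon> j x)"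
proof -
  let ?y = "dilation w \<epsilon> x"
  have y: "?y \<in> ball 0 R" using norm_dilation_le[of \<epsilon> w x] \<epsilon> x by simp
  let ?S = "\<lambda>v. \<epsilon> ^ w k *\<^sub>R dilation w (1 / \<epsilon>) v"
  have l: "linear ?S" by (intro linear_compose_scale_right linear_dilation)
  have S: "?S (Xt i ?y) = (\<epsilon> ^ w k / \<epsilon> ^ w i) *\<^sub>R Xe \<epsilon> i x" for i
    using \<epsilon> by (simp add: Xe_def rescaled_def)
  have comp: "Xt k ?y $ i * (\<epsilon> ^ w k / \<epsilon> ^ w i) = Xe \<epsilon> k x $ i" for i
    using \<epsilon> by (simp add: Xe_def rescaled_def dilation_nth power_one_over field_simps)
  have "?S (frechet_derivative (Xt k) (at ?y) ?y) = ?S (Xt k ?y) - (\<Sum>i\<in>UNIV. Xt k ?y $ i *\<^sub>R ?S (Xt i ?y))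
      + (\<Sum>j\<in>UNIV. (\<Sum>i\<in>UNIV. ?y $ i * structure_coef i k j ?y) *\<^sub>R ?S (Xt j ?y))"
    unfolding radial_derivative[OF R y]
    by (simp only: linear_add[OF l] linear_diff[OF l] linear_sum[OF l] linear_scale[OF l])
  also have "(\<Sum>i\<in>UNIV. Xt k ?y $ i *\<^sub>R ?S (Xt i ?y)) = (\<Sum>i\<in>UNIV. Xe \<epsilon> k x $ i *\<^sub>R Xe \<epsilon> i x)"
    unfolding S by (simp only: scaleR_scaleR comp)
  also have "?S (Xt k ?y) = Xe \<epsilon> k x" by (simp add: Xe_def rescaled_def)
  also have "(\<Sum>j\<in>UNIV. (\<Sum>i\<in>UNIV. ?y $ i * structure_coef i k j ?y) *\<^sub>R ?S (Xt j ?y)) =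
     (\<Sum>j\<in>UNIV. (\<Sum>i\<in>UNIV. x $ i * (\<epsilon> ^ (w i + w k) / \<epsilon> ^ w j * structure_coef i k j ?y)) *\<^sub>R Xe \<epsilon> j x)"
    unfolding S scaleR_scaleR sum_distrib_right
    by (rule sum.cong[OF refl], rule arg_cong2[where f=scaleR], rule sum.cong)
      (auto simp: dilation_nth power_add)
  finally show ?thesis .
qed

text \<open>This is the statement that exponential coordinates are privileged: the rescaled fields do not blow
  up. The coefficients of their radial equation are bounded independently of \<epsilon>, so the
  radial estimate applies to all of them with the same constants.\<close>

lemma Xe_estimate:
  obtains \<rho> K where "\<rho> > 0" "K > 0" "ball 0 \<rho> \<subseteq> V"
    "\<And>\<epsilon> k x. 0 < \<epsilon> \<Longrightarrow> \<epsilon> \<le> 1 \<Longrightarrow> norm x < \<rho> \<Longrightarrow> norm (Xe \<epsilon> k x - axis k 1) \<le> K * norm x"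
proof -
  obtain R0 where R0: "R0 > 0" "cball 0 R0 \<subseteq> V" using open_V zero_V open_contains_cball by blast
  have "\<exists>B. \<forall>x\<in>cball 0 R0. \<bar>structure_coef i k j x\<bar> \<le> B" for i k j
  proof -
    have "bounded (structure_coef i k j ` cball 0 R0)"
      by (intro compact_imp_bounded compact_continuous_image continuous_on_subset[OF structure_coef_continuous R0(2)] compact_cball)
    then show ?thesis by (auto simp: bounded_iff)
  qed
  then obtain B where B: "\<And>i k j x. x \<in> cball 0 R0 \<Longrightarrow> \<bar>structure_coef i k j x\<bar> \<le> B i k j" by metis
  define B0 where "B0 = (\<Sum>i\<in>UNIV. \<Sum>k\<in>UNIV. \<Sum>j\<in>UNIV. \<bar>B i k j\<bar>) + 1"
  have B0: "\<bar>structure_coef i k j x\<bar> \<le> B0" if "x \<in> cball 0 R0" for i k j x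
  proof -
    have "\<bar>B i k j\<bar> \<le> (\<Sum>j\<in>UNIV. \<bar>B i k j\<bar>)" by (rule member_le_sum) auto
    also have "\<dots> \<le> (\<Sum>k\<in>UNIV. \<Sum>j\<in>UNIV. \<bar>B i k j\<bar>)"
      by (rule member_le_sum[where f="\<lambda>k. \<Sum>j\<in>UNIV. \<bar>B i k j\<bar>"]) (auto intro: sum_nonneg)
    also have "\<dots> \<le> (\<Sum>i\<in>UNIV. \<Sum>k\<in>UNIV. \<Sum>j\<in>UNIV. \<bar>B i k j\<bar>)"
      by (rule member_le_sum[where f="\<lambda>i. \<Sum>k\<in>UNIV. \<Sum>j\<in>UNIV. \<bar>B i k j\<bar>"]) (auto intro: sum_nonneg)
    finally show ?thesis using B[OF that, of i k j] by (simp add: B0_def)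
  qed
  have B0p: "B0 > 0" unfolding B0_def by (intro add_nonneg_pos sum_nonneg) auto
  define N where "N = real CARD('n)"
  define C where "C = N * B0"
  have N: "N \<ge> 1" by (simp add: N_def)
  have C: "C > 0" using N B0p by (simp add: C_def)
  (* the smallness condition of the radial estimate with its constant C *)
  define \<rho> where "\<rho> = min R0 (1 / (8 * N\<^sup>2 * C))"
  have \<rho>: "\<rho> > 0" using R0 N C by (simp add: \<rho>_def)
  show ?thesis
  proof
    show "\<rho> > 0" by (rule \<rho>)
    show "4 * N * C > 0" using N C by simp
    show "ball 0 \<rho> \<subseteq> V" using R0(2) by (auto simp: \<rho>_def)
    fix \<epsilon> :: real and k and x :: "(real, 'n) vec" assume \<epsilon>: "0 < \<epsilon>" "\<epsilon> \<le> 1" and x: "norm x < \<rho>"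
    have ball: "ball 0 R0 \<subseteq> V" using R0(2) by auto
    have dil: "dilation w \<epsilon> x \<in> cball 0 R0" if "norm x < R0" for x
      using norm_dilation_le[of \<epsilon> w x] that \<epsilon> by simp
    show "norm (Xe \<epsilon> k x - axis k 1) \<le> 4 * N * C * norm x"
      unfolding N_def
    proof (rule radial_estimate[where \<rho>=R0 and
        m="\<lambda>j k x. \<Sum>i\<in>UNIV. x $ i * (\<epsilon> ^ (w i + w k) / \<epsilon> ^ w j * structure_coef i k j (dilation w \<epsilon> x))"])
      fix k and x :: "(real, 'n) vec" assume x: "norm x < R0"
      show "(Xe \<epsilon> k has_derivative
        (\<lambda>v. \<epsilon> ^ w k *\<^sub>R dilation w (1 / \<epsilon>) (frechet_derivative (Xt k) (at (dilation w \<epsilon> x)) (dilation w \<epsilon> v)))) (at x)"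
        by (rule Xe_has_derivative) (use dil[OF x] R0 in auto)
      show "\<epsilon> ^ w k *\<^sub>R dilation w (1 / \<epsilon>) (frechet_derivative (Xt k) (at (dilation w \<epsilon> x)) (dilation w \<epsilon> x)) =
        Xe \<epsilon> k x - (\<Sum>i\<in>UNIV. Xe \<epsilon> k x $ i *\<^sub>R Xe \<epsilon> i x)
        + (\<Sum>j\<in>UNIV. (\<Sum>i\<in>UNIV. x $ i * (\<epsilon> ^ (w i + w k) / \<epsilon> ^ w j * structure_coef i k j (dilation w \<epsilon> x))) *\<^sub>R Xe \<epsilon> j x)"
        by (rule Xe_radial_derivative[OF ball x \<epsilon>])
      fix j
      have xV: "dilation w \<epsilon> x \<in> V" using dil[OF x] R0 by blast
      have "\<bar>\<epsilon> ^ (w i + w k) / \<epsilon> ^ w j * structure_coef i k j (dilation w \<epsilon> x)\<bar> \<le> B0" for i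
      proof (cases "w i + w k < w j")
        case True
        then show ?thesis using structure_weights[OF xV True] B0p by (simp add: structure_coef_def)
      next
        case False
        then have "\<epsilon> ^ (w i + w k) \<le> \<epsilon> ^ w j" using \<epsilon> by (intro power_decreasing) auto
        then have "\<bar>\<epsilon> ^ (w i + w k) / \<epsilon> ^ w j\<bar> \<le> 1" using \<epsilon> by simp
        then show ?thesis using B0[OF dil[OF x], of i k j] mult_mono[of "\<bar>\<epsilon> ^ (w i + w k) / \<epsilon> ^ w j\<bar>" 1 _ B0]
          by (simp add: abs_mult)
      qed
      then have "\<bar>x $ i * (\<epsilon> ^ (w i + w k) / \<epsilon> ^ w j * structure_coef i k j (dilation w \<epsilon> x))\<bar> \<le> norm x * B0" for i
        unfolding abs_mult[of "x $ i"] using component_le_norm_cart[of x i] B0p by (intro mult_mono) auto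
      then have "\<bar>\<Sum>i\<in>UNIV. x $ i * (\<epsilon> ^ (w i + w k) / \<epsilon> ^ w j * structure_coef i k j (dilation w \<epsilon> x))\<bar> \<le>
          (\<Sum>i\<in>(UNIV::'n set). norm x * B0)"
        by (intro order_trans[OF sum_abs] sum_mono)
      then show "\<bar>\<Sum>i\<in>UNIV. x $ i * (\<epsilon> ^ (w i + w k) / \<epsilon> ^ w j * structure_coef i k j (dilation w \<epsilon> x))\<bar> \<le> C * norm x"
        by (simp add: C_def N_def mult_ac)
    next
      show "8 * (real CARD('n))\<^sup>2 * C * norm x < 1"
        using x N C by (simp add: \<rho>_def N_def field_simps)
    qed (use Xe_zero \<epsilon> C x in \<open>auto simp: \<rho>_def\<close>)
  qed
qed

end

section \<open>Weighted Taylor expansion\<close>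

lemma finite_lists_of_length: "finite {ks :: 'n::finite list. length ks = m}"
  using finite_lists_length_eq[of "UNIV :: 'n set" m] by simp

lemma finite_lists_below: "finite {ks :: 'n::finite list. length ks < N}"
proof -
  have "{ks :: 'n list. length ks < N} = (\<Union>m<N. {ks. length ks = m})" by auto
  then show ?thesis by (simp add: finite_lists_of_length)
qed

text \<open>The monomial indexed by a sequence of indices, as in the definition of the homogeneous parts.\<close>

definition monomial_at :: "real ^ 'n \<Rightarrow> 'n list \<Rightarrow> real" where
  "monomial_at x ks = prod_list (map (\<lambda>k. x $ k) ks)"

lemma monomial_bound: "norm x \<le> R \<Longrightarrow> \<bar>monomial_at x ks\<bar> \<le> R ^ length ks"
proof (induction ks)
  case (Cons k ks)
  have "\<bar>x $ k\<bar> \<le> R" using component_le_norm_cart[of x k] Cons.prems by linarith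
  then show ?case using Cons by (auto simp: monomial_at_def abs_mult intro!: mult_mono)
qed (simp add: monomial_at_def)

lemma monomial_dilation:
  "monomial_at (dilation w r x) ks = r ^ sum_list (map w ks) * monomial_at x ks"
  by (induction ks) (simp_all add: monomial_at_def dilation_nth power_add)

lemma iterated_partial_smooth:
  fixes a :: "real ^ 'n::finite \<Rightarrow> real"
  shows "smooth_on S a \<Longrightarrow> smooth_on S (iterated_partial ks a)"
proof (induction ks)
  case (Cons k ks)
  then show ?case using smooth_on_derivative[of S "iterated_partial ks a" "axis k 1"] by simp
qed simp

lemma frechet_derivative_partials:
  fixes f :: "real ^ 'n::finite \<Rightarrow> real"
  assumes "(f has_derivative D) (at x)"
  shows "D v = (\<Sum>k\<in>UNIV. v $ k * frechet_derivative f (at x) (axis k 1))"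
proof -
  have l: "linear D" and D: "D = frechet_derivative f (at x)"
    using has_derivative_linear[OF assms] frechet_derivative_at[OF assms] by auto
  have "D v = D (\<Sum>k\<in>UNIV. v $ k *\<^sub>R axis k 1)" by (simp only: axis_combination)
  also have "\<dots> = (\<Sum>k\<in>UNIV. v $ k *\<^sub>R D (axis k 1))"
    by (simp only: linear_sum[OF l] linear_scale[OF l])
  finally show ?thesis by (simp add: D)
qed

definition ray_derivative :: "(real ^ 'n \<Rightarrow> real) \<Rightarrow> real ^ 'n::finite \<Rightarrow> nat \<Rightarrow> real \<Rightarrow> real" where
  "ray_derivative a y m t = (\<Sum>ks | length ks = m. iterated_partial ks a (t *\<^sub>R y) * monomial_at y ks)"

lemma ray_derivative_step:
  assumes a: "smooth_on S a" and S: "t *\<^sub>R y \<in> S"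
  shows "(ray_derivative a y m has_real_derivative ray_derivative a y (Suc m) t) (at t)"
proof -
  have ks: "((\<lambda>t. iterated_partial ks a (t *\<^sub>R y) * monomial_at y ks) has_real_derivative
      (\<Sum>k\<in>UNIV. iterated_partial (k # ks) a (t *\<^sub>R y) * monomial_at y (k # ks))) (at t)" for ks
  proof -
    let ?f = "iterated_partial ks a"
    have D: "(?f has_derivative frechet_derivative ?f (at (t *\<^sub>R y))) (at (t *\<^sub>R y))"
      by (rule smooth_on_has_derivative[OF iterated_partial_smooth[OF a] S])
    have "((\<lambda>t. ?f (t *\<^sub>R y)) has_derivative (\<lambda>h. frechet_derivative ?f (at (t *\<^sub>R y)) (h *\<^sub>R y))) (at t)"
      by (rule has_derivative_compose[where g="?f" and f="\<lambda>t. t *\<^sub>R y"])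
        (auto intro!: derivative_eq_intros D)
    moreover have "frechet_derivative ?f (at (t *\<^sub>R y)) (h *\<^sub>R y) =
        (\<Sum>k\<in>UNIV. y $ k * iterated_partial (k # ks) a (t *\<^sub>R y)) * h" for h
      using linear_scale[OF has_derivative_linear[OF D], of h y] frechet_derivative_partials[OF D, of y]
      by (simp add: mult.commute)
    ultimately have "((\<lambda>t. ?f (t *\<^sub>R y)) has_real_derivative
        (\<Sum>k\<in>UNIV. y $ k * iterated_partial (k # ks) a (t *\<^sub>R y))) (at t)"
      by (simp add: has_field_derivative_def)
    then have "((\<lambda>t. ?f (t *\<^sub>R y) * monomial_at y ks) has_real_derivative
        (\<Sum>k\<in>UNIV. y $ k * iterated_partial (k # ks) a (t *\<^sub>R y)) * monomial_at y ks) (at t)"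
      by (rule DERIV_cmult_right)
    then show ?thesis by (simp add: monomial_at_def sum_distrib_right sum_distrib_left mult_ac)
  qed
  have "(ray_derivative a y m has_real_derivative
      (\<Sum>ks | length ks = m. \<Sum>k\<in>UNIV. iterated_partial (k # ks) a (t *\<^sub>R y) * monomial_at y (k # ks))) (at t)"
    unfolding ray_derivative_def[abs_def] by (rule DERIV_sum[OF ks])
  also have "(\<Sum>ks | length ks = m. \<Sum>k\<in>UNIV. iterated_partial (k # ks) a (t *\<^sub>R y) * monomial_at y (k # ks)) =
      (\<Sum>(ks, k)\<in>{ks. length ks = m} \<times> UNIV. iterated_partial (k # ks) a (t *\<^sub>R y) * monomial_at y (k # ks))"
    by (rule sum.cartesian_product)
  also have "\<dots> = ray_derivative a y (Suc m) t"
    unfolding ray_derivative_def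
    by (rule sum.reindex_bij_witness[of _ "\<lambda>ks. (tl ks, hd ks)" "\<lambda>(ks, k). k # ks"])
      (auto simp: length_Suc_conv)
  finally show ?thesis .
qed

definition taylor_term :: "(real ^ 'n \<Rightarrow> real) \<Rightarrow> real ^ 'n \<Rightarrow> 'n::finite list \<Rightarrow> real" where
  "taylor_term a x ks = iterated_partial ks a 0 / fact (length ks) * monomial_at x ks"

text \<open>The one-dimensional expansion along the segment from the origin.\<close>

lemma taylor_remainder:
  fixes a :: "real ^ 'n::finite \<Rightarrow> real"
  assumes a: "smooth_on S a" and r: "cball 0 r \<subseteq> S" and N: "0 < N"
  shows "\<exists>C\<ge>0. \<forall>y. norm y \<le> r \<longrightarrow> \<bar>a y - (\<Sum>ks | length ks < N. taylor_term a y ks)\<bar> \<le> C * norm y ^ N"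
proof -
  have "\<exists>B. \<forall>x\<in>cball 0 r. \<bar>iterated_partial ks a x\<bar> \<le> B" for ks
  proof -
    have "continuous_on (cball 0 r) (iterated_partial ks a)"
      using smooth_on_imp_continuous_on[OF iterated_partial_smooth[OF a]] r continuous_on_subset by blast
    then have "bounded (iterated_partial ks a ` cball 0 r)"
      using compact_continuous_image compact_imp_bounded compact_cball by blast
    then show ?thesis by (auto simp: bounded_iff)
  qed
  then obtain B where B: "\<And>ks x. x \<in> cball 0 r \<Longrightarrow> \<bar>iterated_partial ks a x\<bar> \<le> B ks" by metis
  define C where "C = (\<Sum>ks | length (ks :: 'n list) = N. \<bar>B ks\<bar>)"
  have "\<bar>a y - (\<Sum>ks | length ks < N. taylor_term a y ks)\<bar> \<le> C * norm y ^ N" if y: "norm y \<le> r" for y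
  proof -
    have inS: "t *\<^sub>R y \<in> cball 0 r" if "0 \<le> t" "t \<le> 1" for t
    proof -
      have "norm (t *\<^sub>R y) \<le> norm y" using that by (simp add: mult_left_le_one_le)
      then show ?thesis using y by simp
    qed
    have "\<exists>t>0. t < 1 \<and> a (1 *\<^sub>R y) = (\<Sum>m<N. ray_derivative a y m 0 / fact m * 1 ^ m) + ray_derivative a y N t / fact N * 1 ^ N"
      by (rule Maclaurin[where f="\<lambda>t. a (t *\<^sub>R y)"])
        (use N inS r in \<open>auto simp: ray_derivative_def[of _ _ 0] monomial_at_def intro!: ray_derivative_step[OF a]\<close>)
    then obtain t where t: "0 < t" "t < 1"
      "a y = (\<Sum>m<N. ray_derivative a y m 0 / fact m) + ray_derivative a y N t / fact N" by auto
    have "(\<Sum>m<N. ray_derivative a y m 0 / fact m) = (\<Sum>m<N. \<Sum>ks | length ks = m. taylor_term a y ks)"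
      by (simp add: ray_derivative_def taylor_term_def sum_divide_distrib)
    also have "\<dots> = (\<Sum>ks\<in>(\<Union>m\<in>{..<N}. {ks. length ks = m}). taylor_term a y ks)"
      by (rule sum.UNION_disjoint[symmetric]) (auto simp: finite_lists_of_length)
    also have "(\<Union>m\<in>{..<N}. {ks :: 'n list. length ks = m}) = {ks. length ks < N}" by auto
    finally have "a y - (\<Sum>ks | length ks < N. taylor_term a y ks) = ray_derivative a y N t / fact N"
      using t(3) by simp
    moreover have "\<bar>ray_derivative a y N t / fact N\<bar> \<le> \<bar>ray_derivative a y N t\<bar>"
      using fact_ge_1[of N, where 'a=real] by (simp add: divide_le_eq mult_le_cancel_left1)
    moreover have "\<bar>ray_derivative a y N t\<bar> \<le> (\<Sum>ks | length (ks::'n list) = N. \<bar>B ks\<bar> * norm y ^ N)"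
      unfolding ray_derivative_def
    proof (rule order_trans[OF sum_abs sum_mono])
      fix ks :: "'n list" assume "ks \<in> {ks. length ks = N}"
      then have "\<bar>monomial_at y ks\<bar> \<le> norm y ^ N" using monomial_bound[of y "norm y" ks] by simp
      moreover have "\<bar>iterated_partial ks a (t *\<^sub>R y)\<bar> \<le> \<bar>B ks\<bar>"
        using B[OF inS[of t], of ks] t by simp
      ultimately show "\<bar>iterated_partial ks a (t *\<^sub>R y) * monomial_at y ks\<bar> \<le> \<bar>B ks\<bar> * norm y ^ N"
        unfolding abs_mult by (intro mult_mono) auto
    qed
    ultimately show ?thesis by (simp add: C_def sum_distrib_right)
  qed
  moreover have "C \<ge> 0" by (simp add: C_def sum_nonneg)
  ultimately show ?thesis by blast
qed

lemma length_le_weight: "(\<And>k. 0 < w k) \<Longrightarrow> length ks \<le> sum_list (map w ks)" for w :: "'n \<Rightarrow> nat"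
proof (induction ks)
  case (Cons k ks)
  have "0 < w k" by (rule Cons.prems)
  moreover have "length ks \<le> sum_list (map w ks)" by (rule Cons.IH[OF Cons.prems])
  ultimately show ?case by simp
qed simp

lemma homogeneous_part_dilation:
  "taylor_homogeneous_part w (int d) a (dilation w r x) = r ^ d * taylor_homogeneous_part w (int d) a x"
  unfolding taylor_homogeneous_part_def
  by (auto simp: monomial_dilation[unfolded monomial_at_def] sum_distrib_left mult_ac intro!: sum.cong)

text \<open>Sequences of weight at most \<open>d\<close> have length at most \<open>d\<close>, so they are all present in the ordinary
  expansion of that order; the surplus terms have weight above \<open>d\<close> and join the remainder.\<close>

lemma weighted_taylor:
  fixes a :: "real ^ 'n::finite \<Rightarrow> real"
  assumes w: "\<And>k. 0 < w k" and a: "smooth_on S a" and S: "open S" "0 \<in> S" and R: "R > 0"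
  obtains C \<epsilon>0 where "C \<ge> 0" "\<epsilon>0 > 0"
    "\<And>\<epsilon> x. 0 < \<epsilon> \<Longrightarrow> \<epsilon> < \<epsilon>0 \<Longrightarrow> norm x \<le> R \<Longrightarrow>
      \<bar>a (dilation w \<epsilon> x) - (\<Sum>e\<le>d. \<epsilon> ^ e * taylor_homogeneous_part w (int e) a x)\<bar> \<le> C * \<epsilon> ^ Suc d"
proof -
  obtain r where r: "r > 0" "cball 0 r \<subseteq> S" using S open_contains_cball by blast
  obtain C where C: "C \<ge> 0" "\<And>y. norm y \<le> r \<Longrightarrow>
      \<bar>a y - (\<Sum>ks | length ks < Suc d. taylor_term a y ks)\<bar> \<le> C * norm y ^ Suc d"
    using taylor_remainder[OF a r(2), of "Suc d"] by auto
  define wt where "wt ks = sum_list (map w ks)" for ks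
  define D where "D = (\<Sum>ks | length (ks::'n list) < Suc d. \<bar>iterated_partial ks a 0\<bar> * R ^ length ks)"
  define \<epsilon>0 where "\<epsilon>0 = min 1 (r / R)"
  have \<epsilon>0: "\<epsilon>0 > 0" using r R by (simp add: \<epsilon>0_def)
  have Phi_dom: "D \<ge> 0" using R by (auto simp: D_def intro!: sum_nonneg)
  have main: "\<bar>a (dilation w \<epsilon> x) - (\<Sum>e\<le>d. \<epsilon> ^ e * taylor_homogeneous_part w (int e) a x)\<bar> \<le> (C * R ^ Suc d + D) * \<epsilon> ^ Suc d"
    if \<epsilon>: "0 < \<epsilon>" "\<epsilon> < \<epsilon>0" and x: "norm x \<le> R" for \<epsilon> x
  proof -
    let ?y = "dilation w \<epsilon> x"
    have \<epsilon>1: "\<epsilon> < 1" "\<epsilon> * R < r" using \<epsilon> R by (auto simp: \<epsilon>0_def pos_less_divide_eq)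
    have y: "norm ?y \<le> \<epsilon> * R"
      by (rule order_trans[OF norm_dilation_le_linear mult_left_mono[OF x]]) (use w \<epsilon>(1) \<epsilon>1 in auto)
    then have yr: "norm ?y \<le> r" using \<epsilon>1 by simp
    have tt: "taylor_term a ?y ks = \<epsilon> ^ wt ks * taylor_term a x ks" for ks
      by (simp add: taylor_term_def monomial_dilation wt_def)
    have fin: "finite {ks :: 'n list. length ks < Suc d}" by (rule finite_lists_below)
    have low: "{ks :: 'n list. length ks < Suc d} \<inter> {ks. wt ks \<le> d} = (\<Union>e\<in>{..d}. {ks. wt ks = e})"
    proof -
      have "length ks < Suc d" if "wt ks \<le> d" for ks :: "'n list"
        using length_le_weight[where w=w and ks=ks, OF w] that by (simp add: wt_def)
      then show ?thesis by auto
    qed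
    have finw: "finite {ks :: 'n list. wt ks = e}" if "e \<le> d" for e
    proof (rule finite_subset[OF _ fin], rule subsetI, rule CollectI)
      fix ks :: "'n list" assume "ks \<in> {ks. wt ks = e}"
      then show "length ks < Suc d" using that length_le_weight[where w=w and ks=ks, OF w] by (simp add: wt_def)
    qed
    have "(\<Sum>ks | length ks < Suc d. taylor_term a ?y ks) =
        (\<Sum>ks\<in>{ks. length ks < Suc d} \<inter> {ks. wt ks \<le> d}. \<epsilon> ^ wt ks * taylor_term a x ks) +
        (\<Sum>ks\<in>{ks. length ks < Suc d} - {ks. wt ks \<le> d}. \<epsilon> ^ wt ks * taylor_term a x ks)"
      unfolding tt by (rule sum.Int_Diff[OF fin])
    also have "(\<Sum>ks\<in>{ks. length ks < Suc d} \<inter> {ks. wt ks \<le> d}. \<epsilon> ^ wt ks * taylor_term a x ks) =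
        (\<Sum>e\<le>d. \<Sum>ks | wt ks = e. \<epsilon> ^ wt ks * taylor_term a x ks)"
      unfolding low by (rule sum.UNION_disjoint) (use finw in auto)
    also have "\<dots> = (\<Sum>e\<le>d. \<epsilon> ^ e * taylor_homogeneous_part w (int e) a x)"
      by (auto simp: taylor_homogeneous_part_def taylor_term_def monomial_at_def wt_def sum_distrib_left intro!: sum.cong)
    finally have split: "(\<Sum>ks | length ks < Suc d. taylor_term a ?y ks) -
        (\<Sum>e\<le>d. \<epsilon> ^ e * taylor_homogeneous_part w (int e) a x) =
        (\<Sum>ks\<in>{ks. length ks < Suc d} - {ks. wt ks \<le> d}. \<epsilon> ^ wt ks * taylor_term a x ks)" by simp
    have "\<bar>\<Sum>ks\<in>{ks. length ks < Suc d} - {ks. wt ks \<le> d}. \<epsilon> ^ wt ks * taylor_term a x ks\<bar> \<le>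
        (\<Sum>ks\<in>{ks. length ks < Suc d} - {ks. wt ks \<le> d}. \<epsilon> ^ Suc d * (\<bar>iterated_partial ks a 0\<bar> * R ^ length ks))"
    proof (rule order_trans[OF sum_abs sum_mono])
      fix ks :: "'n list" assume ks: "ks \<in> {ks. length ks < Suc d} - {ks. wt ks \<le> d}"
      then have "\<epsilon> ^ wt ks \<le> \<epsilon> ^ Suc d" using \<epsilon>(1) \<epsilon>1 by (intro power_decreasing) auto
      moreover have "\<bar>taylor_term a x ks\<bar> \<le> \<bar>iterated_partial ks a 0\<bar> * R ^ length ks"
      proof -
        have "\<bar>iterated_partial ks a 0 / fact (length ks)\<bar> \<le> \<bar>iterated_partial ks a 0\<bar>"
          using fact_ge_1[of "length ks", where 'a=real] by (simp add: divide_le_eq mult_le_cancel_left1)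
        then show ?thesis unfolding taylor_term_def abs_mult
          using monomial_bound[OF x, of ks] by (intro mult_mono) auto
      qed
      ultimately show "\<bar>\<epsilon> ^ wt ks * taylor_term a x ks\<bar> \<le> \<epsilon> ^ Suc d * (\<bar>iterated_partial ks a 0\<bar> * R ^ length ks)"
        unfolding abs_mult using \<epsilon>(1) by (intro mult_mono) auto
    qed
    also have "\<dots> \<le> (\<Sum>ks | length ks < Suc d. \<epsilon> ^ Suc d * (\<bar>iterated_partial ks a 0\<bar> * R ^ length ks))"
      by (rule sum_mono2[OF fin]) (use \<epsilon> R in auto)
    also have "\<dots> = D * \<epsilon> ^ Suc d" by (simp add: D_def sum_distrib_left mult.commute)
    finally have 1: "\<bar>(\<Sum>ks | length ks < Suc d. taylor_term a ?y ks) -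
        (\<Sum>e\<le>d. \<epsilon> ^ e * taylor_homogeneous_part w (int e) a x)\<bar> \<le> D * \<epsilon> ^ Suc d" unfolding split .
    have "\<bar>a ?y - (\<Sum>ks | length ks < Suc d. taylor_term a ?y ks)\<bar> \<le> C * norm ?y ^ Suc d"
      by (rule C(2)[OF yr])
    also have "\<dots> \<le> C * (\<epsilon> * R) ^ Suc d" using C(1) y by (intro mult_left_mono power_mono) auto
    also have "\<dots> = C * R ^ Suc d * \<epsilon> ^ Suc d" by (simp add: power_mult_distrib)
    finally have 2: "\<bar>a ?y - (\<Sum>ks | length ks < Suc d. taylor_term a ?y ks)\<bar> \<le> C * R ^ Suc d * \<epsilon> ^ Suc d" .
    show ?thesis using 1 2 by (simp add: distrib_right del: power_Suc)
  qed
  have "C * R ^ Suc d + D \<ge> 0" using C(1) R Phi_dom by simp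
  then show thesis using main by (rule that[OF _ \<epsilon>0])
qed

lemma small_polynomial:
  fixes c :: "nat \<Rightarrow> real"
  assumes "\<forall>\<^sub>F \<epsilon> in at_right 0. \<bar>\<Sum>e\<le>d. \<epsilon> ^ e * c e\<bar> \<le> K * \<epsilon> ^ d" and "e < d"
  shows "c e = 0"
  using assms(2)
proof (induction e rule: less_induct)
  case (less e)
  have "\<forall>\<^sub>F \<epsilon> in at_right 0. \<bar>\<Sum>i\<in>{e..d}. \<epsilon> ^ (i - e) * c i\<bar> \<le> K * \<epsilon> ^ (d - e)"
    using assms(1) eventually_at_right_less
  proof eventually_elim
    case (elim \<epsilon>)
    have "(\<Sum>i\<le>d. \<epsilon> ^ i * c i) = (\<Sum>i\<in>{e..d}. \<epsilon> ^ i * c i)"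
      by (rule sum.mono_neutral_right) (use less in auto)
    also have "\<dots> = (\<Sum>i\<in>{e..d}. \<epsilon> ^ e * (\<epsilon> ^ (i - e) * c i))"
      by (rule sum.cong) (auto simp flip: power_add mult.assoc)
    also have "\<dots> = \<epsilon> ^ e * (\<Sum>i\<in>{e..d}. \<epsilon> ^ (i - e) * c i)" by (simp add: sum_distrib_left)
    finally have "\<epsilon> ^ e * \<bar>\<Sum>i\<in>{e..d}. \<epsilon> ^ (i - e) * c i\<bar> \<le> K * \<epsilon> ^ d"
      using elim by (simp add: abs_mult)
    also have "K * \<epsilon> ^ d = \<epsilon> ^ e * (K * \<epsilon> ^ (d - e))"
      using less(2) by (simp flip: power_add)
    finally show ?case using elim(2) by simp
  qed
  moreover have "((\<lambda>\<epsilon>. \<bar>\<Sum>i\<in>{e..d}. \<epsilon> ^ (i - e) * c i\<bar>) \<longlongrightarrow> \<bar>\<Sum>i\<in>{e..d}. 0 ^ (i - e) * c i\<bar>) (at_right 0)"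
    by (intro tendsto_intros)
  moreover have "((\<lambda>\<epsilon>. K * \<epsilon> ^ (d - e)) \<longlongrightarrow> K * 0 ^ (d - e)) (at_right 0)"
    by (intro tendsto_intros)
  ultimately have "\<bar>\<Sum>i\<in>{e..d}. 0 ^ (i - e) * c i\<bar> \<le> K * 0 ^ (d - e)"
    using tendsto_le[OF trivial_limit_at_right_real] by blast
  moreover have "(\<Sum>i\<in>{e..d}. 0 ^ (i - e) * c i) = (\<Sum>i\<in>{e..d}. if i = e then c i else 0)"
    by (rule sum.cong) auto
  moreover have "(\<Sum>i\<in>{e..d}. if i = e then c i else 0) = c e" using less(2) by simp
  ultimately show ?case using less(2) by (simp add: power_0_left)
qed

text \<open>Along a dilation path the weighted expansion is a polynomial in \<epsilon>, and the bound
  forces its coefficients below degree \<open>d\<close> to vanish near the origin, hence everywhere by homogeneity.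
  What remains of the quotient is the homogeneous part of degree \<open>d\<close> and an error of order \<epsilon>,
  uniformly on bounded sets of any size.\<close>

lemma bounded_rescaling_limit:
  fixes a :: "real ^ 'n::finite \<Rightarrow> real"
  assumes w: "\<And>k. 0 < w k" and a: "smooth_on S a" and S: "open S" "0 \<in> S" and R: "R > 0"
    and \<rho>: "\<rho> > 0" and bnd: "\<And>\<epsilon> x. 0 < \<epsilon> \<Longrightarrow> \<epsilon> < 1 \<Longrightarrow> norm x < \<rho> \<Longrightarrow> \<bar>a (dilation w \<epsilon> x)\<bar> \<le> K * \<epsilon> ^ d"
  shows "uniform_limit (cball 0 R) (\<lambda>\<epsilon> x. a (dilation w \<epsilon> x) / \<epsilon> ^ d)
    (taylor_homogeneous_part w (int d) a) (at_right 0)"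
proof -
  let ?T = "\<lambda>e x. taylor_homogeneous_part w (int e) a x"
  have van0: "?T e x = 0" if "e < d" "norm x < \<rho>" for e x
  proof -
    obtain C \<epsilon>0 where C: "C \<ge> 0" "\<epsilon>0 > 0" "\<And>\<epsilon> x. 0 < \<epsilon> \<Longrightarrow> \<epsilon> < \<epsilon>0 \<Longrightarrow> norm x \<le> \<rho> \<Longrightarrow>
       \<bar>a (dilation w \<epsilon> x) - (\<Sum>e\<le>d. \<epsilon> ^ e * ?T e x)\<bar> \<le> C * \<epsilon> ^ Suc d"
      by (rule weighted_taylor[where w=w and d=d, OF w a S \<rho>]) blast
    have "\<forall>\<^sub>F \<epsilon> in at_right 0. \<bar>\<Sum>e\<le>d. \<epsilon> ^ e * ?T e x\<bar> \<le> (K + C) * \<epsilon> ^ d"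
      using eventually_at_right_less eventually_at_right_real[OF C(2)] eventually_at_right_real[of 0 1, simplified]
    proof eventually_elim
      case (elim \<epsilon>)
      then have \<epsilon>: "0 < \<epsilon>" "\<epsilon> < 1" "\<epsilon> < \<epsilon>0" by auto
      have "\<bar>\<Sum>e\<le>d. \<epsilon> ^ e * ?T e x\<bar> \<le> K * \<epsilon> ^ d + C * \<epsilon> ^ Suc d"
        using C(3)[of \<epsilon> x] bnd[of \<epsilon> x] \<epsilon> that by (simp del: power_Suc)
      also have "C * \<epsilon> ^ Suc d \<le> C * \<epsilon> ^ d"
        using C(1) \<epsilon> by (intro mult_left_mono power_decreasing) auto
      finally show ?case by (simp add: distrib_right)
    qed
    then show ?thesis using small_polynomial[where d=d and c="\<lambda>e. ?T e x"] that by blast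
  qed
  have van: "?T e x = 0" if "e < d" for e x
  proof -
    define r where "r = min 1 (\<rho> / (2 * (norm x + 1)))"
    have r: "0 < r" "r \<le> 1" using \<rho> by (auto simp: r_def intro!: divide_pos_pos add_nonneg_pos)
    have "norm (dilation w r x) \<le> r * norm x" using norm_dilation_le_linear[of r w x] w r by simp
    also have "\<dots> \<le> \<rho> / (2 * (norm x + 1)) * norm x" by (intro mult_right_mono) (auto simp: r_def)
    also have "\<dots> < \<rho>" using \<rho> by (simp add: divide_less_eq add_nonneg_pos algebra_simps add_pos_nonneg)
    finally have "?T e (dilation w r x) = 0" by (rule van0[OF that])
    then show ?thesis using r by (simp add: homogeneous_part_dilation)
  qed
  obtain C \<epsilon>0 where C: "C \<ge> 0" "\<epsilon>0 > 0" "\<And>\<epsilon> x. 0 < \<epsilon> \<Longrightarrow> \<epsilon> < \<epsilon>0 \<Longrightarrow> norm x \<le> R \<Longrightarrow>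
       \<bar>a (dilation w \<epsilon> x) - (\<Sum>e\<le>d. \<epsilon> ^ e * ?T e x)\<bar> \<le> C * \<epsilon> ^ Suc d"
    by (rule weighted_taylor[where w=w and d=d, OF w a S R]) blast
  have est: "\<bar>a (dilation w \<epsilon> x) / \<epsilon> ^ d - ?T d x\<bar> \<le> C * \<epsilon>" if "0 < \<epsilon>" "\<epsilon> < \<epsilon>0" "norm x \<le> R" for \<epsilon> x
  proof -
    have "(\<Sum>e\<le>d. \<epsilon> ^ e * ?T e x) = (\<Sum>e\<le>d. if e = d then \<epsilon> ^ e * ?T e x else 0)"
      by (rule sum.cong) (use van in auto)
    then have "(\<Sum>e\<le>d. \<epsilon> ^ e * ?T e x) = \<epsilon> ^ d * ?T d x" by simp
    then have "\<bar>a (dilation w \<epsilon> x) - \<epsilon> ^ d * ?T d x\<bar> \<le> \<epsilon> ^ d * (C * \<epsilon>)"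
      using C(3)[of \<epsilon> x] that by (simp add: mult_ac)
    moreover have "a (dilation w \<epsilon> x) - \<epsilon> ^ d * ?T d x = \<epsilon> ^ d * (a (dilation w \<epsilon> x) / \<epsilon> ^ d - ?T d x)"
      using that by (simp add: field_simps)
    ultimately have "\<epsilon> ^ d * \<bar>a (dilation w \<epsilon> x) / \<epsilon> ^ d - ?T d x\<bar> \<le> \<epsilon> ^ d * (C * \<epsilon>)"
      using that by (simp add: abs_mult)
    then show ?thesis using that by simp
  qed
  show ?thesis
    unfolding uniform_limit_iff
  proof (intro allI impI)
    fix e :: real assume e: "e > 0"
    have "min \<epsilon>0 (e / (C + 1)) > 0" using C e by simp
    from eventually_at_right_real[OF this]
    show "\<forall>\<^sub>F \<epsilon> in at_right 0. \<forall>x\<in>cball 0 R. dist (a (dilation w \<epsilon> x) / \<epsilon> ^ d) (?T d x) < e"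
    proof eventually_elim
      case (elim \<epsilon>)
      then have \<epsilon>: "0 < \<epsilon>" "\<epsilon> < \<epsilon>0" "\<epsilon> * (C + 1) < e" using C(1) by (auto simp: pos_less_divide_eq)
      then have "C * \<epsilon> < e" by (simp add: algebra_simps)
      then show ?case using est[OF \<epsilon>(1,2)] by (force simp: dist_real_def)
    qed
  qed
qed

text \<open>The form needed for the components of vector fields. When the total power of \<epsilon> is
  positive, both the limit and the homogeneous part of negative degree are zero.\<close>

lemma rescaled_component_limit:
  fixes a :: "real ^ 'n::finite \<Rightarrow> real"
  assumes w: "\<And>k. 0 < w k" and a: "smooth_on S a" and S: "open S" "0 \<in> S" and R: "R > 0"
    and \<rho>: "\<rho> > 0"
    and bnd: "\<And>\<epsilon> x. 0 < \<epsilon> \<Longrightarrow> \<epsilon> < 1 \<Longrightarrow> norm x < \<rho> \<Longrightarrow> \<bar>\<epsilon> ^ m * ((1 / \<epsilon>) ^ l * a (dilation w \<epsilon> x))\<bar> \<le> K"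
  shows "uniform_limit (cball 0 R) (\<lambda>\<epsilon> x. \<epsilon> ^ m * ((1 / \<epsilon>) ^ l * a (dilation w \<epsilon> x)))
    (taylor_homogeneous_part w (int l - int m) a) (at_right 0)"
proof (cases "m \<le> l")
  case True
  define d where "d = l - m"
  have wd: "l = m + d" using True by (simp add: d_def)
  have eq: "\<epsilon> ^ m * ((1 / \<epsilon>) ^ l * z) = z / \<epsilon> ^ d" if "\<epsilon> > 0" for \<epsilon> z :: real
    using that by (simp add: wd power_one_over power_add field_simps)
  have "uniform_limit (cball 0 R) (\<lambda>\<epsilon> x. a (dilation w \<epsilon> x) / \<epsilon> ^ d) (taylor_homogeneous_part w (int d) a) (at_right 0)"
  proof (rule bounded_rescaling_limit[where w=w, OF w a S R \<rho>])
    fix \<epsilon> :: real and x :: "real ^ 'n" assume A: "0 < \<epsilon>" "\<epsilon> < 1" "norm x < \<rho>"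
    have "\<bar>a (dilation w \<epsilon> x)\<bar> / \<epsilon> ^ d \<le> K" using bnd[OF A] unfolding eq[OF A(1)] using A(1) by simp
    then show "\<bar>a (dilation w \<epsilon> x)\<bar> \<le> K * \<epsilon> ^ d" using A(1) by (simp add: divide_le_eq)
  qed
  moreover have "\<forall>\<^sub>F \<epsilon> in at_right 0. \<forall>x\<in>cball 0 R.
      a (dilation w \<epsilon> x) / \<epsilon> ^ d = \<epsilon> ^ m * ((1 / \<epsilon>) ^ l * a (dilation w \<epsilon> x))"
    using eventually_at_right_less by eventually_elim (simp only: eq, simp)
  ultimately have "uniform_limit (cball 0 R) (\<lambda>\<epsilon> x. \<epsilon> ^ m * ((1 / \<epsilon>) ^ l * a (dilation w \<epsilon> x)))
      (taylor_homogeneous_part w (int d) a) (at_right 0)"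
    by (simp cong: uniform_limit_cong)
  moreover have "int d = int l - int m" using wd by simp
  ultimately show ?thesis by (simp only:)
next
  case False
  define d where "d = m - l"
  have wd: "m = l + d" "d > 0" using False by (auto simp: d_def)
  have eq: "\<epsilon> ^ m * ((1 / \<epsilon>) ^ l * z) = \<epsilon> ^ d * z" if "\<epsilon> > 0" for \<epsilon> z :: real
    using that by (simp add: wd power_one_over power_add field_simps)
  have hat: "taylor_homogeneous_part w (int l - int m) a x = 0" for x
  proof -
    have "{ks. int (sum_list (map w ks)) = int l - int m} = {}" using wd by auto
    then show ?thesis by (simp add: taylor_homogeneous_part_def)
  qed
  obtain r where r: "r > 0" "cball 0 r \<subseteq> S" using S open_contains_cball by blast
  have "continuous_on (cball 0 r) a"
    using smooth_on_imp_continuous_on[OF a] r(2) continuous_on_subset by blast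
  then have "bounded (a ` cball 0 r)"
    using compact_continuous_image compact_imp_bounded compact_cball by blast
  then obtain B where B': "B > 0" "\<forall>z\<in>a ` cball 0 r. norm z \<le> B"
    unfolding bounded_pos by blast
  then have B: "\<And>y. y \<in> cball 0 r \<Longrightarrow> \<bar>a y\<bar> \<le> B" "B > 0" by auto
  show ?thesis
    unfolding uniform_limit_iff
  proof (intro allI impI)
    fix e :: real assume e: "e > 0"
    have "min (min 1 (r / R)) (e / B) > 0" using r R e B by simp
    from eventually_at_right_real[OF this]
    show "\<forall>\<^sub>F \<epsilon> in at_right 0. \<forall>x\<in>cball 0 R.
      dist (\<epsilon> ^ m * ((1 / \<epsilon>) ^ l * a (dilation w \<epsilon> x))) (taylor_homogeneous_part w (int l - int m) a x) < e"
    proof eventually_elim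
      case (elim \<epsilon>)
      then have \<epsilon>: "0 < \<epsilon>" "\<epsilon> < 1" "\<epsilon> * R < r" "\<epsilon> * B < e" using R B(2) by (auto simp: pos_less_divide_eq)
      show ?case
      proof
        fix x :: "real ^ 'n" assume x: "x \<in> cball 0 R"
        have "norm (dilation w \<epsilon> x) \<le> \<epsilon> * R"
          by (rule order_trans[OF norm_dilation_le_linear mult_left_mono]) (use w \<epsilon> x in auto)
        then have "\<bar>a (dilation w \<epsilon> x)\<bar> \<le> B" using B(1) \<epsilon> by simp
        moreover have "\<epsilon> ^ d \<le> \<epsilon> ^ 1" using wd(2) \<epsilon> by (intro power_decreasing) auto
        ultimately have "\<bar>\<epsilon> ^ d * a (dilation w \<epsilon> x)\<bar> \<le> \<epsilon> * B"
          unfolding abs_mult using \<epsilon> B(2) by (intro mult_mono) auto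
        then show "dist (\<epsilon> ^ m * ((1 / \<epsilon>) ^ l * a (dilation w \<epsilon> x)))
            (taylor_homogeneous_part w (int l - int m) a x) < e"
          unfolding eq[OF \<epsilon>(1)] hat using \<epsilon> by (simp add: dist_real_def)
      qed
    qed
  qed
qed

lemma uniform_limit_componentwise:
  fixes f :: "real \<Rightarrow> 'x \<Rightarrow> real ^ 'n::finite"
  assumes "\<And>j. uniform_limit B (\<lambda>\<epsilon> x. f \<epsilon> x $ j) (\<lambda>x. l x $ j) G"
  shows "uniform_limit B f l G"
  unfolding uniform_limit_iff
proof (intro allI impI)
  fix e :: real assume e: "e > 0"
  let ?e = "e / real CARD('n)"
  have "?e > 0" using e by simp
  then have "\<forall>\<^sub>F \<epsilon> in G. \<forall>j\<in>UNIV. \<forall>x\<in>B. dist (f \<epsilon> x $ j) (l x $ j) < ?e"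
    using assms by (intro eventually_ball_finite) (auto simp: uniform_limit_iff)
  then show "\<forall>\<^sub>F \<epsilon> in G. \<forall>x\<in>B. dist (f \<epsilon> x) (l x) < e"
  proof eventually_elim
    case (elim \<epsilon>)
    show ?case
    proof
      fix x assume x: "x \<in> B"
      have "norm (f \<epsilon> x - l x) \<le> (\<Sum>j\<in>UNIV. \<bar>(f \<epsilon> x - l x) $ j\<bar>)" by (rule norm_le_l1_cart)
      also have "\<dots> < (\<Sum>j\<in>(UNIV::'n set). ?e)"
        by (rule sum_strict_mono) (use elim x in \<open>auto simp: dist_real_def\<close>)
      also have "\<dots> = e" by simp
      finally show "dist (f \<epsilon> x) (l x) < e" by (simp add: dist_norm)
    qed
  qed
qed

context exponential_frame
begin

definition Xhat :: "'n \<Rightarrow> (real, 'n) vec \<Rightarrow> (real, 'n) vec" where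
  "Xhat = nilpotent_approximation (atlas S) w V F X"

lemma Xe_nth: "Xe \<epsilon> i x $ j = \<epsilon> ^ w i * ((1 / \<epsilon>) ^ w j * Xt i (dilation w \<epsilon> x) $ j)"
  by (simp add: Xe_def rescaled_def dilation_nth)

lemma Xe_limit:
  assumes R: "R > 0"
  shows "uniform_limit (cball 0 R) (\<lambda>\<epsilon>. Xe \<epsilon> i) (Xhat i) (at_right 0)"
proof (rule uniform_limit_componentwise)
  fix j
  obtain \<rho> K where \<rho>: "\<rho> > 0" "K > 0" "ball 0 \<rho> \<subseteq> V"
    "\<And>\<epsilon> k x. 0 < \<epsilon> \<Longrightarrow> \<epsilon> \<le> 1 \<Longrightarrow> norm x < \<rho> \<Longrightarrow> norm (Xe \<epsilon> k x - axis k 1) \<le> K * norm x"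
    using Xe_estimate by blast
  have bnd: "\<bar>Xe \<epsilon> i x $ j\<bar> \<le> 1 + K * \<rho>" if "0 < \<epsilon>" "\<epsilon> < 1" "norm x < \<rho>" for \<epsilon> x
  proof -
    have "\<bar>Xe \<epsilon> i x $ j\<bar> \<le> norm (Xe \<epsilon> i x)" by (rule component_le_norm_cart)
    also have "\<dots> \<le> norm (axis i 1 :: (real, 'n) vec) + norm (Xe \<epsilon> i x - axis i 1)"
      using norm_triangle_ineq[of "axis i 1" "Xe \<epsilon> i x - axis i 1"] by simp
    also have "\<dots> \<le> 1 + K * norm x" using \<rho>(4)[of \<epsilon> x i] that by (simp add: norm_axis_1)
    also have "\<dots> \<le> 1 + K * \<rho>" using that \<rho>(2) by simp
    finally show ?thesis .
  qed
  have "uniform_limit (cball 0 R) (\<lambda>\<epsilon> x. \<epsilon> ^ w i * ((1 / \<epsilon>) ^ w j * Xt i (dilation w \<epsilon> x) $ j))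
      (taylor_homogeneous_part w (int (w j) - int (w i)) (\<lambda>y. Xt i y $ j)) (at_right 0)"
    by (rule rescaled_component_limit[where w=w, OF w_pos smooth_on_vec_nth[OF open_V Xt_smooth] open_V zero_V R \<rho>(1)])
      (rule bnd[unfolded Xe_nth])
  then show "uniform_limit (cball 0 R) (\<lambda>\<epsilon> x. Xe \<epsilon> i x $ j) (\<lambda>x. Xhat i x $ j) (at_right 0)"
    by (simp add: Xe_nth Xhat_def nilpotent_approximation_def)
qed

end

section \<open>Comparing two frames\<close>

lemma frame_coef_bound:
  fixes E :: "'n::finite \<Rightarrow> real ^ 'n"
  assumes h: "h = (\<Sum>j\<in>UNIV. a $ j *\<^sub>R E j)" and E: "\<And>j. norm (E j - axis j 1) \<le> b"
    and b: "real CARD('n) * b \<le> 1 / 2"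
  shows "norm a \<le> 2 * norm h"
proof -
  have "h = a + (\<Sum>j\<in>UNIV. a $ j *\<^sub>R (E j - axis j 1))"
    by (simp add: h scaleR_diff_right sum_subtractf axis_combination)
  then have "norm a \<le> norm h + norm (\<Sum>j\<in>UNIV. a $ j *\<^sub>R (E j - axis j 1))"
    using norm_triangle_ineq4[of h "\<Sum>j\<in>UNIV. a $ j *\<^sub>R (E j - axis j 1)"] by simp
  moreover have "norm (\<Sum>j\<in>UNIV. a $ j *\<^sub>R (E j - axis j 1)) \<le> real CARD('n) * (norm a * b)"
    by (rule norm_sum_scaleR_bound) (use E component_le_norm_cart in auto)
  moreover have "real CARD('n) * (norm a * b) \<le> norm a / 2"
    using mult_left_mono[OF b norm_ge_zero[of a]] by (simp add: mult_ac)
  ultimately show ?thesis by linarith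
qed

lemma (in exponential_frame) F_zero: "F 0 = p"
proof -
  obtain \<gamma> where \<gamma>: "integral_curve W (\<lambda>q. \<Sum>i\<in>UNIV. ((0::(real,'n) vec) $ i) *\<^sub>R X i q) \<gamma>" "\<gamma> 0 = p" "\<gamma> 1 = F 0"
    by (rule exp_curve[OF zero_V])
  have "F (0 *\<^sub>R 0) = \<gamma> 0" by (rule exp_ray[OF zero_V \<gamma>(1,2)]) (use zero_V in auto)
  then show ?thesis using \<gamma> by simp
qed

lemma (in exponential_frame) Xe_euler:
  assumes R: "ball 0 R \<subseteq> V" and x: "norm x < R" and \<epsilon>: "0 < \<epsilon>" "\<epsilon> \<le> 1"
  shows "(\<Sum>i\<in>UNIV. x $ i *\<^sub>R Xe \<epsilon> i x) = x"
proof -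
  let ?y = "dilation w \<epsilon> x"
  have y: "?y \<in> ball 0 R" using norm_dilation_le[of \<epsilon> w x] \<epsilon> x by simp
  note l = linear_dilation[of w "1 / \<epsilon>"]
  have "x = dilation w (1 / \<epsilon>) ?y" using \<epsilon> by (simp add: dilation_inverse)
  also have "\<dots> = dilation w (1 / \<epsilon>) (\<Sum>i\<in>UNIV. ?y $ i *\<^sub>R Xt i ?y)" by (simp only: euler_ball[OF R y])
  also have "\<dots> = (\<Sum>i\<in>UNIV. ?y $ i *\<^sub>R dilation w (1 / \<epsilon>) (Xt i ?y))"
    by (simp only: linear_sum[OF l] linear_scale[OF l])
  also have "\<dots> = (\<Sum>i\<in>UNIV. x $ i *\<^sub>R Xe \<epsilon> i x)"
    by (simp add: Xe_def rescaled_def dilation_nth mult.commute)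
  finally show ?thesis by simp
qed

lemma (in exponential_frame) Xe_expand:
  assumes "dilation w \<epsilon> x \<in> V" and \<epsilon>: "0 < \<epsilon>"
  obtains a where "h = (\<Sum>j\<in>UNIV. a $ j *\<^sub>R Xe \<epsilon> j x)"
proof -
  let ?y = "dilation w \<epsilon> x"
  note l = linear_dilation[of w "1 / \<epsilon>"]
  define b where "b = frame_coef (\<lambda>l. Xt l ?y) (dilation w \<epsilon> h)"
  have "h = dilation w (1 / \<epsilon>) (dilation w \<epsilon> h)" using \<epsilon> by (simp add: dilation_inverse)
  also have "\<dots> = dilation w (1 / \<epsilon>) (\<Sum>j\<in>UNIV. b $ j *\<^sub>R Xt j ?y)"
    by (simp only: b_def frame_coef_expand[OF Xt_det[OF assms(1)]])
  also have "\<dots> = (\<Sum>j\<in>UNIV. b $ j *\<^sub>R dilation w (1 / \<epsilon>) (Xt j ?y))"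
    by (simp only: linear_sum[OF l] linear_scale[OF l])
  also have "\<dots> = (\<Sum>j\<in>UNIV. (\<chi> j. b $ j / \<epsilon> ^ w j) $ j *\<^sub>R Xe \<epsilon> j x)"
    using \<epsilon> by (simp add: Xe_def rescaled_def)
  finally show ?thesis by (rule that)
qed

text \<open>Two exponential frames over the same neighborhood, orthonormal for one field of scalar products.
  The continuity of the transition matrix is inherited from the frames.\<close>

locale two_frames =
  X: exponential_frame S V F W s nn X p + Y: exponential_frame S V F' W s nn Y p
  for S :: "('a::{t2_space,second_countable_topology}, 'n::{finite,linorder}, 'e::euclidean_space) sr_structure"
    and V F F' W s nn and X Y :: "'n \<Rightarrow> 'a \<Rightarrow> (real, 'n) vec" and p +
  fixes g :: "'a \<Rightarrow> (real, 'n) vec \<Rightarrow> (real, 'n) vec \<Rightarrow> real"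
  assumes scalar: "\<And>q. scalar_product (g q)"
    and orthonormal_X: "\<And>q i j. q \<in> W \<Longrightarrow> g q (X i q) (X j q) = (if i = j then 1 else 0)"
    and orthonormal_Y: "\<And>q i j. q \<in> W \<Longrightarrow> g q (Y i q) (Y j q) = (if i = j then 1 else 0)"
begin

abbreviation w :: "'n \<Rightarrow> nat" where "w \<equiv> weight s nn"

text \<open>The transition matrix: column \<open>j\<close> holds the coefficients of \<open>X j\<close> in the frame \<open>Y\<close>.\<close>

definition c :: "'a \<Rightarrow> 'n \<Rightarrow> 'n \<Rightarrow> real" where "c q i j = g q (X j q) (Y i q)"

lemma g_sum: "g q (\<Sum>i\<in>UNIV. a i *\<^sub>R u i) v = (\<Sum>i\<in>UNIV. a i * g q (u i) v)"
  for a :: "'n \<Rightarrow> real"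
proof -
  have l: "linear (\<lambda>u. g q u v)" using scalar[of q] by (simp add: scalar_product_def bilinear_def)
  show ?thesis by (simp add: linear_sum[OF l] linear_scale[OF l])
qed

lemma g_sym: "g q u v = g q v u"
  using scalar[of q] unfolding scalar_product_def by blast

lemma orthonormal_coef:
  fixes E :: "'n \<Rightarrow> (real, 'n) vec"
  assumes "\<And>i j. g q (E i) (E j) = (if i = j then 1 else 0)" "frame_det E \<noteq> 0"
  shows "frame_coef E v $ k = g q v (E k)"
proof -
  have "g q v (E k) = g q (\<Sum>i\<in>UNIV. frame_coef E v $ i *\<^sub>R E i) (E k)"
    by (simp add: frame_coef_expand[OF assms(2)])
  also have "\<dots> = frame_coef E v $ k"
    unfolding g_sum assms(1) by (simp add: if_distrib cong: if_cong)
  finally show ?thesis by simp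
qed

lemma frame_dets:
  assumes "q \<in> W" shows "frame_det (\<lambda>i. X i q) \<noteq> 0" "frame_det (\<lambda>i. Y i q) \<noteq> 0"
  using X.frame Y.frame assms
  by (auto simp: privileged_frame_def basis_family_def intro!: frame_det_nonzero)

lemma X_coef: "q \<in> W \<Longrightarrow> frame_coef (\<lambda>i. Y i q) (X j q) $ i = c q i j"
  using orthonormal_coef[of q "\<lambda>i. Y i q"] orthonormal_Y frame_dets by (simp add: c_def)

lemma Y_coef: "q \<in> W \<Longrightarrow> frame_coef (\<lambda>j. X j q) (Y i q) $ j = c q i j"
  using orthonormal_coef[of q "\<lambda>i. X i q"] orthonormal_X frame_dets g_sym[of q "X j q" "Y i q"]
  by (simp add: c_def)

lemma X_expand: "q \<in> W \<Longrightarrow> X j q = (\<Sum>i\<in>UNIV. c q i j *\<^sub>R Y i q)"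
  using frame_coef_expand[OF frame_dets(2), of q "X j q"] by (simp add: X_coef)

lemma Y_expand: "q \<in> W \<Longrightarrow> Y i q = (\<Sum>j\<in>UNIV. c q i j *\<^sub>R X j q)"
  using frame_coef_expand[OF frame_dets(1), of q "Y i q"] by (simp add: Y_coef)

lemma c_columns: "q \<in> W \<Longrightarrow> (\<Sum>i\<in>UNIV. c q i j * c q i k) = (if j = k then 1 else 0)"
proof -
  assume q: "q \<in> W"
  have "g q (X j q) (X k q) = g q (\<Sum>i\<in>UNIV. c q i j *\<^sub>R Y i q) (X k q)" using X_expand[OF q] by simp
  also have "\<dots> = (\<Sum>i\<in>UNIV. c q i j * c q i k)"
    unfolding g_sum by (simp add: c_def g_sym[of q _ "X k q"])
  finally show ?thesis using orthonormal_X[OF q] by simp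
qed

lemma c_rows: "q \<in> W \<Longrightarrow> (\<Sum>j\<in>UNIV. c q i j * c q k j) = (if i = k then 1 else 0)"
proof -
  assume q: "q \<in> W"
  have "g q (Y i q) (Y k q) = g q (\<Sum>j\<in>UNIV. c q i j *\<^sub>R X j q) (Y k q)" using Y_expand[OF q] by simp
  also have "\<dots> = (\<Sum>j\<in>UNIV. c q i j * c q k j)"
    unfolding g_sum by (simp add: c_def)
  finally show ?thesis using orthonormal_Y[OF q] by simp
qed

text \<open>Both frames are adapted to the same flag, so the transition matrix is block triangular in
  either direction.\<close>

lemma c_block:
  assumes q: "q \<in> W" and ne: "w i \<noteq> w j" shows "c q i j = 0"
proof (cases "w j < w i")
  case True
  have set: "{l. pos l \<le> nn (w j)} = {l. w l \<le> w j}" using X.weights(4)[OF X.weights(1)] by auto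
  have "X j q \<in> span ((\<lambda>i. X i q) ` {i. pos i \<le> nn (w j)})"
    using X.weights(3)[of j] by (auto intro!: span_base)
  also have "\<dots> = span ((\<lambda>i. Y i q) ` {i. w i \<le> w j})"
    using X.flag_basis[OF q X.weights(1)] Y.flag_basis[OF q X.weights(1)] set by metis
  finally show ?thesis
    using span_frame_iff[OF frame_dets(2)[OF q]] True X_coef[OF q] by (auto simp: not_le)
next
  case False
  have set: "{l. pos l \<le> nn (w i)} = {l. w l \<le> w i}" using X.weights(4)[OF X.weights(1)] by auto
  have "Y i q \<in> span ((\<lambda>i. Y i q) ` {l. pos l \<le> nn (w i)})"
    using X.weights(3)[of i] by (auto intro!: span_base)
  also have "\<dots> = span ((\<lambda>i. X i q) ` {l. w l \<le> w i})"
    using X.flag_basis[OF q X.weights(1)] Y.flag_basis[OF q X.weights(1)] set by metis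
  finally show ?thesis
    using span_frame_iff[OF frame_dets(1)[OF q]] False ne Y_coef[OF q] by (auto simp: not_le)
qed

definition Cm :: "'a \<Rightarrow> ((real, 'n) vec, 'n) vec" where "Cm q = (\<chi> i j. c q i j)"

lemma Cm_nth: "(Cm q *v v) $ i = (\<Sum>j\<in>UNIV. c q i j * v $ j)"
  by (simp add: Cm_def matrix_vector_mult_def)

lemma Cm_orthogonal: "q \<in> W \<Longrightarrow> orthogonal_transformation ((*v) (Cm q))"
  unfolding orthogonal_transformation_matrix orthogonal_matrix
  by (auto simp: Cm_def matrix_matrix_mult_def transpose_def mat_def vec_eq_iff c_columns)

lemma Cm_norm: "q \<in> W \<Longrightarrow> norm (Cm q *v v) = norm v"
  using Cm_orthogonal orthogonal_transformation_norm by blast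

text \<open>It turns the coefficients of a tangent vector at \<open>p\<close> in the frame \<open>X\<close> into those in the frame \<open>Y\<close>,
  and commutes with the dilations because the transition matrix is block diagonal.\<close>

definition L :: "(real, 'n) vec \<Rightarrow> (real, 'n) vec" where "L = (*v) (Cm p)"

lemma p_W: "p \<in> W" using X.F_in_W[OF X.zero_V] X.F_zero by simp

lemma L_orthogonal: "orthogonal_transformation L"
  unfolding L_def by (rule Cm_orthogonal[OF p_W])

lemma L_linear: "linear L" by (simp add: L_def)

lemma L_nth: "L v $ i = (\<Sum>j\<in>UNIV. c p i j * v $ j)" by (simp add: L_def Cm_nth)

lemma L_norm: "norm (L v) = norm v" using Cm_norm[OF p_W] by (simp add: L_def)

lemma L_dilation: "L (dilation w r v) = dilation w r (L v)"
proof (rule vec_eq_iff[THEN iffD2], rule allI)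
  fix i
  have "c p i j * (r ^ w j * v $ j) = r ^ w i * (c p i j * v $ j)" for j
    using c_block[OF p_W, of i j] by (cases "w i = w j") auto
  then show "L (dilation w r v) $ i = dilation w r (L v) $ i"
    by (simp only: L_nth dilation_nth sum_distrib_left)
qed

lemma L_matrix: "w i \<noteq> w j \<Longrightarrow> matrix L $ i $ j = 0"
  unfolding L_def by (simp add: Cm_def c_block[OF p_W])

subsection \<open>The transition map\<close>

definition Phi :: "(real, 'n) vec \<Rightarrow> (real, 'n) vec" where "Phi x = inv_into V F' (F x)"

definition Phi_dom :: "(real, 'n) vec set" where "Phi_dom = V \<inter> F -` (F' ` V)"

lemma open_Phi_dom: "open Phi_dom" unfolding Phi_dom_def by (rule X.open_preimage[OF Y.open_FV])

lemma Phi_dom_V: "Phi_dom \<subseteq> V" by (auto simp: Phi_dom_def)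

lemma zero_Phi_dom: "0 \<in> Phi_dom"
  using X.zero_V X.F_zero Y.F_zero by (auto simp: Phi_dom_def intro: image_eqI[of _ _ 0])

lemma Phi_V: "x \<in> Phi_dom \<Longrightarrow> Phi x \<in> V" "x \<in> Phi_dom \<Longrightarrow> F' (Phi x) = F x"
  unfolding Phi_dom_def Phi_def by (auto intro: inv_into_into f_inv_into_f)

lemma Phi_zero: "Phi 0 = 0"
  using Y.inv_F[OF X.zero_V] X.F_zero Y.F_zero by (simp add: Phi_def)

lemma Phi_smooth: "smooth_on Phi_dom Phi"
  unfolding Phi_def[abs_def]
  by (rule X.smooth_fun_coordinates[OF open_Phi_dom Phi_dom_V _ Y.open_FV Y.smooth_inv_F]) (auto simp: Phi_dom_def)

lemma Phi_coords_diff: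
  assumes x: "x \<in> Phi_dom"
  shows "frechet_derivative Phi (at x) (X.coords_diff x v) = Y.coords_diff (Phi x) v"
proof -
  define c0 where "c0 = chart_at (atlas S) (F x)"
  have c0: "c0 \<in> atlas S" "F x \<in> fst c0" using X.chart_at by (auto simp: c0_def)
  have xV: "x \<in> V" "F x \<in> F' ` V" using x by (auto simp: Phi_dom_def)
  let ?y = "snd c0 (F x)" and ?N = "snd c0 ` (F ` V \<inter> F' ` V \<inter> fst c0)"
  have N: "open ?N" "?y \<in> ?N"
    using X.open_chart_image[OF c0(1) open_Int[OF X.open_FV Y.open_FV]] xV c0 by auto
  have G: "(X.chart_to_coords c0 has_derivative frechet_derivative (X.chart_to_coords c0) (at ?y)) (at ?y)"
    by (rule smooth_on_has_derivative[OF X.smooth_chart_to_coords[OF c0(1)]]) (use xV c0 in auto)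
  have Gy: "X.chart_to_coords c0 ?y = x" by (rule X.chart_to_coords_chart[OF c0(1) xV(1) c0(2)])
  have "((\<lambda>y. Phi (X.chart_to_coords c0 y)) has_derivative
      (\<lambda>v. frechet_derivative Phi (at x) (frechet_derivative (X.chart_to_coords c0) (at ?y) v))) (at ?y)"
    by (rule has_derivative_compose[OF G]) (use smooth_on_has_derivative[OF Phi_smooth x] Gy in simp)
  then have "(Y.chart_to_coords c0 has_derivative
      (\<lambda>v. frechet_derivative Phi (at x) (frechet_derivative (X.chart_to_coords c0) (at ?y) v))) (at ?y)"
  proof (rule has_derivative_transform_within_open[OF _ N])
    fix y assume "y \<in> ?N"
    then obtain x' where x': "x' \<in> V" "F x' \<in> fst c0" "y = snd c0 (F x')" by auto
    then show "Phi (X.chart_to_coords c0 y) = Y.chart_to_coords c0 y"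
      using X.chart_to_coords_chart[OF c0(1) x'(1,2)] X.chartD(5)[OF c0(1) x'(2)]
      by (simp add: Phi_def Y.chart_to_coords_def)
  qed
  from fun_cong[OF frechet_derivative_at[OF this], of v] show ?thesis
    by (simp add: X.coords_diff_alt Y.coords_diff_alt Phi_V(2)[OF x] flip: c0_def)
qed

lemma Phi_frame:
  assumes x: "x \<in> Phi_dom"
  shows "frechet_derivative Phi (at x) (X.Xt j x) = (\<Sum>i\<in>UNIV. c (F x) i j *\<^sub>R Y.Xt i (Phi x))"
proof -
  have xV: "x \<in> V" using x Phi_dom_V by auto
  note l = Y.coords_diff_linear[OF Phi_V(1)[OF x]]
  have "frechet_derivative Phi (at x) (X.Xt j x) = Y.coords_diff (Phi x) (X j (F x))"
    by (simp add: X.in_coords_lx Phi_coords_diff[OF x])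
  also have "\<dots> = Y.coords_diff (Phi x) (\<Sum>i\<in>UNIV. c (F x) i j *\<^sub>R Y i (F x))"
    using X_expand[OF X.F_in_W[OF xV]] by simp
  also have "\<dots> = (\<Sum>i\<in>UNIV. c (F x) i j *\<^sub>R Y.Xt i (Phi x))"
    by (simp only: linear_sum[OF l] linear_scale[OF l] Y.in_coords_lx Phi_V(2)[OF x])
  finally show ?thesis .
qed

lemma Phi_derivative_zero: "(Phi has_derivative L) (at 0)"
proof -
  let ?D = "frechet_derivative Phi (at 0)"
  have D: "(Phi has_derivative ?D) (at 0)" by (rule smooth_on_has_derivative[OF Phi_smooth zero_Phi_dom])
  note l = has_derivative_linear[OF D]
  have ax: "?D (axis j 1) = (\<Sum>i\<in>UNIV. c p i j *\<^sub>R axis i 1)" for j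
    using Phi_frame[OF zero_Phi_dom, of j] by (simp add: X.Xt_zero Y.Xt_zero Phi_zero X.F_zero)
  have "?D v = L v" for v
  proof -
    have "?D v = ?D (\<Sum>j\<in>UNIV. v $ j *\<^sub>R axis j 1)" by (simp only: axis_combination)
    also have "\<dots> = (\<Sum>j\<in>UNIV. v $ j *\<^sub>R (\<Sum>i\<in>UNIV. c p i j *\<^sub>R axis i 1))"
      by (simp only: linear_sum[OF l] linear_scale[OF l] ax)
    also have "\<dots> = L v"
      by (simp add: vec_eq_iff L_nth axis_def if_distrib mult.commute cong: if_cong)
    finally show ?thesis .
  qed
  then have "?D = L" by auto
  then show ?thesis using D by simp
qed

text \<open>The coefficients are recovered from fields that are continuous in the coordinates.\<close>

lemma c_isCont: "isCont (\<lambda>x. c (F x) i j) 0"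
proof -
  let ?f = "\<lambda>x. frame_coef (\<lambda>i. Y.Xt i (Phi x)) (frechet_derivative Phi (at x) (X.Xt j x)) $ i"
  have eq: "?f x = c (F x) i j" if x: "x \<in> Phi_dom" for x
  proof -
    have "frame_coef (\<lambda>i. Y.Xt i (Phi x)) (frechet_derivative Phi (at x) (X.Xt j x)) = (\<chi> i. c (F x) i j)"
      by (rule frame_coef_unique[OF Y.Xt_det[OF Phi_V(1)[OF x]]]) (simp add: Phi_frame[OF x])
    then show ?thesis by simp
  qed
  have ic: "isCont h 0" if "smooth_on T h" "open T" "0 \<in> T" for h :: "(real, 'n) vec \<Rightarrow> (real, 'n) vec" and T
    using smooth_on_imp_continuous_on[OF that(1)] that(2,3) continuous_on_eq_continuous_at by blast
  have "isCont (\<lambda>x. Y.Xt i (Phi x)) 0" for i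
  proof -
    have "isCont (Y.Xt i) (Phi 0)" unfolding Phi_zero by (rule ic[OF Y.Xt_smooth X.open_V X.zero_V])
    then show ?thesis by (rule isCont_o2[OF ic[OF Phi_smooth open_Phi_dom zero_Phi_dom]])
  qed
  then have 1: "((\<lambda>x. Y.Xt i (Phi x)) \<longlongrightarrow> Y.Xt i (Phi 0)) (at 0)" for i by (simp add: isCont_def)
  have "smooth_on Phi_dom (\<lambda>x. frechet_derivative Phi (at x) (X.Xt j x))"
    by (rule smooth_on_directional[OF open_Phi_dom Phi_smooth smooth_on_subset[OF X.Xt_smooth Phi_dom_V]])
  from ic[OF this open_Phi_dom zero_Phi_dom]
  have 2: "((\<lambda>x. frechet_derivative Phi (at x) (X.Xt j x)) \<longlongrightarrow> frechet_derivative Phi (at 0) (X.Xt j 0)) (at 0)"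
    by (simp add: isCont_def)
  have "(?f \<longlongrightarrow> ?f 0) (at 0)"
    by (intro tendsto_vec_nth tendsto_frame_coef 1 2 Y.Xt_det Phi_V zero_Phi_dom)
  moreover have "\<forall>\<^sub>F x in at 0. ?f x = c (F x) i j"
    using eventually_at_in_open'[OF open_Phi_dom zero_Phi_dom] by eventually_elim (rule eq)
  ultimately show ?thesis
    unfolding isCont_def eq[OF zero_Phi_dom, symmetric] by (rule Lim_transform_eventually)
qed

definition Phie :: "real \<Rightarrow> (real, 'n) vec \<Rightarrow> (real, 'n) vec" where
  "Phie \<epsilon> x = dilation w (1 / \<epsilon>) (Phi (dilation w \<epsilon> x))"

definition DPhie :: "real \<Rightarrow> (real, 'n) vec \<Rightarrow> (real, 'n) vec \<Rightarrow> (real, 'n) vec" where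
  "DPhie \<epsilon> x h = dilation w (1 / \<epsilon>) (frechet_derivative Phi (at (dilation w \<epsilon> x)) (dilation w \<epsilon> h))"

lemma Phie_zero: "Phie \<epsilon> 0 = 0" by (simp add: Phie_def dilation_zero Phi_zero)

lemma Phie_has_derivative:
  "dilation w \<epsilon> x \<in> Phi_dom \<Longrightarrow> (Phie \<epsilon> has_derivative DPhie \<epsilon> x) (at x)"
  unfolding Phie_def[abs_def] DPhie_def[abs_def]
  by (intro bounded_linear.has_derivative[OF bounded_linear_dilation]
      has_derivative_compose[of "dilation w \<epsilon>", OF _ smooth_on_has_derivative[OF Phi_smooth]]
      bounded_linear_imp_has_derivative bounded_linear_dilation)

text \<open>The transition matrix only mixes fields of equal weight, so its entries acquire no power of
  \<epsilon>. Thus the rescaled transition map relates the rescaled frames by a matrix that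
  tends to the constant matrix of \<open>L\<close>.\<close>

lemma DPhie_frame:
  assumes x: "dilation w \<epsilon> x \<in> Phi_dom" and \<epsilon>: "0 < \<epsilon>"
  shows "DPhie \<epsilon> x (X.Xe \<epsilon> j x) = (\<Sum>i\<in>UNIV. c (F (dilation w \<epsilon> x)) i j *\<^sub>R Y.Xe \<epsilon> i (Phie \<epsilon> x))"
proof -
  let ?y = "dilation w \<epsilon> x"
  note l = linear_dilation[of w "1 / \<epsilon>"] and lD = smooth_on_linear_frechet[OF Phi_smooth x]
  have 1: "dilation w \<epsilon> (X.Xe \<epsilon> j x) = \<epsilon> ^ w j *\<^sub>R X.Xt j ?y"
    using \<epsilon> by (simp add: X.Xe_def rescaled_def linear_scale[OF linear_dilation] dilation_inverse)
  have 2: "\<epsilon> ^ w j *\<^sub>R (c (F ?y) i j *\<^sub>R dilation w (1 / \<epsilon>) (Y.Xt i (Phi ?y))) =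
      c (F ?y) i j *\<^sub>R Y.Xe \<epsilon> i (Phie \<epsilon> x)" for i
  proof (cases "w i = w j")
    case True
    then show ?thesis using \<epsilon> by (simp add: Y.Xe_def rescaled_def Phie_def dilation_inverse mult.commute)
  next
    case False
    then show ?thesis using c_block[OF X.F_in_W, of ?y i j] x Phi_dom_V by auto
  qed
  have "DPhie \<epsilon> x (X.Xe \<epsilon> j x) =
      \<epsilon> ^ w j *\<^sub>R (\<Sum>i\<in>UNIV. c (F ?y) i j *\<^sub>R dilation w (1 / \<epsilon>) (Y.Xt i (Phi ?y)))"
    unfolding DPhie_def 1
    by (simp only: linear_scale[OF lD] linear_scale[OF l] Phi_frame[OF x] linear_sum[OF l])
  also have "\<dots> = (\<Sum>i\<in>UNIV. c (F ?y) i j *\<^sub>R Y.Xe \<epsilon> i (Phie \<epsilon> x))"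
    by (simp only: scaleR_sum_right 2)
  finally show ?thesis .
qed

lemma DPhie_linear: "dilation w \<epsilon> x \<in> Phi_dom \<Longrightarrow> linear (DPhie \<epsilon> x)"
  using Phie_has_derivative has_derivative_linear by blast

lemma DPhie_combination:
  assumes x: "dilation w \<epsilon> x \<in> Phi_dom" and \<epsilon>: "0 < \<epsilon>"
  shows "DPhie \<epsilon> x (\<Sum>j\<in>UNIV. a $ j *\<^sub>R X.Xe \<epsilon> j x) =
    (\<Sum>i\<in>UNIV. (Cm (F (dilation w \<epsilon> x)) *v a) $ i *\<^sub>R Y.Xe \<epsilon> i (Phie \<epsilon> x))"
proof -
  note l = DPhie_linear[OF x]
  have "DPhie \<epsilon> x (\<Sum>j\<in>UNIV. a $ j *\<^sub>R X.Xe \<epsilon> j x) =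
      (\<Sum>j\<in>UNIV. \<Sum>i\<in>UNIV. (a $ j * c (F (dilation w \<epsilon> x)) i j) *\<^sub>R Y.Xe \<epsilon> i (Phie \<epsilon> x))"
    by (simp add: linear_sum[OF l] linear_scale[OF l] DPhie_frame[OF assms] scaleR_sum_right)
  also have "\<dots> = (\<Sum>i\<in>UNIV. \<Sum>j\<in>UNIV. (a $ j * c (F (dilation w \<epsilon> x)) i j) *\<^sub>R Y.Xe \<epsilon> i (Phie \<epsilon> x))"
    by (rule sum.swap)
  finally show ?thesis by (simp add: Cm_nth scaleR_sum_left mult.commute)
qed

lemma good_radius:
  obtains \<rho> K where "\<rho> > 0" "K > 0" "ball 0 \<rho> \<subseteq> Phi_dom" "real CARD('n) * (K * \<rho>) \<le> 1 / 2"
    "\<And>\<epsilon> k x. 0 < \<epsilon> \<Longrightarrow> \<epsilon> \<le> 1 \<Longrightarrow> norm x < \<rho> \<Longrightarrow> norm (X.Xe \<epsilon> k x - axis k 1) \<le> K * norm x"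
    "\<And>\<epsilon> k x. 0 < \<epsilon> \<Longrightarrow> \<epsilon> \<le> 1 \<Longrightarrow> norm x < \<rho> \<Longrightarrow> norm (Y.Xe \<epsilon> k x - axis k 1) \<le> K * norm x"
proof -
  obtain \<rho>1 K1 where 1: "\<rho>1 > 0" "K1 > 0"
    "\<And>\<epsilon> k x. 0 < \<epsilon> \<Longrightarrow> \<epsilon> \<le> 1 \<Longrightarrow> norm x < \<rho>1 \<Longrightarrow> norm (X.Xe \<epsilon> k x - axis k 1) \<le> K1 * norm x"
    using X.Xe_estimate by metis
  obtain \<rho>2 K2 where 2: "\<rho>2 > 0" "K2 > 0"
    "\<And>\<epsilon> k x. 0 < \<epsilon> \<Longrightarrow> \<epsilon> \<le> 1 \<Longrightarrow> norm x < \<rho>2 \<Longrightarrow> norm (Y.Xe \<epsilon> k x - axis k 1) \<le> K2 * norm x"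
    using Y.Xe_estimate by metis
  obtain r where r: "r > 0" "ball 0 r \<subseteq> Phi_dom" using open_Phi_dom zero_Phi_dom open_contains_ball by blast
  define K where "K = max K1 K2"
  have K: "K > 0" "K1 \<le> K" "K2 \<le> K" using 1 2 by (auto simp: K_def)
  define \<rho> where "\<rho> = min (min \<rho>1 \<rho>2) (min r (1 / (2 * real CARD('n) * K)))"
  have N: "real CARD('n) \<ge> 1" by simp
  show ?thesis
  proof
    show "\<rho> > 0" using 1 2 r K by (simp add: \<rho>_def)
    show "K > 0" by (rule K(1))
    show "ball 0 \<rho> \<subseteq> Phi_dom" using r(2) by (auto simp: \<rho>_def)
    have "\<rho> \<le> 1 / (2 * real CARD('n) * K)" by (simp add: \<rho>_def)
    then show "real CARD('n) * (K * \<rho>) \<le> 1 / 2" using K(1) by (simp add: field_simps)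
    fix \<epsilon> :: real and k and x :: "(real, 'n) vec" assume A: "0 < \<epsilon>" "\<epsilon> \<le> 1" "norm x < \<rho>"
    show "norm (X.Xe \<epsilon> k x - axis k 1) \<le> K * norm x"
      using 1(3)[of \<epsilon> x k] A K(2) mult_right_mono[OF K(2) norm_ge_zero[of x]] by (auto simp: \<rho>_def)
    show "norm (Y.Xe \<epsilon> k x - axis k 1) \<le> K * norm x"
      using 2(3)[of \<epsilon> x k] A K(3) mult_right_mono[OF K(3) norm_ge_zero[of x]] by (auto simp: \<rho>_def)
  qed
qed

end

lemma dilation_into:
  fixes w :: "'n::finite \<Rightarrow> nat"
  assumes w: "\<And>i. 0 < w i" and S: "open S" "0 \<in> S" and R: "R > 0"
  obtains \<epsilon>0 where "0 < \<epsilon>0" "\<epsilon>0 \<le> 1" "\<And>\<epsilon> x. 0 < \<epsilon> \<Longrightarrow> \<epsilon> < \<epsilon>0 \<Longrightarrow> norm x \<le> R \<Longrightarrow> dilation w \<epsilon> x \<in> S"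
proof -
  obtain r where r: "r > 0" "ball 0 r \<subseteq> S" using S open_contains_ball by blast
  define \<epsilon>0 where "\<epsilon>0 = min 1 (r / R)"
  show ?thesis
  proof
    show "0 < \<epsilon>0" "\<epsilon>0 \<le> 1" using r R by (auto simp: \<epsilon>0_def)
    fix \<epsilon> :: real and x :: "real ^ 'n" assume A: "0 < \<epsilon>" "\<epsilon> < \<epsilon>0" "norm x \<le> R"
    have "norm (dilation w \<epsilon> x) \<le> \<epsilon> * R"
      by (rule order_trans[OF norm_dilation_le_linear mult_left_mono[OF A(3)]]) (use A w in \<open>auto simp: \<epsilon>0_def\<close>)
    also have "\<dots> < r" using A R by (simp add: \<epsilon>0_def pos_less_divide_eq)
    finally show "dilation w \<epsilon> x \<in> S" using r(2) by auto
  qed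
qed

lemma uniform_limit_at_moving_point:
  fixes f :: "real \<Rightarrow> real ^ 'n::finite \<Rightarrow> real ^ 'm::finite"
  assumes f: "uniform_limit (ball 0 R) f l G" and y: "(y \<longlongrightarrow> y0) G" and y0: "norm y0 < R"
    and cont: "\<forall>\<^sub>F \<epsilon> in G. continuous_on (ball 0 R) (f \<epsilon>)" and G: "G \<noteq> bot"
  shows "((\<lambda>\<epsilon>. f \<epsilon> (y \<epsilon>)) \<longlongrightarrow> l y0) G"
proof -
  have "continuous_on (ball 0 R) l" by (rule uniform_limit_theorem[OF cont f G])
  then have "isCont l y0" using y0 continuous_on_eq_continuous_at[of "ball 0 R" l] by auto
  then have 1: "((\<lambda>\<epsilon>. l (y \<epsilon>)) \<longlongrightarrow> l y0) G" using y by (rule isCont_tendsto_compose)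
  have "\<forall>\<^sub>F \<epsilon> in G. y \<epsilon> \<in> ball 0 R" by (rule topological_tendstoD[OF y]) (use y0 in auto)
  have "((\<lambda>\<epsilon>. f \<epsilon> (y \<epsilon>) - l (y \<epsilon>)) \<longlongrightarrow> 0) G"
  proof (rule tendstoI)
    fix e :: real assume "e > 0"
    then have "\<forall>\<^sub>F \<epsilon> in G. \<forall>x\<in>ball 0 R. dist (f \<epsilon> x) (l x) < e"
      using f by (simp add: uniform_limit_iff)
    then show "\<forall>\<^sub>F \<epsilon> in G. dist (f \<epsilon> (y \<epsilon>) - l (y \<epsilon>)) 0 < e"
      using \<open>\<forall>\<^sub>F \<epsilon> in G. y \<epsilon> \<in> ball 0 R\<close> by eventually_elim (simp add: dist_norm)
  qed
  from tendsto_add[OF this 1] show ?thesis by simp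
qed

text \<open>A radius on which both rescaled frames are uniformly close to the standard basis, small enough
  that the perturbation of a linear combination is at most half of its size.\<close>

locale two_frames_radius = two_frames S V F F' W s nn X Y p g
  for S :: "('a::{t2_space,second_countable_topology}, 'n::{finite,linorder}, 'e::euclidean_space) sr_structure"
    and V F F' W s nn and X Y :: "'n \<Rightarrow> 'a \<Rightarrow> (real, 'n) vec" and p g +
  fixes \<rho> K :: real
  assumes \<rho>: "\<rho> > 0" and K: "K > 0" and ball_Phi_dom: "ball 0 \<rho> \<subseteq> Phi_dom" and NK\<rho>: "real CARD('n) * (K * \<rho>) \<le> 1 / 2"
    and X_est: "\<And>\<epsilon> k x. 0 < \<epsilon> \<Longrightarrow> \<epsilon> \<le> 1 \<Longrightarrow> norm x < \<rho> \<Longrightarrow> norm (X.Xe \<epsilon> k x - axis k 1) \<le> K * norm x"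
    and Y_est: "\<And>\<epsilon> k x. 0 < \<epsilon> \<Longrightarrow> \<epsilon> \<le> 1 \<Longrightarrow> norm x < \<rho> \<Longrightarrow> norm (Y.Xe \<epsilon> k x - axis k 1) \<le> K * norm x"
begin

lemma ball_V: "ball 0 \<rho> \<subseteq> V" using ball_Phi_dom Phi_dom_V by blast

lemma dilation_Phi_dom: "0 < \<epsilon> \<Longrightarrow> \<epsilon> \<le> 1 \<Longrightarrow> norm x < \<rho> \<Longrightarrow> dilation w \<epsilon> x \<in> Phi_dom"
  using norm_dilation_le[of \<epsilon> w x] ball_Phi_dom by force

lemma Y_combination_bound:
  assumes \<epsilon>: "0 < \<epsilon>" "\<epsilon> \<le> 1" and y: "norm y < \<rho>"
  shows "norm (\<Sum>i\<in>UNIV. u $ i *\<^sub>R Y.Xe \<epsilon> i y) \<le> 2 * norm u"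
proof -
  have "(\<Sum>i\<in>UNIV. u $ i *\<^sub>R Y.Xe \<epsilon> i y) = u + (\<Sum>i\<in>UNIV. u $ i *\<^sub>R (Y.Xe \<epsilon> i y - axis i 1))"
    by (simp add: scaleR_diff_right sum_subtractf axis_combination)
  also have "norm \<dots> \<le> norm u + norm (\<Sum>i\<in>UNIV. u $ i *\<^sub>R (Y.Xe \<epsilon> i y - axis i 1))"
    by (rule norm_triangle_ineq)
  also have "norm (\<Sum>i\<in>UNIV. u $ i *\<^sub>R (Y.Xe \<epsilon> i y - axis i 1)) \<le> real CARD('n) * (norm u * (K * \<rho>))"
  proof (rule norm_sum_scaleR_bound)
    show "norm (Y.Xe \<epsilon> i y - axis i 1) \<le> K * \<rho>" for i
      by (rule order_trans[OF Y_est[OF \<epsilon> y] mult_left_mono]) (use y K in auto)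
  qed (use component_le_norm_cart in auto)
  also have "real CARD('n) * (norm u * (K * \<rho>)) = norm u * (real CARD('n) * (K * \<rho>))" by simp
  also have "\<dots> \<le> norm u * (1 / 2)" by (rule mult_left_mono[OF NK\<rho> norm_ge_zero])
  also have "\<dots> \<le> norm u" by simp
  finally show ?thesis by simp
qed

lemma X_ray: "x = (\<Sum>j\<in>UNIV. x $ j *\<^sub>R X.Xe \<epsilon> j (t *\<^sub>R x))"
  if \<epsilon>: "0 < \<epsilon>" "\<epsilon> \<le> 1" and x: "norm x < \<rho>" and t: "0 \<le> t" "t \<le> 1"
proof (cases "t = 0")
  case True
  then show ?thesis using X.Xe_zero[OF \<epsilon>(1)] by (simp add: axis_combination)
next
  case False
  have "norm (t *\<^sub>R x) \<le> norm x" using t by (simp add: mult_left_le_one_le)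
  then have "(\<Sum>i\<in>UNIV. (t *\<^sub>R x) $ i *\<^sub>R X.Xe \<epsilon> i (t *\<^sub>R x)) = t *\<^sub>R x"
    by (intro X.Xe_euler[OF ball_V _ \<epsilon>]) (use x in simp)
  then have "t *\<^sub>R (\<Sum>j\<in>UNIV. x $ j *\<^sub>R X.Xe \<epsilon> j (t *\<^sub>R x)) = t *\<^sub>R x"
    by (simp add: scaleR_sum_right)
  then show ?thesis using False by simp
qed

text \<open>The coefficients, in the second rescaled frame, of the velocity of the image of a ray.\<close>

definition u :: "real \<Rightarrow> (real, 'n) vec \<Rightarrow> real \<Rightarrow> (real, 'n) vec" where
  "u \<epsilon> x t = Cm (F (dilation w \<epsilon> (t *\<^sub>R x))) *v x"

lemma ray_small: "norm x < \<rho> \<Longrightarrow> 0 \<le> t \<Longrightarrow> t \<le> 1 \<Longrightarrow> norm (t *\<^sub>R x) < \<rho>"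
  using mult_left_le_one_le[of "norm x" t] by simp

lemma DPhie_ray:
  assumes \<epsilon>: "0 < \<epsilon>" "\<epsilon> \<le> 1" and x: "norm x < \<rho>" and t: "0 \<le> t" "t \<le> 1"
  shows "DPhie \<epsilon> (t *\<^sub>R x) x = (\<Sum>i\<in>UNIV. u \<epsilon> x t $ i *\<^sub>R Y.Xe \<epsilon> i (Phie \<epsilon> (t *\<^sub>R x)))"
proof -
  have D: "dilation w \<epsilon> (t *\<^sub>R x) \<in> Phi_dom" by (rule dilation_Phi_dom[OF \<epsilon> ray_small[OF x t]])
  have "DPhie \<epsilon> (t *\<^sub>R x) x = DPhie \<epsilon> (t *\<^sub>R x) (\<Sum>j\<in>UNIV. x $ j *\<^sub>R X.Xe \<epsilon> j (t *\<^sub>R x))"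
    using X_ray[OF \<epsilon> x t] by simp
  then show ?thesis using DPhie_combination[OF D \<epsilon>(1)] by (simp add: u_def)
qed

lemma u_norm:
  assumes \<epsilon>: "0 < \<epsilon>" "\<epsilon> \<le> 1" and x: "norm x < \<rho>" and t: "0 \<le> t" "t \<le> 1"
  shows "norm (u \<epsilon> x t) = norm x"
  unfolding u_def
  by (rule Cm_norm[OF X.F_in_W]) (use dilation_Phi_dom[OF \<epsilon> ray_small[OF x t]] Phi_dom_V in blast)

lemma Phie_ray_derivative:
  assumes \<epsilon>: "0 < \<epsilon>" "\<epsilon> \<le> 1" and x: "norm x < \<rho>" and t: "0 \<le> t" "t \<le> 1"
  shows "((\<lambda>t. Phie \<epsilon> (t *\<^sub>R x)) has_derivative (\<lambda>h. h *\<^sub>R DPhie \<epsilon> (t *\<^sub>R x) x)) (at t)"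
proof -
  have D: "dilation w \<epsilon> (t *\<^sub>R x) \<in> Phi_dom" by (rule dilation_Phi_dom[OF \<epsilon> ray_small[OF x t]])
  have "((\<lambda>t. Phie \<epsilon> (t *\<^sub>R x)) has_derivative (\<lambda>h. DPhie \<epsilon> (t *\<^sub>R x) (h *\<^sub>R x))) (at t)"
    by (rule has_derivative_compose[where g="Phie \<epsilon>" and f="\<lambda>t. t *\<^sub>R x" and g'="DPhie \<epsilon> (t *\<^sub>R x)"])
      (auto intro!: derivative_eq_intros Phie_has_derivative D)
  then show ?thesis by (simp add: linear_scale[OF DPhie_linear[OF D]])
qed

lemma Phie_ray_continuous:
  assumes \<epsilon>: "0 < \<epsilon>" "\<epsilon> \<le> 1" and x: "norm x < \<rho>" and t: "t \<le> 1"
  shows "continuous_on {0..t} (\<lambda>t. Phie \<epsilon> (t *\<^sub>R x))"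
proof (rule continuous_at_imp_continuous_on, rule ballI)
  fix \<tau> assume "\<tau> \<in> {0..t}"
  then show "isCont (\<lambda>t. Phie \<epsilon> (t *\<^sub>R x)) \<tau>"
    using t by (intro has_derivative_continuous[OF Phie_ray_derivative[OF \<epsilon> x]]) auto
qed

text \<open>As long as the image of the ray stays in the ball, its speed is at most twice that of the ray; so it
  cannot leave the ball.\<close>

lemma Phie_ray_bound:
  assumes \<epsilon>: "0 < \<epsilon>" "\<epsilon> \<le> 1" and x: "norm x < \<rho> / 2" and t: "0 \<le> t" "t \<le> 1"
  shows "norm (Phie \<epsilon> (t *\<^sub>R x)) \<le> 2 * t * norm x" "norm (Phie \<epsilon> (t *\<^sub>R x)) < \<rho>"
proof -
  have x\<rho>: "norm x < \<rho>" using x \<rho> by simp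
  have claim: "norm (Phie \<epsilon> (t *\<^sub>R x)) \<le> 2 * t * norm x"
    if t: "0 \<le> t" "t \<le> 1" and IH: "\<And>s. 0 \<le> s \<Longrightarrow> s < t \<Longrightarrow> norm (Phie \<epsilon> (s *\<^sub>R x)) < \<rho>" for t
  proof (cases "t = 0")
    case True then show ?thesis by (simp add: Phie_zero)
  next
    case False
    then have t0: "0 < t" using t by simp
    obtain \<tau> where \<tau>: "\<tau> \<in> {0<..<t}"
      "norm (Phie \<epsilon> (t *\<^sub>R x) - Phie \<epsilon> (0 *\<^sub>R x)) \<le> norm ((t - 0) *\<^sub>R DPhie \<epsilon> (\<tau> *\<^sub>R x) x)"
      using mvt_general[OF t0 Phie_ray_continuous[OF \<epsilon> x\<rho> t(2)], of "\<lambda>\<tau> h. h *\<^sub>R DPhie \<epsilon> (\<tau> *\<^sub>R x) x"]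
        Phie_ray_derivative[OF \<epsilon> x\<rho>] t by fastforce
    have \<tau>1: "0 \<le> \<tau>" "\<tau> \<le> 1" "\<tau> < t" using \<tau>(1) t by auto
    have "norm (DPhie \<epsilon> (\<tau> *\<^sub>R x) x) \<le> 2 * norm (u \<epsilon> x \<tau>)"
      unfolding DPhie_ray[OF \<epsilon> x\<rho> \<tau>1(1,2)] by (rule Y_combination_bound[OF \<epsilon> IH[OF \<tau>1(1,3)]])
    also have "\<dots> = 2 * norm x" using u_norm[OF \<epsilon> x\<rho> \<tau>1(1,2)] by simp
    finally have "t * norm (DPhie \<epsilon> (\<tau> *\<^sub>R x) x) \<le> t * (2 * norm x)"
      by (rule mult_left_mono) (use t0 in simp)
    moreover have "norm (Phie \<epsilon> (t *\<^sub>R x)) \<le> t * norm (DPhie \<epsilon> (\<tau> *\<^sub>R x) x)"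
      using \<tau>(2) t0 by (simp add: Phie_zero)
    ultimately show ?thesis by linarith
  qed
  have small: "2 * t * norm x < \<rho>" if "0 \<le> t" "t \<le> 1" for t
    using mult_left_le_one_le[of "norm x" t] that x by simp
  have bd: "norm (Phie \<epsilon> (t *\<^sub>R x)) < \<rho>" if "t \<in> {0..1}" for t
  proof (rule first_exit[where \<phi>="\<lambda>(k::unit) t. norm (Phie \<epsilon> (t *\<^sub>R x))", OF _ _ that])
    show "continuous_on {0..1} (\<lambda>t. norm (Phie \<epsilon> (t *\<^sub>R x)))"
      by (intro continuous_on_norm Phie_ray_continuous[OF \<epsilon> x\<rho>]) simp
    fix t and k :: unit assume t: "t \<in> {0..1::real}" and IH: "\<And>s (k::unit). 0 \<le> s \<Longrightarrow> s < t \<Longrightarrow> norm (Phie \<epsilon> (s *\<^sub>R x)) < \<rho>"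
    show "norm (Phie \<epsilon> (t *\<^sub>R x)) < \<rho>"
      using claim[of t] IH small[of t] t by force
  qed
  show "norm (Phie \<epsilon> (t *\<^sub>R x)) \<le> 2 * t * norm x" by (rule claim[OF t]) (use bd t in auto)
  show "norm (Phie \<epsilon> (t *\<^sub>R x)) < \<rho>" using bd t by simp
qed

text \<open>The image \<open>y\<close> of the ray at time \<open>t\<close> is compared with \<open>t L x\<close>. The velocity of \<open>y\<close> differs from
  \<open>u\<close> by \<open>\<Sum> u i (Y i - e i)\<close>, which is of second order in \<open>x\<close> but not small with \<epsilon>. The Euler
  identity \<open>\<Sum> y i (Y i - e i) = 0\<close> allows \<open>t u\<close> to be replaced by \<open>t u - y\<close> there, and this is
  controlled by the error itself with a factor below one.\<close>

lemma Phie_close: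
  assumes \<epsilon>: "0 < \<epsilon>" "\<epsilon> \<le> 1" and x: "norm x < \<rho> / 2" and \<sigma>: "\<sigma> > 0"
    and uL: "\<And>t. 0 \<le> t \<Longrightarrow> t \<le> 1 \<Longrightarrow> norm (u \<epsilon> x t - L x) \<le> \<sigma>"
  shows "norm (Phie \<epsilon> x - L x) < 4 * \<sigma>"
proof -
  have x\<rho>: "norm x < \<rho>" using x \<rho> by simp
  let ?z = "\<lambda>t. Phie \<epsilon> (t *\<^sub>R x) - t *\<^sub>R L x"
  have cont: "continuous_on {0..t} ?z" if "t \<le> 1" for t
    by (intro continuous_intros Phie_ray_continuous[OF \<epsilon> x\<rho> that])
  have "norm (?z 1) < 4 * \<sigma>"
  proof (rule first_exit[where \<phi>="\<lambda>(k::unit) t. norm (?z t)"])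
    show "continuous_on {0..1} (\<lambda>t. norm (?z t))" by (intro continuous_on_norm cont) simp
    fix t and k :: unit assume t: "t \<in> {0..1::real}" and IH: "\<And>s (k::unit). 0 \<le> s \<Longrightarrow> s < t \<Longrightarrow> norm (?z s) < 4 * \<sigma>"
    show "norm (?z t) < 4 * \<sigma>"
    proof (cases "t = 0")
      case True then show ?thesis using \<sigma> by (simp add: Phie_zero)
    next
      case False
      then have t0: "0 < t" "t \<le> 1" using t by auto
      have der: "(?z has_derivative (\<lambda>h. h *\<^sub>R (DPhie \<epsilon> (\<tau> *\<^sub>R x) x - L x))) (at \<tau>)" if "0 \<le> \<tau>" "\<tau> \<le> 1" for \<tau>
        by (auto intro!: derivative_eq_intros Phie_ray_derivative[OF \<epsilon> x\<rho> that] simp: scaleR_diff_right)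
      obtain \<tau> where \<tau>: "\<tau> \<in> {0<..<t}" "norm (?z t - ?z 0) \<le> norm ((t - 0) *\<^sub>R (DPhie \<epsilon> (\<tau> *\<^sub>R x) x - L x))"
        using mvt_general[OF t0(1) cont[OF t0(2)], of "\<lambda>\<tau> h. h *\<^sub>R (DPhie \<epsilon> (\<tau> *\<^sub>R x) x - L x)"]
          der t0 by fastforce
      have \<tau>1: "0 \<le> \<tau>" "\<tau> \<le> 1" "\<tau> < t" "0 < \<tau>" using \<tau>(1) t0 by auto
      define y where "y = Phie \<epsilon> (\<tau> *\<^sub>R x)"
      define r where "r i = Y.Xe \<epsilon> i y - axis i 1" for i
      define v where "v = u \<epsilon> x \<tau>"
      have y: "norm y \<le> 2 * \<tau> * norm x" "norm y < \<rho>"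
        unfolding y_def by (rule Phie_ray_bound[OF \<epsilon> x \<tau>1(1,2)])+
      have vL: "norm (v - L x) \<le> \<sigma>" unfolding v_def by (rule uL[OF \<tau>1(1,2)])
      have "(\<Sum>i\<in>UNIV. y $ i *\<^sub>R Y.Xe \<epsilon> i y) = y" by (rule Y.Xe_euler[OF ball_V y(2) \<epsilon>])
      then have yr: "(\<Sum>i\<in>UNIV. y $ i *\<^sub>R r i) = 0"
        by (simp add: r_def scaleR_diff_right sum_subtractf axis_combination)
      have D: "DPhie \<epsilon> (\<tau> *\<^sub>R x) x = v + (\<Sum>i\<in>UNIV. v $ i *\<^sub>R r i)"
        using DPhie_ray[OF \<epsilon> x\<rho> \<tau>1(1,2)]
        by (simp add: r_def y_def v_def scaleR_diff_right sum_subtractf axis_combination)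
      have eq: "\<tau> *\<^sub>R (\<Sum>i\<in>UNIV. v $ i *\<^sub>R r i) = (\<Sum>i\<in>UNIV. (\<tau> *\<^sub>R v - y) $ i *\<^sub>R r i)"
        using yr by (simp add: scaleR_diff_left sum_subtractf scaleR_sum_right)
      have "norm (\<Sum>i\<in>UNIV. (\<tau> *\<^sub>R v - y) $ i *\<^sub>R r i) \<le> real CARD('n) * (5 * \<sigma> * (K * (2 * \<tau> * norm x)))"
      proof (rule norm_sum_scaleR_bound)
        show "norm (r i) \<le> K * (2 * \<tau> * norm x)" for i
          unfolding r_def by (rule order_trans[OF Y_est[OF \<epsilon> y(2)] mult_left_mono[OF y(1)]]) (use K in simp)
        have "\<tau> *\<^sub>R v - y = \<tau> *\<^sub>R (v - L x) - ?z \<tau>" by (simp add: y_def algebra_simps)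
        also have "norm \<dots> \<le> norm (\<tau> *\<^sub>R (v - L x)) + norm (?z \<tau>)" by (rule norm_triangle_ineq4)
        also have "norm (\<tau> *\<^sub>R (v - L x)) \<le> \<sigma>"
          using \<tau>1 vL mult_left_le_one_le[of "norm (v - L x)" \<tau>] by simp
        also have "norm (?z \<tau>) \<le> 4 * \<sigma>" using IH[OF \<tau>1(1,3)] by simp
        finally have "norm (\<tau> *\<^sub>R v - y) \<le> 5 * \<sigma>" by simp
        then show "\<bar>(\<tau> *\<^sub>R v - y) $ i\<bar> \<le> 5 * \<sigma>" for i
          using component_le_norm_cart[of "\<tau> *\<^sub>R v - y" i] by linarith
      qed (use \<sigma> in simp)
      then have "norm (\<tau> *\<^sub>R (\<Sum>i\<in>UNIV. v $ i *\<^sub>R r i)) \<le> \<tau> * (10 * \<sigma> * (real CARD('n) * (K * norm x)))"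
        unfolding eq by (simp add: mult_ac)
      then have "\<tau> * norm (\<Sum>i\<in>UNIV. v $ i *\<^sub>R r i) \<le> \<tau> * (10 * \<sigma> * (real CARD('n) * (K * norm x)))"
        using \<tau>1(1) by simp
      then have "norm (\<Sum>i\<in>UNIV. v $ i *\<^sub>R r i) \<le> 10 * \<sigma> * (real CARD('n) * (K * norm x))"
        using \<tau>1(4) by simp
      also have "\<dots> \<le> 10 * \<sigma> * (1 / 4)"
      proof (rule mult_left_mono)
        have "real CARD('n) * (K * norm x) \<le> real CARD('n) * (K * (\<rho> / 2))" using x K by (intro mult_left_mono) auto
        also have "\<dots> = real CARD('n) * (K * \<rho>) / 2" by simp
        also have "\<dots> \<le> 1 / 4" using NK\<rho> by linarith
        finally show "real CARD('n) * (K * norm x) \<le> 1 / 4" .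
      qed (use \<sigma> in simp)
      finally have 2: "norm (\<Sum>i\<in>UNIV. v $ i *\<^sub>R r i) \<le> 10 * \<sigma> * (1 / 4)" .
      have "norm (DPhie \<epsilon> (\<tau> *\<^sub>R x) x - L x) \<le> norm (v - L x) + norm (\<Sum>i\<in>UNIV. v $ i *\<^sub>R r i)"
        unfolding D using norm_triangle_ineq[of "v - L x" "\<Sum>i\<in>UNIV. v $ i *\<^sub>R r i"] by (simp add: algebra_simps)
      then have "norm (DPhie \<epsilon> (\<tau> *\<^sub>R x) x - L x) < 4 * \<sigma>" using vL 2 \<sigma> by linarith
      moreover have "norm (?z t) \<le> t * norm (DPhie \<epsilon> (\<tau> *\<^sub>R x) x - L x)"
        using \<tau>(2) t0 by (simp add: Phie_zero)
      moreover have "t * norm (DPhie \<epsilon> (\<tau> *\<^sub>R x) x - L x) \<le> norm (DPhie \<epsilon> (\<tau> *\<^sub>R x) x - L x)"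
        using t0 by (simp add: mult_left_le_one_le)
      ultimately show ?thesis by linarith
    qed
  qed simp
  then show ?thesis by simp
qed

text \<open>By continuity of the transition matrix at \<open>p\<close> the coefficients \<open>u\<close> approach \<open>L x\<close>.\<close>

lemma Phie_limit_small:
  assumes e: "e > 0"
  obtains \<epsilon>0 where "0 < \<epsilon>0" "\<epsilon>0 \<le> 1"
    "\<And>\<epsilon> x. 0 < \<epsilon> \<Longrightarrow> \<epsilon> < \<epsilon>0 \<Longrightarrow> norm x < \<rho> / 2 \<Longrightarrow> norm (Phie \<epsilon> x - L x) < e"
proof -
  (* the error in the matrix entries is multiplied by the dimension twice and by the radius *)
  define \<eta> where "\<eta> = e / (4 * (real CARD('n) * (real CARD('n) * \<rho>)))"
  have \<eta>: "\<eta> > 0" using e \<rho> by (simp add: \<eta>_def)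
  have "\<forall>\<^sub>F x in nhds 0. \<forall>i\<in>UNIV. \<forall>j\<in>UNIV. \<bar>c (F x) i j - c p i j\<bar> < \<eta>"
  proof (intro eventually_ball_finite ballI)
    fix i j
    have "((\<lambda>x. c (F x) i j) \<longlongrightarrow> c (F 0) i j) (nhds 0)"
      using c_isCont[of i j] by (simp add: isCont_def tendsto_nhds_iff)
    then have "\<forall>\<^sub>F x in nhds 0. dist (c (F x) i j) (c (F 0) i j) < \<eta>" using \<eta> by (rule tendstoD)
    then show "\<forall>\<^sub>F x in nhds 0. \<bar>c (F x) i j - c p i j\<bar> < \<eta>"
      by (simp add: dist_real_def X.F_zero)
  qed auto
  then obtain U where U: "open U" "0 \<in> U" "\<And>x i j. x \<in> U \<Longrightarrow> \<bar>c (F x) i j - c p i j\<bar> < \<eta>"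
    unfolding eventually_nhds by auto
  obtain \<epsilon>0 where \<epsilon>0: "0 < \<epsilon>0" "\<epsilon>0 \<le> 1" "\<And>\<epsilon> x. 0 < \<epsilon> \<Longrightarrow> \<epsilon> < \<epsilon>0 \<Longrightarrow> norm x \<le> \<rho> \<Longrightarrow> dilation w \<epsilon> x \<in> U"
    by (rule dilation_into[where w=w, OF X.w_pos U(1,2) \<rho>]) blast
  show ?thesis
  proof
    show "0 < \<epsilon>0" "\<epsilon>0 \<le> 1" by (rule \<epsilon>0)+
    fix \<epsilon> :: real and x :: "(real, 'n) vec" assume A: "0 < \<epsilon>" "\<epsilon> < \<epsilon>0" "norm x < \<rho> / 2"
    have x\<rho>: "norm x < \<rho>" using A(3) \<rho> by simp
    have "norm (Phie \<epsilon> x - L x) < 4 * (e / 4)"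
    proof (rule Phie_close)
      fix t :: real assume t: "0 \<le> t" "t \<le> 1"
      have inU: "dilation w \<epsilon> (t *\<^sub>R x) \<in> U"
        by (rule \<epsilon>0(3)) (use A ray_small[OF x\<rho> t] in auto)
      have comp: "\<bar>(u \<epsilon> x t - L x) $ i\<bar> \<le> real CARD('n) * (\<eta> * \<rho>)" for i
      proof -
        have "(u \<epsilon> x t - L x) $ i = (\<Sum>j\<in>UNIV. (c (F (dilation w \<epsilon> (t *\<^sub>R x))) i j - c p i j) * x $ j)"
          by (simp add: u_def Cm_nth L_nth sum_subtractf algebra_simps)
        also have "\<bar>\<dots>\<bar> \<le> (\<Sum>j\<in>(UNIV::'n set). \<eta> * \<rho>)"
        proof (rule order_trans[OF sum_abs sum_mono])
          fix j show "\<bar>(c (F (dilation w \<epsilon> (t *\<^sub>R x))) i j - c p i j) * x $ j\<bar> \<le> \<eta> * \<rho>"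
            unfolding abs_mult
            by (rule mult_mono) (use U(3)[OF inU, of i j] component_le_norm_cart[of x j] x\<rho> \<eta> in auto)
        qed
        finally show ?thesis by simp
      qed
      have "norm (u \<epsilon> x t - L x) \<le> (\<Sum>i\<in>UNIV. \<bar>(u \<epsilon> x t - L x) $ i\<bar>)" by (rule norm_le_l1_cart)
      also have "\<dots> \<le> (\<Sum>i\<in>(UNIV::'n set). real CARD('n) * (\<eta> * \<rho>))" by (rule sum_mono) (rule comp)
      also have "\<dots> = e / 4" using \<rho> by (simp add: \<eta>_def)
      finally show "norm (u \<epsilon> x t - L x) \<le> e / 4" .
    qed (use A \<epsilon>0 e in auto)
    then show "norm (Phie \<epsilon> x - L x) < e" by simp
  qed
qed

text \<open>A dilation moves a bounded set into the small ball, and both the rescaled transition maps and \<open>L\<close>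
  are compatible with it.\<close>

lemma Phie_limit:
  assumes R: "R > 0"
  shows "uniform_limit (cball 0 R) Phie L (at_right 0)"
  unfolding uniform_limit_iff
proof (intro allI impI)
  fix e :: real assume e: "e > 0"
  obtain r where r: "0 < r" "r \<le> 1" "\<And>x. norm x \<le> R \<Longrightarrow> norm (dilation w r x) < \<rho> / 2"
  proof -
    obtain \<epsilon>0 where \<epsilon>0: "0 < \<epsilon>0" "\<epsilon>0 \<le> 1" "\<And>\<epsilon> x. 0 < \<epsilon> \<Longrightarrow> \<epsilon> < \<epsilon>0 \<Longrightarrow> norm x \<le> R \<Longrightarrow> dilation w \<epsilon> x \<in> ball 0 (\<rho> / 2)"
      by (rule dilation_into[where w=w, OF X.w_pos _ _ R, of "ball 0 (\<rho> / 2)"]) (use \<rho> in auto)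
    show ?thesis by (rule that[of "\<epsilon>0 / 2"]) (use \<epsilon>0 \<epsilon>0(3)[of "\<epsilon>0 / 2"] in auto)
  qed
  obtain B where B: "B > 0" "\<And>v. norm (dilation w (1 / r) v) \<le> norm v * B"
    using bounded_linear.pos_bounded[OF bounded_linear_dilation[of w "1 / r"]] by blast
  have eB: "e / B > 0" using e B by simp
  obtain \<epsilon>0 where \<epsilon>0: "0 < \<epsilon>0" "\<epsilon>0 \<le> 1"
    "\<And>\<epsilon> x. 0 < \<epsilon> \<Longrightarrow> \<epsilon> < \<epsilon>0 \<Longrightarrow> norm x < \<rho> / 2 \<Longrightarrow> norm (Phie \<epsilon> x - L x) < e / B"
    by (rule Phie_limit_small[OF eB]) blast
  have "r * \<epsilon>0 > 0" using r \<epsilon>0 by simp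
  from eventually_at_right_real[OF this]
  show "\<forall>\<^sub>F \<epsilon> in at_right 0. \<forall>x\<in>cball 0 R. dist (Phie \<epsilon> x) (L x) < e"
  proof eventually_elim
    case (elim \<epsilon>)
    have \<epsilon>: "0 < \<epsilon> / r" "\<epsilon> / r < \<epsilon>0" using elim r by (auto simp: divide_less_eq mult.commute)
    show ?case
    proof
      fix x :: "(real, 'n) vec" assume x: "x \<in> cball 0 R"
      have "Phie \<epsilon> x - L x = dilation w (1 / r) (Phie (\<epsilon> / r) (dilation w r x) - L (dilation w r x))"
        using r \<epsilon> by (simp add: Phie_def L_dilation linear_diff[OF linear_dilation] dilation_mult dilation_one)
      also have "norm \<dots> \<le> norm (Phie (\<epsilon> / r) (dilation w r x) - L (dilation w r x)) * B" by (rule B(2))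
      also have "\<dots> < e / B * B"
        by (rule mult_strict_right_mono[OF \<epsilon>0(3)[OF \<epsilon>] B(1)]) (use r(3) x in auto)
      finally show "dist (Phie \<epsilon> x) (L x) < e" using B by (simp add: dist_norm)
    qed
  qed
qed

subsection \<open>Convergence of the differentials\<close>

text \<open>The differential is determined by its values on the first rescaled frame, and those are bounded.\<close>

lemma DPhie_bound:
  assumes \<epsilon>: "0 < \<epsilon>" "\<epsilon> \<le> 1" and x: "norm x < \<rho> / 2"
  shows "norm (DPhie \<epsilon> x h) \<le> 4 * norm h"
proof -
  have x\<rho>: "norm x < \<rho>" using x \<rho> by simp
  have D: "dilation w \<epsilon> x \<in> Phi_dom" by (rule dilation_Phi_dom[OF \<epsilon> x\<rho>])
  have V: "dilation w \<epsilon> x \<in> V" using D Phi_dom_V by blast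
  obtain a where a: "h = (\<Sum>j\<in>UNIV. a $ j *\<^sub>R X.Xe \<epsilon> j x)"
    by (rule X.Xe_expand[OF V \<epsilon>(1)])
  have "norm a \<le> 2 * norm h"
  proof (rule frame_coef_bound[OF a])
    show "norm (X.Xe \<epsilon> j x - axis j 1) \<le> K * \<rho>" for j
      by (rule order_trans[OF X_est[OF \<epsilon> x\<rho>] mult_left_mono]) (use x\<rho> K in auto)
  qed (rule NK\<rho>)
  moreover have "norm (DPhie \<epsilon> x h) \<le> 2 * norm (Cm (F (dilation w \<epsilon> x)) *v a)"
    unfolding a DPhie_combination[OF D \<epsilon>(1)]
    by (rule Y_combination_bound[OF \<epsilon>]) (use Phie_ray_bound(2)[OF \<epsilon> x, of 1] in simp)
  moreover have "norm (Cm (F (dilation w \<epsilon> x)) *v a) = norm a"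
    by (rule Cm_norm[OF X.F_in_W[OF V]])
  ultimately show ?thesis by linarith
qed

text \<open>The candidate for the limit of the differentials: the homogeneous parts of the partial derivatives
  of the transition map.\<close>

definition G :: "'n \<Rightarrow> (real, 'n) vec \<Rightarrow> (real, 'n) vec" where
  "G i x = (\<chi> k. taylor_homogeneous_part w (int (w k) - int (w i))
     (\<lambda>y. frechet_derivative Phi (at y) (axis i 1) $ k) x)"

lemma DPhie_axis_nth:
  assumes "dilation w \<epsilon> x \<in> Phi_dom"
  shows "DPhie \<epsilon> x (axis i 1) $ k =
    \<epsilon> ^ w i * ((1 / \<epsilon>) ^ w k * frechet_derivative Phi (at (dilation w \<epsilon> x)) (axis i 1) $ k)"
proof -
  have "dilation w \<epsilon> (axis i 1) = \<epsilon> ^ w i *\<^sub>R axis i 1"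
    by (auto simp: vec_eq_iff dilation_nth axis_def)
  then show ?thesis
    by (simp add: DPhie_def dilation_nth linear_scale[OF smooth_on_linear_frechet[OF Phi_smooth assms]])
qed

lemma DPhie_axis_limit:
  assumes R: "R > 0"
  shows "uniform_limit (cball 0 R) (\<lambda>\<epsilon> x. DPhie \<epsilon> x (axis i 1)) (G i) (at_right 0)"
proof (rule uniform_limit_componentwise)
  fix k
  let ?a = "\<lambda>y. frechet_derivative Phi (at y) (axis i 1) $ k"
  have "uniform_limit (cball 0 R) (\<lambda>\<epsilon> x. \<epsilon> ^ w i * ((1 / \<epsilon>) ^ w k * ?a (dilation w \<epsilon> x)))
      (taylor_homogeneous_part w (int (w k) - int (w i)) ?a) (at_right 0)"
  proof (rule rescaled_component_limit[where w=w and \<rho>="\<rho> / 2", OF X.w_pos _ open_Phi_dom zero_Phi_dom R])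
    show "smooth_on Phi_dom ?a"
      by (intro smooth_on_vec_nth open_Phi_dom smooth_on_derivative Phi_smooth)
    show "\<rho> / 2 > 0" using \<rho> by simp
    fix \<epsilon> :: real and x :: "(real, 'n) vec" assume A: "0 < \<epsilon>" "\<epsilon> < 1" "norm x < \<rho> / 2"
    have D: "dilation w \<epsilon> x \<in> Phi_dom" using A \<rho> by (intro dilation_Phi_dom) auto
    have "\<bar>DPhie \<epsilon> x (axis i 1) $ k\<bar> \<le> norm (DPhie \<epsilon> x (axis i 1))" by (rule component_le_norm_cart)
    also have "\<dots> \<le> 4" using DPhie_bound[of \<epsilon> x "axis i 1"] A by (simp add: norm_axis_1)
    finally show "\<bar>\<epsilon> ^ w i * ((1 / \<epsilon>) ^ w k * ?a (dilation w \<epsilon> x))\<bar> \<le> 4" using DPhie_axis_nth[OF D] by simp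
  qed
  moreover obtain \<epsilon>0 where \<epsilon>0: "0 < \<epsilon>0" "\<epsilon>0 \<le> 1" "\<And>\<epsilon> x. 0 < \<epsilon> \<Longrightarrow> \<epsilon> < \<epsilon>0 \<Longrightarrow> norm x \<le> R \<Longrightarrow> dilation w \<epsilon> x \<in> Phi_dom"
    by (rule dilation_into[where w=w, OF X.w_pos open_Phi_dom zero_Phi_dom R]) blast
  have "\<forall>\<^sub>F \<epsilon> in at_right 0. \<forall>x\<in>cball 0 R.
      \<epsilon> ^ w i * ((1 / \<epsilon>) ^ w k * ?a (dilation w \<epsilon> x)) = DPhie \<epsilon> x (axis i 1) $ k"
    using eventually_at_right_real[OF \<epsilon>0(1)]
    by eventually_elim (use DPhie_axis_nth \<epsilon>0(3) in simp)
  ultimately have "uniform_limit (cball 0 R) (\<lambda>\<epsilon> x. DPhie \<epsilon> x (axis i 1) $ k)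
      (taylor_homogeneous_part w (int (w k) - int (w i)) ?a) (at_right 0)"
    by (simp cong: uniform_limit_cong)
  then show "uniform_limit (cball 0 R) (\<lambda>\<epsilon> x. DPhie \<epsilon> x (axis i 1) $ k) (\<lambda>x. G i x $ k) (at_right 0)"
    by (simp add: G_def)
qed

text \<open>The maps converge to \<open>L\<close> and their differentials converge uniformly, so the limit of the differentials
  is the differential of the limit.\<close>

lemma G_eq: "G i x = L (axis i 1)"
proof -
  define R where "R = norm x + 1"
  have R: "R > 0" "norm x < R" by (auto simp: R_def intro: add_nonneg_pos)
  obtain \<epsilon>0 where \<epsilon>0: "0 < \<epsilon>0" "\<epsilon>0 \<le> 1" "\<And>\<epsilon> x. 0 < \<epsilon> \<Longrightarrow> \<epsilon> < \<epsilon>0 \<Longrightarrow> norm x \<le> R \<Longrightarrow> dilation w \<epsilon> x \<in> Phi_dom"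
    by (rule dilation_into[where w=w, OF X.w_pos open_Phi_dom zero_Phi_dom R(1)]) blast
  (* any sequence in the admissible range that tends to 0 *)
  define \<delta> where "\<delta> n = \<epsilon>0 / real (n + 2)" for n
  have \<delta>: "0 < \<delta> n" "\<delta> n < \<epsilon>0" for n using \<epsilon>0(1) by (auto simp: \<delta>_def divide_less_eq)
  have "(\<lambda>n. \<epsilon>0 * inverse (real (Suc (Suc n)))) \<longlonglongrightarrow> \<epsilon>0 * 0"
    by (intro tendsto_mult tendsto_const LIMSEQ_Suc[OF LIMSEQ_inverse_real_of_nat])
  then have lim: "\<delta> \<longlonglongrightarrow> 0" by (simp add: \<delta>_def[abs_def] divide_inverse)
  have "\<forall>\<^sub>F n in sequentially. \<delta> n \<in> {0<..} \<and> \<delta> n \<noteq> 0"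
  proof (rule always_eventually, rule allI)
    show "\<delta> n \<in> {0<..} \<and> \<delta> n \<noteq> 0" for n using \<delta>(1)[of n] by simp
  qed
  then have filt: "filterlim \<delta> (at_right 0) sequentially"
    unfolding filterlim_at using lim by simp
  define f where "f n = Phie (\<delta> n)" for n
  define f' where "f' n = DPhie (\<delta> n)" for n
  define g' where "g' x h = (\<Sum>i\<in>UNIV. h $ i *\<^sub>R G i x)" for x h :: "(real, 'n) vec"
  have inD: "dilation w (\<delta> n) x \<in> Phi_dom" if "x \<in> cball 0 R" for n x
    using \<epsilon>0(3)[OF \<delta>] that by simp
  have der: "(f n has_derivative f' n x) (at x within cball 0 R)" if "x \<in> cball 0 R" for n x
    unfolding f_def f'_def
    by (rule has_derivative_at_withinI[OF Phie_has_derivative[OF inD[OF that]]])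
  have close: "\<forall>\<^sub>F n in sequentially. \<forall>x\<in>cball 0 R. \<forall>h. norm (f' n x h - g' x h) \<le> e * norm h"
    if e: "e > 0" for e
  proof -
    have "e / real CARD('n) > 0" using e by simp
    then have "\<forall>\<^sub>F \<epsilon> in at_right 0. \<forall>i\<in>UNIV. \<forall>x\<in>cball 0 R. dist (DPhie \<epsilon> x (axis i 1)) (G i x) < e / real CARD('n)"
      using DPhie_axis_limit[OF R(1)] by (intro eventually_ball_finite) (auto simp: uniform_limit_iff)
    then have "\<forall>\<^sub>F n in sequentially. \<forall>i\<in>UNIV. \<forall>x\<in>cball 0 R. dist (DPhie (\<delta> n) x (axis i 1)) (G i x) < e / real CARD('n)"
      using filt unfolding filterlim_iff by blast
    then show ?thesis
    proof eventually_elim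
      case (elim n)
      show ?case
      proof (intro ballI allI)
        fix x h :: "(real, 'n) vec" assume x: "x \<in> cball 0 R"
        note l = DPhie_linear[OF inD[OF x]]
        have "f' n x h = f' n x (\<Sum>i\<in>UNIV. h $ i *\<^sub>R axis i 1)" by (simp only: axis_combination)
        also have "\<dots> = (\<Sum>i\<in>UNIV. h $ i *\<^sub>R DPhie (\<delta> n) x (axis i 1))"
          by (simp only: f'_def linear_sum[OF l] linear_scale[OF l])
        finally have "f' n x h - g' x h = (\<Sum>i\<in>UNIV. h $ i *\<^sub>R (DPhie (\<delta> n) x (axis i 1) - G i x))"
          by (simp add: g'_def scaleR_diff_right sum_subtractf)
        also have "norm \<dots> \<le> real CARD('n) * (norm h * (e / real CARD('n)))"
          by (rule norm_sum_scaleR_bound)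
            (use elim x component_le_norm_cart in \<open>auto simp: dist_norm intro: less_imp_le\<close>)
        also have "\<dots> = e * norm h" by simp
        finally show "norm (f' n x h - g' x h) \<le> e * norm h" .
      qed
    qed
  qed
  have lim0: "(\<lambda>n. f n 0) \<longlonglongrightarrow> 0" by (simp add: f_def Phie_zero)
  obtain \<phi> where \<phi>: "\<And>x. x \<in> cball 0 R \<Longrightarrow> (\<lambda>n. f n x) \<longlonglongrightarrow> \<phi> x"
    "\<And>x. x \<in> cball 0 R \<Longrightarrow> (\<phi> has_derivative g' x) (at x within cball 0 R)"
    using has_derivative_sequence[OF convex_cball der close _ lim0] R(1) by force
  have \<phi>L: "\<phi> y = L y" if y: "y \<in> cball 0 R" for y
  proof (rule LIMSEQ_unique[OF \<phi>(1)[OF y]])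
    have "((\<lambda>\<epsilon>. Phie \<epsilon> y) \<longlongrightarrow> L y) (at_right 0)" by (rule tendsto_uniform_limitI[OF Phie_limit[OF R(1)] y])
    then show "(\<lambda>n. f n y) \<longlonglongrightarrow> L y" unfolding f_def by (rule filterlim_compose[OF _ filt])
  qed
  have xb: "x \<in> ball 0 R" using R(2) by simp
  have "(\<phi> has_derivative g' x) (at x)"
    using \<phi>(2)[of x] xb at_within_interior[of x "cball 0 R"] by simp
  then have "(L has_derivative g' x) (at x)"
    by (rule has_derivative_transform_within_open[OF _ open_ball xb]) (use \<phi>L in simp)
  moreover have "(L has_derivative L) (at x)"
    by (rule bounded_linear_imp_has_derivative) (use L_linear linear_conv_bounded_linear in blast)
  ultimately have "g' x = L" by (rule has_derivative_unique)
  moreover have "g' x (axis i 1) = G i x"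
  proof -
    have "g' x (axis i 1) = (\<Sum>j\<in>UNIV. if j = i then G j x else 0)"
      unfolding g'_def by (rule sum.cong) (auto simp: axis_def)
    then show ?thesis by simp
  qed
  ultimately show ?thesis by simp
qed

text \<open>Pass to the limit in the relation between the rescaled frames.\<close>

lemma hat_frames: "L (X.Xhat j x) = (\<Sum>i\<in>UNIV. c p i j *\<^sub>R Y.Xhat i (L x))"
proof -
  define R where "R = norm x + 1"
  have R: "R > 0" "norm x < R" "norm (L x) < R" by (auto simp: R_def L_norm intro: add_nonneg_pos)
  have sub: "ball 0 R \<subseteq> cball (0 :: (real, 'n) vec) R" by auto
  obtain \<epsilon>0 where \<epsilon>0: "0 < \<epsilon>0" "\<epsilon>0 \<le> 1" "\<And>\<epsilon> x. 0 < \<epsilon> \<Longrightarrow> \<epsilon> < \<epsilon>0 \<Longrightarrow> norm x \<le> R \<Longrightarrow> dilation w \<epsilon> x \<in> Phi_dom"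
    by (rule dilation_into[where w=w, OF X.w_pos open_Phi_dom zero_Phi_dom R(1)]) blast
  have ev: "\<forall>\<^sub>F \<epsilon> in at_right 0. 0 < \<epsilon> \<and> \<epsilon> < \<epsilon>0" using eventually_at_right_real[OF \<epsilon>0(1)] by simp
  have xc: "x \<in> cball 0 R" using R by simp
  have P: "((\<lambda>\<epsilon>. Phie \<epsilon> x) \<longlongrightarrow> L x) (at_right 0)" by (rule tendsto_uniform_limitI[OF Phie_limit[OF R(1)] xc])
  have Xl: "((\<lambda>\<epsilon>. X.Xe \<epsilon> j x) \<longlongrightarrow> X.Xhat j x) (at_right 0)" for j
    by (rule tendsto_uniform_limitI[OF X.Xe_limit[OF R(1)] xc])
  have Yl: "((\<lambda>\<epsilon>. Y.Xe \<epsilon> i (Phie \<epsilon> x)) \<longlongrightarrow> Y.Xhat i (L x)) (at_right 0)" for i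
  proof (rule uniform_limit_at_moving_point[OF uniform_limit_on_subset[OF Y.Xe_limit[OF R(1)] sub] P R(3)])
    show "\<forall>\<^sub>F \<epsilon> in at_right 0. continuous_on (ball 0 R) (Y.Xe \<epsilon> i)"
      using ev
    proof eventually_elim
      case (elim \<epsilon>)
      show ?case
      proof (rule continuous_at_imp_continuous_on, rule ballI)
        fix y :: "(real, 'n) vec" assume "y \<in> ball 0 R"
        then have "dilation w \<epsilon> y \<in> V" using \<epsilon>0(3)[of \<epsilon> y] elim Phi_dom_V by auto
        then show "isCont (Y.Xe \<epsilon> i) y" by (rule has_derivative_continuous[OF Y.Xe_has_derivative])
      qed
    qed
  qed simp
  have Dl: "((\<lambda>\<epsilon>. DPhie \<epsilon> x (axis i 1)) \<longlongrightarrow> L (axis i 1)) (at_right 0)" for i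
    using tendsto_uniform_limitI[OF DPhie_axis_limit[OF R(1)] xc, of i] by (simp add: G_eq)
  have dil0: "((\<lambda>\<epsilon>. dilation w \<epsilon> x) \<longlongrightarrow> 0) (at_right 0)"
  proof (rule vec_tendstoI)
    fix i
    have "((\<lambda>\<epsilon>. \<epsilon> ^ w i * x $ i) \<longlongrightarrow> 0 ^ w i * x $ i) (at_right 0)" by (intro tendsto_intros)
    then show "((\<lambda>\<epsilon>. dilation w \<epsilon> x $ i) \<longlongrightarrow> (0 :: (real, 'n) vec) $ i) (at_right 0)"
      using X.w_pos[of i] by (simp add: dilation_nth power_0_left)
  qed
  have cl: "((\<lambda>\<epsilon>. c (F (dilation w \<epsilon> x)) i j) \<longlongrightarrow> c p i j) (at_right 0)" for i
    using isCont_tendsto_compose[OF c_isCont dil0, of i j] by (simp add: X.F_zero)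
  have lhs: "((\<lambda>\<epsilon>. \<Sum>i\<in>UNIV. X.Xe \<epsilon> j x $ i *\<^sub>R DPhie \<epsilon> x (axis i 1)) \<longlongrightarrow>
      (\<Sum>i\<in>UNIV. X.Xhat j x $ i *\<^sub>R L (axis i 1))) (at_right 0)"
    by (intro tendsto_sum tendsto_scaleR tendsto_vec_nth Xl Dl)
  have rhs: "((\<lambda>\<epsilon>. \<Sum>i\<in>UNIV. c (F (dilation w \<epsilon> x)) i j *\<^sub>R Y.Xe \<epsilon> i (Phie \<epsilon> x)) \<longlongrightarrow>
      (\<Sum>i\<in>UNIV. c p i j *\<^sub>R Y.Xhat i (L x))) (at_right 0)"
    by (intro tendsto_sum tendsto_scaleR cl Yl)
  have "\<forall>\<^sub>F \<epsilon> in at_right 0. (\<Sum>i\<in>UNIV. c (F (dilation w \<epsilon> x)) i j *\<^sub>R Y.Xe \<epsilon> i (Phie \<epsilon> x)) =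
      (\<Sum>i\<in>UNIV. X.Xe \<epsilon> j x $ i *\<^sub>R DPhie \<epsilon> x (axis i 1))"
    using ev
  proof eventually_elim
    case (elim \<epsilon>)
    have D: "dilation w \<epsilon> x \<in> Phi_dom" using \<epsilon>0(3)[of \<epsilon> x] elim R by simp
    note l = DPhie_linear[OF D]
    have "DPhie \<epsilon> x (X.Xe \<epsilon> j x) = DPhie \<epsilon> x (\<Sum>i\<in>UNIV. X.Xe \<epsilon> j x $ i *\<^sub>R axis i 1)"
      by (simp only: axis_combination)
    then show ?case using DPhie_frame[OF D, of j] elim by (simp add: linear_sum[OF l] linear_scale[OF l])
  qed
  from Lim_transform_eventually[OF rhs this] lhs
  have "(\<Sum>i\<in>UNIV. c p i j *\<^sub>R Y.Xhat i (L x)) = (\<Sum>i\<in>UNIV. X.Xhat j x $ i *\<^sub>R L (axis i 1))"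
    using tendsto_unique[OF trivial_limit_at_right_real] by blast
  also have "\<dots> = L (\<Sum>i\<in>UNIV. X.Xhat j x $ i *\<^sub>R axis i 1)"
    by (simp add: linear_sum[OF L_linear] linear_scale[OF L_linear])
  finally show ?thesis by (simp only: axis_combination)
qed

end

section \<open>Invariance of the distance\<close>

lemma orthonormal_combination_length:
  fixes C :: "'i \<Rightarrow> 'i \<Rightarrow> real"
  assumes I: "finite I" and C: "\<And>j k. j \<in> I \<Longrightarrow> k \<in> I \<Longrightarrow> (\<Sum>i\<in>I. C i j * C i k) = (if j = k then 1 else 0)"
  shows "(\<Sum>i\<in>I. (\<Sum>j\<in>I. C i j * h j)\<^sup>2) = (\<Sum>j\<in>I. (h j)\<^sup>2)"
proof -
  have "(\<Sum>i\<in>I. (\<Sum>j\<in>I. C i j * h j)\<^sup>2) = (\<Sum>i\<in>I. \<Sum>j\<in>I. \<Sum>k\<in>I. (C i j * C i k) * (h j * h k))"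
    by (simp add: power2_eq_square sum_product mult_ac)
  also have "\<dots> = (\<Sum>j\<in>I. \<Sum>i\<in>I. \<Sum>k\<in>I. (C i j * C i k) * (h j * h k))" by (rule sum.swap)
  also have "\<dots> = (\<Sum>j\<in>I. \<Sum>k\<in>I. \<Sum>i\<in>I. (C i j * C i k) * (h j * h k))"
    by (rule sum.cong[OF refl sum.swap])
  also have "\<dots> = (\<Sum>j\<in>I. \<Sum>k\<in>I. (if j = k then 1 else 0) * (h j * h k))"
    by (intro sum.cong refl) (simp add: C flip: sum_distrib_right)
  also have "\<dots> = (\<Sum>j\<in>I. \<Sum>k\<in>I. if j = k then h j * h k else 0)"
    by (intro sum.cong refl) simp
  also have "\<dots> = (\<Sum>j\<in>I. (h j)\<^sup>2)" using I by (simp add: power2_eq_square)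
  finally show ?thesis .
qed

text \<open>The image of a horizontal curve is horizontal with the controls rotated by an orthogonal matrix,
  which leaves the length unchanged.\<close>

lemma frame_distance_le:
  fixes L :: "real ^ 'n::finite \<Rightarrow> real ^ 'n"
  assumes I: "finite I" and L: "linear L" "\<And>v. norm (L v) = norm v"
    and C: "\<And>j k. j \<in> I \<Longrightarrow> k \<in> I \<Longrightarrow> (\<Sum>i\<in>I. C i j * C i k) = (if j = k then 1 else 0)"
    and rel: "\<And>j v. j \<in> I \<Longrightarrow> L (Z j v) = (\<Sum>i\<in>I. C i j *\<^sub>R Z' i (L v))"
  shows "frame_distance I Z' (L x) (L y) \<le> frame_distance I Z x y"
  unfolding frame_distance_def
proof (rule INF_greatest, clarify)
  fix \<gamma> h assume hc: "horizontal_curve I Z x y \<gamma> h"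
  let ?\<gamma> = "\<lambda>t. L (\<gamma> t)" and ?h = "\<lambda>i t. \<Sum>j\<in>I. C i j * h j t"
  have bl: "bounded_linear L" using L(1) linear_conv_bounded_linear by blast
  have dist: "dist (L a) (L b) = dist a b" for a b
    using L(2)[of "a - b"] by (simp add: dist_norm linear_diff[OF L(1)])
  have "horizontal_curve I Z' (L x) (L y) ?\<gamma> ?h"
    unfolding horizontal_curve_def
  proof (intro conjI ballI)
    show "absolutely_continuous_on {0..1} ?\<gamma>"
      using hc unfolding horizontal_curve_def absolutely_continuous_on_def by (simp add: dist)
    show "?\<gamma> 0 = L x" "?\<gamma> 1 = L y" using hc by (auto simp: horizontal_curve_def)
    show "?h i \<in> borel_measurable (lebesgue_on {0..1})" for i
      by (intro borel_measurable_sum borel_measurable_times borel_measurable_const)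
        (use hc in \<open>auto simp: horizontal_curve_def\<close>)
    have "AE t in lebesgue_on {0..1}.
        (\<gamma> has_vector_derivative (\<Sum>i\<in>I. h i t *\<^sub>R Z i (\<gamma> t))) (at t within {0..1})"
      using hc by (simp add: horizontal_curve_def)
    then show "AE t in lebesgue_on {0..1}.
        (?\<gamma> has_vector_derivative (\<Sum>i\<in>I. ?h i t *\<^sub>R Z' i (?\<gamma> t))) (at t within {0..1})"
    proof eventually_elim
      case (elim t)
      have "(?\<gamma> has_vector_derivative L (\<Sum>i\<in>I. h i t *\<^sub>R Z i (\<gamma> t))) (at t within {0..1})"
        by (rule bounded_linear.has_vector_derivative[OF bl elim])
      moreover have "L (\<Sum>j\<in>I. h j t *\<^sub>R Z j (\<gamma> t)) = (\<Sum>i\<in>I. ?h i t *\<^sub>R Z' i (?\<gamma> t))"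
      proof -
        have "L (\<Sum>j\<in>I. h j t *\<^sub>R Z j (\<gamma> t)) = (\<Sum>j\<in>I. \<Sum>i\<in>I. (C i j * h j t) *\<^sub>R Z' i (?\<gamma> t))"
          by (simp add: linear_sum[OF L(1)] linear_scale[OF L(1)] rel scaleR_sum_right mult.commute)
        also have "\<dots> = (\<Sum>i\<in>I. \<Sum>j\<in>I. (C i j * h j t) *\<^sub>R Z' i (?\<gamma> t))" by (rule sum.swap)
        finally show ?thesis by (simp add: scaleR_sum_left)
      qed
      ultimately show ?case by simp
    qed
  qed
  then have "(INF (\<gamma>, h)\<in>{(\<gamma>, h). horizontal_curve I Z' (L x) (L y) \<gamma> h}.
        \<integral>\<^sup>+ t. ennreal (sqrt (\<Sum>i\<in>I. (h i t)\<^sup>2)) \<partial>lebesgue_on {0..1})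
      \<le> (\<integral>\<^sup>+ t. ennreal (sqrt (\<Sum>i\<in>I. (?h i t)\<^sup>2)) \<partial>lebesgue_on {0..1})"
    by (intro INF_lower2[of "(?\<gamma>, ?h)"]) auto
  also have "\<dots> = (\<integral>\<^sup>+ t. ennreal (sqrt (\<Sum>i\<in>I. (h i t)\<^sup>2)) \<partial>lebesgue_on {0..1})"
    by (simp add: orthonormal_combination_length[OF I C])
  finally show "(INF (\<gamma>, h)\<in>{(\<gamma>, h). horizontal_curve I Z' (L x) (L y) \<gamma> h}.
        \<integral>\<^sup>+ t. ennreal (sqrt (\<Sum>i\<in>I. (h i t)\<^sup>2)) \<partial>lebesgue_on {0..1})
      \<le> (\<integral>\<^sup>+ t. ennreal (sqrt (\<Sum>i\<in>I. (h i t)\<^sup>2)) \<partial>lebesgue_on {0..1})" .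
qed

context two_frames_radius
begin

lemma hat_distance:
  defines "I \<equiv> {i. pos i \<le> nn 1}"
  shows "frame_distance I Y.Xhat (L x) (L y) = frame_distance I X.Xhat x y"
proof (rule antisym)
  have I: "I = {i. w i \<le> 1}" using X.weights(4)[of 1] X.s_ge_1 by (auto simp: I_def)
  have fin: "finite I" by simp
  have z: "c p i j = 0" if "i \<in> I \<longleftrightarrow> j \<notin> I" for i j
    using c_block[OF p_W, of i j] that by (auto simp: I)
  have cols: "(\<Sum>i\<in>I. c p i j * c p i k) = (if j = k then 1 else 0)" if "j \<in> I" "k \<in> I" for j k
  proof -
    have "(\<Sum>i\<in>I. c p i j * c p i k) = (\<Sum>i\<in>UNIV. c p i j * c p i k)"
      by (rule sum.mono_neutral_left) (use z that in auto)
    then show ?thesis using c_columns[OF p_W] by simp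
  qed
  have rows: "(\<Sum>j\<in>I. c p i j * c p k j) = (if i = k then 1 else 0)" if "i \<in> I" "k \<in> I" for i k
  proof -
    have "(\<Sum>j\<in>I. c p i j * c p k j) = (\<Sum>j\<in>UNIV. c p i j * c p k j)"
      by (rule sum.mono_neutral_left) (use z that in auto)
    then show ?thesis using c_rows[OF p_W] by simp
  qed
  have rel: "L (X.Xhat j v) = (\<Sum>i\<in>I. c p i j *\<^sub>R Y.Xhat i (L v))" if "j \<in> I" for j v
    unfolding hat_frames by (rule sum.mono_neutral_right) (use z that in auto)
  show "frame_distance I Y.Xhat (L x) (L y) \<le> frame_distance I X.Xhat x y"
    by (rule frame_distance_le[where L=L and C="c p" and Z=X.Xhat and Z'=Y.Xhat,
        OF fin L_linear L_norm cols rel])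
  have bij: "bij L" by (rule orthogonal_transformation_bij[OF L_orthogonal])
  let ?K = "inv L"
  have KL: "?K (L v) = v" and LK: "L (?K v) = v" for v
    using bij by (auto simp: bij_is_inj bij_is_surj surj_f_inv_f)
  have Klin: "linear ?K"
    using L_linear bij by (simp add: bij_is_inj inj_linear_imp_inv_linear)
  have Knorm: "norm (?K v) = norm v" for v using L_norm[of "?K v"] LK by simp
  have rel': "?K (Y.Xhat i v) = (\<Sum>j\<in>I. c p i j *\<^sub>R X.Xhat j (?K v))" if "i \<in> I" for i v
  proof -
    have "L (\<Sum>j\<in>I. c p i j *\<^sub>R X.Xhat j (?K v)) = (\<Sum>j\<in>I. \<Sum>k\<in>I. (c p i j * c p k j) *\<^sub>R Y.Xhat k v)"
      by (simp add: linear_sum[OF L_linear] linear_scale[OF L_linear] rel LK scaleR_sum_right)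
    also have "\<dots> = (\<Sum>k\<in>I. \<Sum>j\<in>I. (c p i j * c p k j) *\<^sub>R Y.Xhat k v)" by (rule sum.swap)
    also have "\<dots> = (\<Sum>k\<in>I. (if i = k then 1 else 0) *\<^sub>R Y.Xhat k v)"
      by (rule sum.cong[OF refl]) (simp add: rows that flip: scaleR_sum_left)
    also have "\<dots> = (\<Sum>k\<in>I. if k = i then Y.Xhat k v else 0)" by (rule sum.cong) auto
    also have "\<dots> = Y.Xhat i v" using that by simp
    finally show ?thesis using KL by metis
  qed
  have "frame_distance I X.Xhat (?K (L x)) (?K (L y)) \<le> frame_distance I Y.Xhat (L x) (L y)"
    by (rule frame_distance_le[where L="?K" and C="\<lambda>j i. c p i j" and Z=Y.Xhat and Z'=X.Xhat,
        OF fin Klin Knorm rows rel'])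
  then show "frame_distance I X.Xhat x y \<le> frame_distance I Y.Xhat (L x) (L y)" by (simp add: KL)
qed

lemma rescaled_transition_converges:
  assumes B: "B \<subseteq> V" "bounded B"
  shows "\<forall>\<^sub>F \<epsilon> in at_right 0. \<forall>x\<in>B. dilation w \<epsilon> x \<in> V \<and> F (dilation w \<epsilon> x) \<in> F' ` V"
    "uniform_limit B (\<lambda>\<epsilon> x. dilation w (1 / \<epsilon>) (inv_into V F' (F (dilation w \<epsilon> x)))) L (at_right 0)"
proof -
  obtain R where R: "R > 0" "\<And>x. x \<in> B \<Longrightarrow> norm x \<le> R" using B(2) by (auto simp: bounded_pos)
  obtain \<epsilon>0 where \<epsilon>0: "0 < \<epsilon>0" "\<epsilon>0 \<le> 1" "\<And>\<epsilon> x. 0 < \<epsilon> \<Longrightarrow> \<epsilon> < \<epsilon>0 \<Longrightarrow> norm x \<le> R \<Longrightarrow> dilation w \<epsilon> x \<in> Phi_dom"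
    by (rule dilation_into[where w=w, OF X.w_pos open_Phi_dom zero_Phi_dom R(1)]) blast
  show "\<forall>\<^sub>F \<epsilon> in at_right 0. \<forall>x\<in>B. dilation w \<epsilon> x \<in> V \<and> F (dilation w \<epsilon> x) \<in> F' ` V"
    using eventually_at_right_real[OF \<epsilon>0(1)]
  proof eventually_elim
    case (elim \<epsilon>)
    show ?case
    proof
      fix x assume "x \<in> B"
      then have "dilation w \<epsilon> x \<in> Phi_dom" using \<epsilon>0(3)[of \<epsilon> x] elim R(2) by simp
      then show "dilation w \<epsilon> x \<in> V \<and> F (dilation w \<epsilon> x) \<in> F' ` V" unfolding Phi_dom_def by blast
    qed
  qed
  have "uniform_limit B Phie L (at_right 0)"
    by (rule uniform_limit_on_subset[OF Phie_limit[OF R(1)]]) (use R(2) in auto)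
  then show "uniform_limit B (\<lambda>\<epsilon> x. dilation w (1 / \<epsilon>) (inv_into V F' (F (dilation w \<epsilon> x)))) L (at_right 0)"
    by (simp add: Phie_def[abs_def] Phi_def)
qed

end

section \<open>Isometry of the nilpotent approximations\<close>

lemma exponential_frameI:
  fixes S :: "('a::{t2_space,second_countable_topology}, 'n::{finite,linorder}, 'e::euclidean_space) sr_structure"
  assumes "sub_riemannian_manifold S" "privileged_frame S W s nn X"
    "exponential_coordinates (atlas S) W X p V F"
  shows "exponential_frame S V F W s nn X p"
proof unfold_locales
  have "exp_reaches (atlas S) W (\<lambda>q. \<Sum>i\<in>UNIV. (x $ i) *\<^sub>R X i q) p (F x)" if "x \<in> V" for x
    using assms(3) that by (simp add: exponential_coordinates_def)
  moreover have "F x \<in> W" if "x \<in> V" for x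
  proof -
    have "exp_reaches (atlas S) W (\<lambda>q. \<Sum>i\<in>UNIV. (x $ i) *\<^sub>R X i q) p (F x)"
      using assms(3) that by (simp add: exponential_coordinates_def)
    then obtain \<gamma> :: "real \<Rightarrow> 'a" where "\<gamma> ` {0..1} \<subseteq> W" "\<gamma> 1 = F x"
      unfolding exp_reaches_def by blast
    moreover have "\<gamma> 1 \<in> \<gamma> ` {0..1}" by (rule imageI) simp
    ultimately show ?thesis by auto
  qed
  ultimately show "F ` V \<subseteq> W"
    "\<And>x. x \<in> V \<Longrightarrow> exp_reaches (atlas S) W (\<lambda>q. \<Sum>i\<in>UNIV. (x $ i) *\<^sub>R X i q) p (F x)" by auto
qed (use assms in \<open>auto simp: sub_riemannian_manifold_def exponential_coordinates_def\<close>)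

theorem theorem1p1:
  fixes S :: "('a::{t2_space,second_countable_topology}, 'n::{finite,linorder}, 'e::euclidean_space) sr_structure"
    and \<omega> :: "'a \<Rightarrow> ('n \<Rightarrow> (real, 'n) vec) \<Rightarrow> real"
    and g :: "'a \<Rightarrow> (real, 'n) vec \<Rightarrow> (real, 'n) vec \<Rightarrow> real"
    and p :: 'a and W :: "'a set"
    and s :: nat and nn :: "nat \<Rightarrow> nat"
    and X Y :: "'n \<Rightarrow> 'a \<Rightarrow> (real, 'n) vec"
    and V :: "((real, 'n) vec) set" and F\<^sub>X F\<^sub>Y :: "(real, 'n) vec \<Rightarrow> 'a"
  assumes "sub_riemannian_measure_manifold S \<omega>"
    and "riemannian_metric (atlas S) g" and "extends_sr_metric S g"
    and "regular_point S p" and "open W" and "p \<in> W"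
    and "privileged_orthonormal_frame S g W s nn X"
    and "privileged_orthonormal_frame S g W s nn Y"
    and "exponential_coordinates (atlas S) W X p V F\<^sub>X"
    and "exponential_coordinates (atlas S) W Y p V F\<^sub>Y"
  shows "\<exists>L :: (real, 'n) vec \<Rightarrow> (real, 'n) vec.
     orthogonal_transformation L \<and>
     (\<forall>B. B \<subseteq> V \<and> bounded B \<longrightarrow>
        (\<forall>\<^sub>F \<epsilon> in at_right 0. \<forall>x\<in>B. dilation (weight s nn) \<epsilon> x \<in> V \<and> F\<^sub>X (dilation (weight s nn) \<epsilon> x) \<in> F\<^sub>Y ` V) \<and>
        uniform_limit B (\<lambda>\<epsilon> x. dilation (weight s nn) (1 / \<epsilon>) (inv_into V F\<^sub>Y (F\<^sub>X (dilation (weight s nn) \<epsilon> x)))) L (at_right 0)) \<and>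
     (((\<lambda>x. inv_into V F\<^sub>Y (F\<^sub>X x)) has_derivative L) (at 0) \<and>
      (\<forall>i j. weight s nn i \<noteq> weight s nn j \<longrightarrow> matrix L $ i $ j = 0)) \<and>
     (\<forall>x y.
        frame_distance {i. pos i \<le> nn 1} (nilpotent_approximation (atlas S) (weight s nn) V F\<^sub>Y Y) (L x) (L y) =
        frame_distance {i. pos i \<le> nn 1} (nilpotent_approximation (atlas S) (weight s nn) V F\<^sub>X X) x y)"
proof -
  have S: "sub_riemannian_manifold S"
    using assms(1) by (simp add: sub_riemannian_measure_manifold_def)
  interpret X: exponential_frame S V F\<^sub>X W s nn X p
    by (rule exponential_frameI[OF S _ assms(9)]) (use assms(7) in \<open>simp add: privileged_orthonormal_frame_def\<close>)
  interpret Y: exponential_frame S V F\<^sub>Y W s nn Y p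
    by (rule exponential_frameI[OF S _ assms(10)]) (use assms(8) in \<open>simp add: privileged_orthonormal_frame_def\<close>)
  interpret two_frames S V F\<^sub>X F\<^sub>Y W s nn X Y p g
    by unfold_locales
      (use assms(2,7,8) in \<open>auto simp: riemannian_metric_def privileged_orthonormal_frame_def\<close>)
  obtain \<rho> K where \<rho>K: "\<rho> > 0" "K > 0" "ball 0 \<rho> \<subseteq> Phi_dom" "real CARD('n) * (K * \<rho>) \<le> 1 / 2"
    "\<And>\<epsilon> k x. 0 < \<epsilon> \<Longrightarrow> \<epsilon> \<le> 1 \<Longrightarrow> norm x < \<rho> \<Longrightarrow> norm (X.Xe \<epsilon> k x - axis k 1) \<le> K * norm x"
    "\<And>\<epsilon> k x. 0 < \<epsilon> \<Longrightarrow> \<epsilon> \<le> 1 \<Longrightarrow> norm x < \<rho> \<Longrightarrow> norm (Y.Xe \<epsilon> k x - axis k 1) \<le> K * norm x"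
    by (rule good_radius) blast
  interpret two_frames_radius S V F\<^sub>X F\<^sub>Y W s nn X Y p g \<rho> K
    by unfold_locales (use \<rho>K in auto)
  show ?thesis
  proof (intro exI[of _ L] conjI allI impI)
    show "orthogonal_transformation L" by (rule L_orthogonal)
    show "((\<lambda>x. inv_into V F\<^sub>Y (F\<^sub>X x)) has_derivative L) (at 0)"
      using Phi_derivative_zero by (simp add: Phi_def[abs_def])
    show "matrix L $ i $ j = 0" if "weight s nn i \<noteq> weight s nn j" for i j
      using that by (rule L_matrix)
    show "frame_distance {i. pos i \<le> nn 1} (nilpotent_approximation (atlas S) (weight s nn) V F\<^sub>Y Y) (L x) (L y) =
        frame_distance {i. pos i \<le> nn 1} (nilpotent_approximation (atlas S) (weight s nn) V F\<^sub>X X) x y" for x y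
      using hat_distance[of x y] by (simp only: X.Xhat_def Y.Xhat_def)
    fix B assume "B \<subseteq> V \<and> bounded B"
    then show "\<forall>\<^sub>F \<epsilon> in at_right 0. \<forall>x\<in>B. dilation (weight s nn) \<epsilon> x \<in> V \<and> F\<^sub>X (dilation (weight s nn) \<epsilon> x) \<in> F\<^sub>Y ` V"
      "uniform_limit B (\<lambda>\<epsilon> x. dilation (weight s nn) (1 / \<epsilon>) (inv_into V F\<^sub>Y (F\<^sub>X (dilation (weight s nn) \<epsilon> x)))) L (at_right 0)"
      using rescaled_transition_converges by auto
  qed
qed

end
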